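(* Let $\mathbb{G}$ be a step-two Carnot group with Lie algebra stratification $\mathfrak{g}=\mathfrak{g}_1\oplus\mathfrak{g}_2$, and let $Q=\dim\mathfrak{g}_1+2\dim\mathfrak{g}_2$ be its homogeneous dimension. For every left-invariant Riemannian metric $g$ on $\mathbb{G}$, with Riemannian volume $\nu_g$ and open Riemannian balls $B_g(p,r)$, one has $$\frac{\nu_g(B_g(p,R))}{\nu_g(B_g(p,r))}\le\left(\frac{R}{r}\right)^Q\qquad\text{for all } p\in\mathbb{G}\text{ and all } 0<r\le R.$$
   Context: A step-two Carnot group is a connected and simply connected (real, finite-dimensional) Lie group $\mathbb{G}$ whose Lie algebra $\mathfrak{g}$ of left-invariant vector fields admits a stratification, i.e. a direct sum decomposition into linear subspaces $\mathfrak{g}=\mathfrak{g}_1\oplus\mathfrak{g}_2$ with $[\mathfrak{g}_1,\mathfrak{g}_1]=\mathfrak{g}_2$ and $[\mathfrak{g}_1,\mathfrak{g}_2]=\{0\}$. The stratification need not be unique, but $\mathfrak{g}_2=[\mathfrak{g},\mathfrak{g}]$ always, so $Q=\dim\mathfrak{g}_1+2\dim\mathfrak{g}_2$ does not depend on the choice. Left-invariant Riemannian metrics on $\mathbb{G}$ correspond to inner products on $\mathfrak{g}$: given an inner product with orthonormal basis $X_1,\dots,X_n$ of $\mathfrak{g}$, the associated metric $g$ is the one for which the left-invariant vector fields $X_1(p),\dots,X_n(p)$ are orthonormal in $T_p\mathbb{G}$ for every $p$. The Riemannian distance $d_g(p,q)$ is the infimum of the lengths $\int_0^1\sqrt{g_{\gamma(\tau)}(\dot\gamma(\tau),\dot\gamma(\tau))}\,d\tau$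 over smooth paths $\gamma:[0,1]\to\mathbb{G}$ with $\gamma(0)=p$, $\gamma(1)=q$, and $B_g(p,r)=\{q\in\mathbb{G}: d_g(p,q)<r\}$. *)

theory Defs
  imports "HOL-Analysis.Analysis" "HOL-Library.Function_Algebras"
begin

text \<open>Vector fields will be functions into a real vector space. The pointwise structure makes
  \<open>subspace\<close>, \<open>span\<close> and \<open>dim\<close> available for sets of vector fields.\<close>

instantiation "fun" :: (type, real_vector) real_vector
begin

definition scaleR_fun :: "real \<Rightarrow> ('a \<Rightarrow> 'b) \<Rightarrow> 'a \<Rightarrow> 'b"
  where "scaleR_fun c f = (\<lambda>x. c *\<^sub>R f x)"

instance
  by standard (auto simp: scaleR_fun_def plus_fun_def fun_eq_iff scaleR_add_right scaleR_add_left)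

end


section \<open>Smooth functions on open sets\<close>

text \<open>\<open>Ck_on\<close> and \<open>smooth_on\<close> are only meant for open sets and finite-dimensional domains;
  there, continuity of all iterated directional derivatives is the usual \<open>C\<^sup>k\<close> condition.\<close>

primrec Ck_on ::
  "nat \<Rightarrow> ('a::real_normed_vector \<Rightarrow> 'b::real_normed_vector) \<Rightarrow> 'a set \<Rightarrow> bool"
where
  "Ck_on 0 f S \<longleftrightarrow> continuous_on S f"
| "Ck_on (Suc k) f S \<longleftrightarrow>
     (\<forall>x\<in>S. f differentiable (at x)) \<and>
     (\<forall>v. Ck_on k (\<lambda>x. frechet_derivative f (at x) v) S)"

definition smooth_on ::
  "'a::real_normed_vector set \<Rightarrow> ('a \<Rightarrow> 'b::real_normed_vector) \<Rightarrow> bool"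
  where "smooth_on S f \<longleftrightarrow> (\<forall>k. Ck_on k f S)"


section \<open>Smooth manifolds\<close>

text \<open>A chart is a pair \<open>(U, \<phi>)\<close>; the values of \<open>\<phi>\<close> outside \<open>U\<close> are irrelevant.
  The Hausdorff and second countability axioms are carried by the type classes of the
  underlying topological space, which is the whole type.\<close>

type_synonym ('g, 'n) chart = "'g set \<times> ('g \<Rightarrow> real ^ 'n)"

abbreviation chart_dom :: "('g, 'n) chart \<Rightarrow> 'g set"
  where "chart_dom \<equiv> fst"

abbreviation chart_map :: "('g, 'n) chart \<Rightarrow> 'g \<Rightarrow> real ^ 'n"
  where "chart_map \<equiv> snd"

definition chart_inv :: "('g, 'n) chart \<Rightarrow> real ^ 'n \<Rightarrow> 'g"
  where "chart_inv c = inv_into (chart_dom c) (chart_map c)"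

definition is_chart :: "('g::topological_space, 'n::finite) chart \<Rightarrow> bool"
  where "is_chart c \<longleftrightarrow>
    open (chart_dom c) \<and> open (chart_map c ` chart_dom c) \<and>
    homeomorphism (chart_dom c) (chart_map c ` chart_dom c) (chart_map c) (chart_inv c)"

definition smoothly_compatible :: "('g, 'n::finite) chart \<Rightarrow> ('g, 'n) chart \<Rightarrow> bool"
  where "smoothly_compatible c d \<longleftrightarrow>
    smooth_on (chart_map c ` (chart_dom c \<inter> chart_dom d)) (chart_map d \<circ> chart_inv c) \<and>
    smooth_on (chart_map d ` (chart_dom c \<inter> chart_dom d)) (chart_map c \<circ> chart_inv d)"

definition smooth_structure ::
  "('g::{t2_space,second_countable_topology}, 'n::finite) chart set \<Rightarrow> bool"
  where "smooth_structure A \<longleftrightarrow>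
    (\<forall>c\<in>A. is_chart c) \<and>
    (\<Union>c\<in>A. chart_dom c) = UNIV \<and>
    (\<forall>c\<in>A. \<forall>d\<in>A. smoothly_compatible c d) \<and>
    (\<forall>c. is_chart c \<and> (\<forall>d\<in>A. smoothly_compatible c d) \<longrightarrow> c \<in> A)"

text \<open>The tangent space at \<open>p\<close> is represented by \<open>real ^ 'n\<close>, a vector standing for the tangent
  vector with these coordinates in the chosen chart \<open>chart_at A p\<close>. The two maps
  \<open>tangent_to_chart\<close> and \<open>tangent_of_chart\<close> convert between this representation and the
  coordinates in an arbitrary chart around \<open>p\<close>.\<close>

definition chart_at :: "('g, 'n) chart set \<Rightarrow> 'g \<Rightarrow> ('g, 'n) chart"
  where "chart_at A p = (SOME c. c \<in> A \<and> p \<in> chart_dom c)"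

definition chart_change ::
  "('g, 'n::finite) chart \<Rightarrow> ('g, 'n) chart \<Rightarrow> 'g \<Rightarrow> real ^ 'n \<Rightarrow> real ^ 'n"
  where "chart_change c d p =
    frechet_derivative (chart_map d \<circ> chart_inv c) (at (chart_map c p))"

definition tangent_to_chart ::
  "('g, 'n::finite) chart set \<Rightarrow> ('g, 'n) chart \<Rightarrow> 'g \<Rightarrow> real ^ 'n \<Rightarrow> real ^ 'n"
  where "tangent_to_chart A c p = chart_change (chart_at A p) c p"

definition tangent_of_chart ::
  "('g, 'n::finite) chart set \<Rightarrow> ('g, 'n) chart \<Rightarrow> 'g \<Rightarrow> real ^ 'n \<Rightarrow> real ^ 'n"
  where "tangent_of_chart A c p = chart_change c (chart_at A p) p"

definition pushforward ::
  "('g, 'n::finite) chart set \<Rightarrow> ('g \<Rightarrow> 'g) \<Rightarrow> 'g \<Rightarrow> real ^ 'n \<Rightarrow> real ^ 'n"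
  where "pushforward A f p =
    frechet_derivative (chart_map (chart_at A (f p)) \<circ> f \<circ> chart_inv (chart_at A p))
      (at (chart_map (chart_at A p) p))"

definition local_field ::
  "('g, 'n::finite) chart set \<Rightarrow> ('g, 'n) chart \<Rightarrow> ('g \<Rightarrow> real ^ 'n) \<Rightarrow> real ^ 'n \<Rightarrow> real ^ 'n"
  where "local_field A c X x = tangent_to_chart A c (chart_inv c x) (X (chart_inv c x))"

definition smooth_vector_field ::
  "('g, 'n::finite) chart set \<Rightarrow> ('g \<Rightarrow> real ^ 'n) \<Rightarrow> bool"
  where "smooth_vector_field A X \<longleftrightarrow>
    (\<forall>c\<in>A. smooth_on (chart_map c ` chart_dom c) (local_field A c X))"

text \<open>In local coordinates,
  \<open>[X, Y]\<^sup>j = (\<Sum>i. X\<^sup>i \<partial>\<^sub>i Y\<^sup>j - Y\<^sup>i \<partial>\<^sub>i X\<^sup>j)\<close>.\<close>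

definition lie_bracket ::
  "('g, 'n::finite) chart set \<Rightarrow> ('g \<Rightarrow> real ^ 'n) \<Rightarrow> ('g \<Rightarrow> real ^ 'n) \<Rightarrow> 'g \<Rightarrow> real ^ 'n"
  where "lie_bracket A X Y p =
    (let c = chart_at A p; x = chart_map c p; Xc = local_field A c X; Yc = local_field A c Y in
     frechet_derivative Yc (at x) (Xc x) - frechet_derivative Xc (at x) (Yc x))"


section \<open>Lie groups and step-two Carnot groups\<close>

definition lie_group ::
  "('g::{t2_space,second_countable_topology}, 'n::finite) chart set \<Rightarrow>
   ('g \<Rightarrow> 'g \<Rightarrow> 'g) \<Rightarrow> 'g \<Rightarrow> ('g \<Rightarrow> 'g) \<Rightarrow> bool"
  where "lie_group A gmul gunit ginv \<longleftrightarrow>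
    smooth_structure A \<and> group gmul gunit ginv \<and>
    continuous_on UNIV (\<lambda>(p, q). gmul p q) \<and> continuous_on UNIV ginv \<and>
    (\<forall>c\<in>A. \<forall>d\<in>A. \<forall>e\<in>A.
      smooth_on
        {(x, y). x \<in> chart_map c ` chart_dom c \<and> y \<in> chart_map d ` chart_dom d \<and>
                 gmul (chart_inv c x) (chart_inv d y) \<in> chart_dom e}
        (\<lambda>(x, y). chart_map e (gmul (chart_inv c x) (chart_inv d y)))) \<and>
    (\<forall>c\<in>A. \<forall>d\<in>A.
      smooth_on
        {x \<in> chart_map c ` chart_dom c. ginv (chart_inv c x) \<in> chart_dom d}
        (\<lambda>x. chart_map d (ginv (chart_inv c x))))"

definition lie_algebra ::
  "('g, 'n::finite) chart set \<Rightarrow> ('g \<Rightarrow> 'g \<Rightarrow> 'g) \<Rightarrow> ('g \<Rightarrow> real ^ 'n) set"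
  where "lie_algebra A gmul =
    {X. smooth_vector_field A X \<and>
        (\<forall>a p. X (gmul a p) = pushforward A (gmul a) p (X p))}"

definition step_two_stratification ::
  "('g, 'n::finite) chart set \<Rightarrow> ('g \<Rightarrow> 'g \<Rightarrow> 'g) \<Rightarrow>
   ('g \<Rightarrow> real ^ 'n) set \<Rightarrow> ('g \<Rightarrow> real ^ 'n) set \<Rightarrow> bool"
  where "step_two_stratification A gmul g1 g2 \<longleftrightarrow>
    subspace g1 \<and> subspace g2 \<and>
    g1 \<inter> g2 = {0} \<and> {X + Y |X Y. X \<in> g1 \<and> Y \<in> g2} = lie_algebra A gmul \<and>
    span {lie_bracket A X Y |X Y. X \<in> g1 \<and> Y \<in> g1} = g2 \<and>
    (\<forall>X\<in>g1. \<forall>Y\<in>g2. lie_bracket A X Y = 0)"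

definition step_two_carnot_group ::
  "('g::{t2_space,second_countable_topology}, 'n::finite) chart set \<Rightarrow>
   ('g \<Rightarrow> 'g \<Rightarrow> 'g) \<Rightarrow> 'g \<Rightarrow> ('g \<Rightarrow> 'g) \<Rightarrow>
   ('g \<Rightarrow> real ^ 'n) set \<Rightarrow> ('g \<Rightarrow> real ^ 'n) set \<Rightarrow> bool"
  where "step_two_carnot_group A gmul gunit ginv g1 g2 \<longleftrightarrow>
    lie_group A gmul gunit ginv \<and>
    connected (UNIV :: 'g set) \<and> simply_connected (UNIV :: 'g set) \<and>
    step_two_stratification A gmul g1 g2"


section \<open>Riemannian metrics, distance and volume\<close>

definition local_metric ::
  "('g, 'n::finite) chart set \<Rightarrow> ('g \<Rightarrow> real ^ 'n \<Rightarrow> real ^ 'n \<Rightarrow> real) \<Rightarrow>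
   ('g, 'n) chart \<Rightarrow> real ^ 'n \<Rightarrow> real ^ 'n \<Rightarrow> real ^ 'n \<Rightarrow> real"
  where "local_metric A g c x v w =
    (let p = chart_inv c x in g p (tangent_of_chart A c p v) (tangent_of_chart A c p w))"

definition riemannian_metric ::
  "('g, 'n::finite) chart set \<Rightarrow> ('g \<Rightarrow> real ^ 'n \<Rightarrow> real ^ 'n \<Rightarrow> real) \<Rightarrow> bool"
  where "riemannian_metric A g \<longleftrightarrow>
    (\<forall>p. bilinear (g p) \<and> (\<forall>v w. g p v w = g p w v) \<and> (\<forall>v. v \<noteq> 0 \<longrightarrow> g p v v > 0)) \<and>
    (\<forall>c\<in>A. \<forall>v w. smooth_on (chart_map c ` chart_dom c) (\<lambda>x. local_metric A g c x v w))"

definition left_invariant_metric ::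
  "('g, 'n::finite) chart set \<Rightarrow> ('g \<Rightarrow> 'g \<Rightarrow> 'g) \<Rightarrow>
   ('g \<Rightarrow> real ^ 'n \<Rightarrow> real ^ 'n \<Rightarrow> real) \<Rightarrow> bool"
  where "left_invariant_metric A gmul g \<longleftrightarrow>
    (\<forall>a p v w. g (gmul a p) (pushforward A (gmul a) p v) (pushforward A (gmul a) p w) = g p v w)"

text \<open>Smoothness on the closed interval means smoothness on some open neighbourhood of it, so
  that the two-sided derivative below is the velocity at the end points as well.\<close>

definition smooth_path ::
  "('g::topological_space, 'n::finite) chart set \<Rightarrow> (real \<Rightarrow> 'g) \<Rightarrow> bool"
  where "smooth_path A \<gamma> \<longleftrightarrow>
    (\<exists>I. open I \<and> {0..1} \<subseteq> I \<and> continuous_on I \<gamma> \<and>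
      (\<forall>c\<in>A. smooth_on {t \<in> I. \<gamma> t \<in> chart_dom c} (chart_map c \<circ> \<gamma>)))"

definition velocity ::
  "('g, 'n::finite) chart set \<Rightarrow> (real \<Rightarrow> 'g) \<Rightarrow> real \<Rightarrow> real ^ 'n"
  where "velocity A \<gamma> t = vector_derivative (chart_map (chart_at A (\<gamma> t)) \<circ> \<gamma>) (at t)"

definition riemannian_length ::
  "('g, 'n::finite) chart set \<Rightarrow> ('g \<Rightarrow> real ^ 'n \<Rightarrow> real ^ 'n \<Rightarrow> real) \<Rightarrow>
   (real \<Rightarrow> 'g) \<Rightarrow> real"
  where "riemannian_length A g \<gamma> =
    integral {0..1} (\<lambda>t. sqrt (g (\<gamma> t) (velocity A \<gamma> t) (velocity A \<gamma> t)))"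

definition riemannian_dist ::
  "('g::topological_space, 'n::finite) chart set \<Rightarrow>
   ('g \<Rightarrow> real ^ 'n \<Rightarrow> real ^ 'n \<Rightarrow> real) \<Rightarrow> 'g \<Rightarrow> 'g \<Rightarrow> real"
  where "riemannian_dist A g p q =
    Inf {riemannian_length A g \<gamma> |\<gamma>. smooth_path A \<gamma> \<and> \<gamma> 0 = p \<and> \<gamma> 1 = q}"

definition riemannian_ball ::
  "('g::topological_space, 'n::finite) chart set \<Rightarrow>
   ('g \<Rightarrow> real ^ 'n \<Rightarrow> real ^ 'n \<Rightarrow> real) \<Rightarrow> 'g \<Rightarrow> real \<Rightarrow> 'g set"
  where "riemannian_ball A g p r = {q. riemannian_dist A g p q < r}"

text \<open>The Riemannian volume is the unique Borel measure with density \<open>sqrt (det (g\<^sub>i\<^sub>j))\<close> with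
  respect to Lebesgue measure in every chart; \<open>axis i 1\<close> are the standard basis vectors.\<close>

definition riemannian_volume ::
  "('g::topological_space, 'n::finite) chart set \<Rightarrow>
   ('g \<Rightarrow> real ^ 'n \<Rightarrow> real ^ 'n \<Rightarrow> real) \<Rightarrow> 'g measure \<Rightarrow> bool"
  where "riemannian_volume A g \<nu> \<longleftrightarrow>
    sets \<nu> = sets borel \<and>
    (\<forall>c\<in>A. \<forall>B\<in>sets borel. B \<subseteq> chart_dom c \<longrightarrow>
      emeasure \<nu> B =
        (\<integral>\<^sup>+x\<in>chart_map c ` B.
           ennreal (sqrt (det (\<chi> i j. local_metric A g c x (axis i 1) (axis j 1)))) \<partial>lborel))"

end

theory Submission
  imports Defs
begin

text \<open>Replace the first layer by the orthogonal complement of the second one, which is again a first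
  layer. The dilation scaling the first layer by \<open>l \<le> 1\<close> and the second by \<open>l\<^sup>2\<close> is an automorphism
  of the Lie algebra, hence of the simply connected group. It contracts the lengths of curves by \<open>l\<close>
  at least, so it maps the ball of radius \<open>R\<close> into the one of radius \<open>l R\<close>, and it multiplies volumes
  by \<open>l ^ Q\<close>; take \<open>l = r / R\<close>.

  To have the dilation on the group, exponential coordinates are constructed without ordinary
  differential equations: since the group has step two, integrating two closed one-forms gives
  coordinates near the identity in which the multiplication is \<open>x + y + [x, y] / 2\<close>; the inverse of
  these coordinates extends to a global homomorphism by taking \<open>n\<close>-th powers of \<open>n\<close>-th roots, and is
  injective since the group is simply connected.\<close>

section \<open>Calculus of smooth functions\<close>

text \<open>Orthogonality of the two layers is what makes the dilation contract by \<open>l\<close>: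
  the norm is then componentwise in a basis adapted to both layers, and
  \<open>l\<^sup>2 \<le> l\<close> takes care of the second one. For a first layer in oblique
  position this bound may fail. Changing the first layer is harmless because the second layer is
  central: brackets depend only on classes modulo it, and the dimensions in \<open>Q\<close> stay
  the same. The dilation is given on the Lie algebra, whereas distance and volume live on the group.
  What is needed is therefore one global chart of the atlas in which multiplication is explicit. In
  it the left-invariant frame has determinant of modulus 1, so that the volume is Lebesgue measure
  and \<open>l ^ Q\<close> is the determinant of a diagonal map. The closed forms come from the
  Maurer-Cartan equation: its right-hand side takes values in the second layer, so the first-layer
  part of the form is closed, and the primitive of that part supplies the correction that closes the
  whole form.\<close>

lemma frechet_derivative_cong_open:
  assumes "open S" "x \<in> S" "\<And>y. y \<in> S \<Longrightarrow> f y = g y"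
  shows "frechet_derivative f (at x) = frechet_derivative g (at x)"
proof -
  have "(f has_derivative D) (at x) \<longleftrightarrow> (g has_derivative D) (at x)" for D
    using assms has_derivative_transform_within_open[of f D x UNIV S g]
      has_derivative_transform_within_open[of g D x UNIV S f] by auto
  then show ?thesis by (simp add: frechet_derivative_def)
qed

lemma differentiable_cong_open:
  assumes "open S" "x \<in> S" "\<And>y. y \<in> S \<Longrightarrow> f y = g y" "f differentiable (at x)"
  shows "g differentiable (at x)"
  using assms has_derivative_transform_within_open[of f _ x UNIV S g]
  by (auto simp: differentiable_def)

lemma frechet_derivative_eqI: "(f has_derivative D) (at x) \<Longrightarrow> frechet_derivative f (at x) = D"
  using frechet_derivative_at by metis

lemma Ck_on_cong:
  assumes "open S" "\<And>x. x \<in> S \<Longrightarrow> f x = g x" "Ck_on k f S"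
  shows "Ck_on k g S"
  using assms(2,3)
proof (induction k arbitrary: f g)
  case 0
  then show ?case using continuous_on_cong by force
next
  case (Suc k)
  have "Ck_on k (\<lambda>x. frechet_derivative g (at x) v) S" for v
  proof (rule Suc.IH[of "\<lambda>x. frechet_derivative f (at x) v"])
    show "frechet_derivative f (at x) v = frechet_derivative g (at x) v" if "x \<in> S" for x
      using frechet_derivative_cong_open[OF assms(1) that Suc.prems(1)] by simp
    show "Ck_on k (\<lambda>x. frechet_derivative f (at x) v) S"
      using Suc.prems(2) by simp
  qed
  moreover have "\<forall>x\<in>S. g differentiable (at x)"
  proof
    fix x assume "x \<in> S"
    then show "g differentiable (at x)"
      using Suc.prems(2) by (intro differentiable_cong_open[OF assms(1) _ Suc.prems(1)]) auto
  qed
  ultimately show ?case by simp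
qed

lemma Ck_on_SucI:
  assumes "open S" "\<And>x. x \<in> S \<Longrightarrow> (f has_derivative D x) (at x)" "\<And>v. Ck_on k (\<lambda>x. D x v) S"
  shows "Ck_on (Suc k) f S"
proof -
  have "frechet_derivative f (at x) = D x" if "x \<in> S" for x
    by (rule frechet_derivative_eqI) (use that assms in auto)
  then have "Ck_on k (\<lambda>x. frechet_derivative f (at x) v) S" for v
    by (intro Ck_on_cong[OF assms(1) _ assms(3)[of v]]) auto
  then show ?thesis using assms(2) by (auto simp: differentiable_def)
qed

lemma Ck_on_SucD:
  assumes "Ck_on (Suc k) f S" "x \<in> S"
  shows "(f has_derivative frechet_derivative f (at x)) (at x)"
  using assms by (auto simp: frechet_derivative_works)

lemma Ck_on_imp_continuous_on: "Ck_on k f S \<Longrightarrow> continuous_on S f"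
  by (cases k) (auto intro!: continuous_at_imp_continuous_on differentiable_imp_continuous_within)

lemma Ck_on_decrease: "Ck_on (Suc k) f S \<Longrightarrow> Ck_on k f S"
proof (induction k arbitrary: f)
  case 0
  then have "continuous_on S f" by (rule Ck_on_imp_continuous_on)
  then show ?case by simp
next
  case (Suc k)
  then show ?case by (metis Ck_on.simps(2))
qed

lemma Ck_on_subset: "Ck_on k f S \<Longrightarrow> T \<subseteq> S \<Longrightarrow> Ck_on k f T"
  by (induction k arbitrary: f) (use continuous_on_subset in \<open>auto\<close>)

lemma Ck_on_locally:
  assumes "\<And>x. x \<in> S \<Longrightarrow> \<exists>U. open U \<and> x \<in> U \<and> Ck_on k f U"
  shows "Ck_on k f S"
  using assms
proof (induction k arbitrary: f)
  case 0
  show ?case unfolding Ck_on.simps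
  proof (intro continuous_at_imp_continuous_on ballI)
    fix x assume "x \<in> S"
    then show "isCont f x"
      using 0 by (metis Ck_on.simps(1) continuous_on_eq_continuous_at)
  qed
next
  case (Suc k)
  have "f differentiable (at x)" if "x \<in> S" for x
    using Suc.prems[OF that] by auto
  moreover have "Ck_on k (\<lambda>x. frechet_derivative f (at x) v) S" for v
    by (rule Suc.IH) (use Suc.prems in fastforce)
  ultimately show ?case by simp
qed

lemma Ck_on_const [simp]: "Ck_on k (\<lambda>x. a) S"
  by (induction k arbitrary: a) (auto simp: frechet_derivative_const)

lemma Ck_on_bounded_linear:
  assumes "bounded_linear L"
  shows "Ck_on k L S"
proof (cases k)
  case 0
  then show ?thesis using assms by (simp add: linear_continuous_on)
next
  case (Suc j)
  have "(L has_derivative L) (at x)" for x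
    using assms bounded_linear_imp_has_derivative by blast
  then have "frechet_derivative L (at x) = L" for x
    using frechet_derivative_eqI by blast
  then show ?thesis
    using Suc assms by (auto simp: bounded_linear_imp_differentiable)
qed

lemma Ck_on_bounded_linear_compose:
  assumes "bounded_linear L" "open S" "Ck_on k f S"
  shows "Ck_on k (\<lambda>x. L (f x)) S"
  using assms(3)
proof (induction k arbitrary: f)
  case 0
  then show ?case using linear_continuous_on_compose assms(1) by (metis Ck_on.simps(1) bounded_linear.continuous_on)
next
  case (Suc k)
  show ?case
  proof (rule Ck_on_SucI[OF assms(2)])
    show "((\<lambda>x. L (f x)) has_derivative (\<lambda>v. L (frechet_derivative f (at x) v))) (at x)"
      if "x \<in> S" for x
      by (rule bounded_linear.has_derivative[OF assms(1) Ck_on_SucD[OF Suc.prems that]])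
    show "Ck_on k (\<lambda>x. L (frechet_derivative f (at x) v)) S" for v
      using Suc by simp
  qed
qed

lemma Ck_on_add:
  assumes "open S" "Ck_on k f S" "Ck_on k g S"
  shows "Ck_on k (\<lambda>x. f x + g x) S"
  using assms(2,3)
proof (induction k arbitrary: f g)
  case 0
  then show ?case by (simp add: continuous_on_add)
next
  case (Suc k)
  show ?case
  proof (rule Ck_on_SucI[OF assms(1)])
    show "((\<lambda>x. f x + g x) has_derivative
        (\<lambda>v. frechet_derivative f (at x) v + frechet_derivative g (at x) v)) (at x)" if "x \<in> S" for x
      by (rule has_derivative_add[OF Ck_on_SucD[OF Suc.prems(1) that] Ck_on_SucD[OF Suc.prems(2) that]])
    show "Ck_on k (\<lambda>x. frechet_derivative f (at x) v + frechet_derivative g (at x) v) S" for v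
      using Suc by simp
  qed
qed

lemma Ck_on_minus:
  assumes "open S" "Ck_on k f S"
  shows "Ck_on k (\<lambda>x. - f x) S"
  by (rule Ck_on_bounded_linear_compose[OF bounded_linear_minus[OF bounded_linear_ident] assms])

lemma Ck_on_diff:
  assumes "open S" "Ck_on k f S" "Ck_on k g S"
  shows "Ck_on k (\<lambda>x. f x - g x) S"
  using Ck_on_add[OF assms(1,2) Ck_on_minus[OF assms(1,3)]] by simp

lemma Ck_on_sum:
  assumes "open S" "\<And>i. i \<in> I \<Longrightarrow> Ck_on k (f i) S"
  shows "Ck_on k (\<lambda>x. \<Sum>i\<in>I. f i x) S"
  using assms(2)
  by (induction I rule: infinite_finite_induct) (auto intro!: Ck_on_add assms(1))

lemma Ck_on_bilinear:
  assumes B: "bounded_bilinear B" and "open S" "Ck_on k f S" "Ck_on k g S"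
  shows "Ck_on k (\<lambda>x. B (f x) (g x)) S"
  using assms(3,4)
proof (induction k arbitrary: f g)
  case 0
  then show ?case by (simp add: bounded_bilinear.continuous_on[OF B])
next
  case (Suc k)
  show ?case
  proof (rule Ck_on_SucI[OF assms(2)])
    show "((\<lambda>x. B (f x) (g x)) has_derivative
        (\<lambda>v. B (f x) (frechet_derivative g (at x) v) + B (frechet_derivative f (at x) v) (g x))) (at x)"
      if "x \<in> S" for x
      by (rule bounded_bilinear.FDERIV[OF B Ck_on_SucD[OF Suc.prems(1) that] Ck_on_SucD[OF Suc.prems(2) that]])
    show "Ck_on k (\<lambda>x. B (f x) (frechet_derivative g (at x) v) + B (frechet_derivative f (at x) v) (g x)) S"
      for v
    proof (intro Ck_on_add[OF assms(2)] Suc.IH)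
      show "Ck_on k f S" "Ck_on k g S"
        by (rule Ck_on_decrease[OF Suc.prems(1)], rule Ck_on_decrease[OF Suc.prems(2)])
    qed (use Suc.prems in auto)
  qed
qed

lemma linear_basis_expansion:
  fixes f :: "'a::euclidean_space \<Rightarrow> 'b::real_vector"
  assumes "linear f"
  shows "f w = (\<Sum>i\<in>Basis. (w \<bullet> i) *\<^sub>R f i)"
proof -
  have "f w = f (\<Sum>i\<in>Basis. (w \<bullet> i) *\<^sub>R i)" by (simp add: euclidean_representation)
  also have "\<dots> = (\<Sum>i\<in>Basis. (w \<bullet> i) *\<^sub>R f i)"
    by (simp add: linear_sum[OF assms] linear_cmul[OF assms])
  finally show ?thesis .
qed

text \<open>Expanding the outer derivative in the basis of the Euclidean middle space turns the
  chain rule into a finite sum of products; the induction hypothesis then applies to each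
  \<open>frechet_derivative g (at (f x)) i\<close> with fixed direction \<open>i\<close>.\<close>

lemma Ck_on_compose:
  fixes f :: "'a::real_normed_vector \<Rightarrow> 'b::euclidean_space" and g :: "'b \<Rightarrow> 'c::real_normed_vector"
  assumes "open S" "open T" "Ck_on k f S" "Ck_on k g T" "f ` S \<subseteq> T"
  shows "Ck_on k (\<lambda>x. g (f x)) S"
  using assms(3,4,5)
proof (induction k arbitrary: f g)
  case 0
  then show ?case using continuous_on_compose2 by (metis Ck_on.simps(1))
next
  case (Suc k)
  show ?case
  proof (rule Ck_on_SucI[OF assms(1)])
    let ?D = "\<lambda>x v. \<Sum>i\<in>Basis. (frechet_derivative f (at x) v \<bullet> i) *\<^sub>R frechet_derivative g (at (f x)) i"
    show "((\<lambda>x. g (f x)) has_derivative ?D x) (at x)" if "x \<in> S" for x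
    proof -
      have g: "(g has_derivative frechet_derivative g (at (f x))) (at (f x))"
        by (rule Ck_on_SucD[OF Suc.prems(2)]) (use that Suc.prems in auto)
      have D: "((\<lambda>x. g (f x)) has_derivative
          (\<lambda>v. frechet_derivative g (at (f x)) (frechet_derivative f (at x) v))) (at x)"
        by (rule has_derivative_compose[OF Ck_on_SucD[OF Suc.prems(1) that] g])
      show ?thesis
        by (rule has_derivative_eq_rhs[OF D], rule ext, rule linear_basis_expansion[OF has_derivative_linear[OF g]])
    qed
    show "Ck_on k (\<lambda>x. ?D x v) S" for v
    proof (intro Ck_on_sum Ck_on_bilinear[OF bounded_bilinear_scaleR] assms(1)
        Ck_on_bounded_linear_compose[OF bounded_linear_inner_left])
      show "Ck_on k (\<lambda>x. frechet_derivative f (at x) v) S"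
        using Suc.prems(1) by simp
      show "Ck_on k (\<lambda>x. frechet_derivative g (at (f x)) i) S" for i
        using Suc.IH[OF Ck_on_decrease[OF Suc.prems(1)] _ Suc.prems(3), of "\<lambda>y. frechet_derivative g (at y) i"]
          Suc.prems(2) by simp
    qed
  qed
qed

lemma Ck_on_Pair:
  assumes "open S" "Ck_on k f S" "Ck_on k g S"
  shows "Ck_on k (\<lambda>x. (f x, g x)) S"
  using assms(2,3)
proof (induction k arbitrary: f g)
  case 0
  then show ?case by (simp add: continuous_on_Pair)
next
  case (Suc k)
  show ?case
  proof (rule Ck_on_SucI[OF assms(1)])
    show "((\<lambda>x. (f x, g x)) has_derivative
        (\<lambda>v. (frechet_derivative f (at x) v, frechet_derivative g (at x) v))) (at x)" if "x \<in> S" for x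
      by (rule has_derivative_Pair[OF Ck_on_SucD[OF Suc.prems(1) that] Ck_on_SucD[OF Suc.prems(2) that]])
    show "Ck_on k (\<lambda>x. (frechet_derivative f (at x) v, frechet_derivative g (at x) v)) S" for v
      using Suc by simp
  qed
qed

text \<open>On a Euclidean domain an operator is a finite sum of rank-one operators built from its
  values on the basis, so regularity of every value \<open>f x v\<close> gives regularity in the
  operator norm.\<close>

lemma Ck_on_blinfun:
  fixes f :: "'a::real_normed_vector \<Rightarrow> 'b::euclidean_space \<Rightarrow>\<^sub>L 'c::real_normed_vector"
  assumes "open S" "\<And>v. Ck_on k (\<lambda>x. f x v) S"
  shows "Ck_on k f S"
proof -
  have "Ck_on k (\<lambda>x. \<Sum>i\<in>Basis. blinfun_scaleR_left (f x i) o\<^sub>L blinfun_inner_left i) S"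
    by (intro Ck_on_sum assms
       Ck_on_bounded_linear_compose[OF bounded_linear_compose[OF
         bounded_bilinear.bounded_linear_left[OF bounded_bilinear_blinfun_compose]
         bounded_linear_blinfun_scaleR_left]])
  moreover have "(\<Sum>i\<in>Basis. blinfun_scaleR_left (f x i) o\<^sub>L blinfun_inner_left i) = f x" for x
  proof (rule blinfun_eqI)
    fix w
    have "f x w = f x (\<Sum>i\<in>Basis. (w \<bullet> i) *\<^sub>R i)"
      by (simp add: euclidean_representation)
    also have "\<dots> = (\<Sum>i\<in>Basis. (w \<bullet> i) *\<^sub>R f x i)"
      by (simp add: blinfun.sum_right blinfun.scaleR_right)
    finally show "(\<Sum>i\<in>Basis. blinfun_scaleR_left (f x i) o\<^sub>L blinfun_inner_left i) w = f x w"
      by (simp add: blinfun.sum_left inner_commute)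
  qed
  ultimately show ?thesis by simp
qed

lemma smooth_onD: "smooth_on S f \<Longrightarrow> Ck_on k f S"
  by (simp add: smooth_on_def)

lemma smooth_on_frechet_derivative: "smooth_on S f \<Longrightarrow> smooth_on S (\<lambda>x. frechet_derivative f (at x) v)"
  unfolding smooth_on_def by (metis Ck_on.simps(2))

lemma smooth_on_has_derivative:
  "smooth_on S f \<Longrightarrow> x \<in> S \<Longrightarrow> (f has_derivative frechet_derivative f (at x)) (at x)"
  using Ck_on_SucD smooth_on_def by blast

lemma smooth_on_compose:
  fixes f :: "'a::real_normed_vector \<Rightarrow> 'b::euclidean_space" and g :: "'b \<Rightarrow> 'c::real_normed_vector"
  assumes "open S" "open T" "smooth_on S f" "smooth_on T g" "f ` S \<subseteq> T"
  shows "smooth_on S (\<lambda>x. g (f x))"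
  using assms Ck_on_compose unfolding smooth_on_def by blast

lemma smooth_on_cong:
  "open S \<Longrightarrow> (\<And>x. x \<in> S \<Longrightarrow> f x = g x) \<Longrightarrow> smooth_on S f \<Longrightarrow> smooth_on S g"
  unfolding smooth_on_def using Ck_on_cong by blast

lemma smooth_on_subset: "smooth_on S f \<Longrightarrow> T \<subseteq> S \<Longrightarrow> smooth_on T f"
  unfolding smooth_on_def using Ck_on_subset by blast

lemma smooth_on_locally:
  assumes "\<And>x. x \<in> S \<Longrightarrow> \<exists>U. open U \<and> x \<in> U \<and> smooth_on U f"
  shows "smooth_on S f"
  using assms Ck_on_locally unfolding smooth_on_def by meson

lemma smooth_on_imp_continuous_on: "smooth_on S f \<Longrightarrow> continuous_on S f"
  by (metis Ck_on.simps(1) smooth_on_def)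

lemma frechet_derivative_euclidean_inner:
  assumes "f differentiable (at x)"
  shows "((\<lambda>x. f x \<bullet> i) has_derivative (\<lambda>v. frechet_derivative f (at x) v \<bullet> i)) (at x)"
  using assms by (intro has_derivative_inner_left) (simp add: frechet_derivative_works)

text \<open>Both mixed partial derivatives are the limit of the second difference quotient
  \<open>(f (x+hu+hv) - f (x+hu) - f (x+hv) + f x) / h\<^sup>2\<close>.\<close>

lemma second_difference_mean_value:
  fixes f :: "'a::real_normed_vector \<Rightarrow> real"
  assumes f: "Ck_on 2 f (ball x e)" and h: "0 < h" "h * (norm u + norm v) < e"
  obtains a b where "0 < a" "a < h" "0 < b" "b < h"
    "f (x + h *\<^sub>R u + h *\<^sub>R v) - f (x + h *\<^sub>R u) - f (x + h *\<^sub>R v) + f x =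
      h * h * frechet_derivative (\<lambda>y. frechet_derivative f (at y) u) (at (x + a *\<^sub>R u + b *\<^sub>R v)) v"
proof -
  have f': "(f has_derivative frechet_derivative f (at y)) (at y)" if "y \<in> ball x e" for y
    using f that by (metis Ck_on_SucD numeral_2_eq_2)
  have f'': "((\<lambda>y. frechet_derivative f (at y) u) has_derivative
     frechet_derivative (\<lambda>y. frechet_derivative f (at y) u) (at y)) (at y)" if "y \<in> ball x e" for y
  proof -
    have "Ck_on (Suc 0) (\<lambda>y. frechet_derivative f (at y) u) (ball x e)"
      using f by (simp add: numeral_2_eq_2)
    then show ?thesis using that Ck_on_SucD by blast
  qed
  have inb: "x + a *\<^sub>R u + b *\<^sub>R v \<in> ball x e" if "0 \<le> a" "a \<le> h" "0 \<le> b" "b \<le> h" for a b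
  proof -
    have "norm (a *\<^sub>R u + b *\<^sub>R v) \<le> a * norm u + b * norm v"
      using norm_triangle_ineq[of "a *\<^sub>R u" "b *\<^sub>R v"] that by simp
    also have "\<dots> \<le> h * norm u + h * norm v"
      using that by (intro add_mono mult_right_mono) auto
    also have "\<dots> < e" using h by (simp add: algebra_simps)
    finally have "norm (a *\<^sub>R u + b *\<^sub>R v) < e" .
    moreover have "dist x (x + a *\<^sub>R u + b *\<^sub>R v) = norm (a *\<^sub>R u + b *\<^sub>R v)"
      by (metis add.assoc add_diff_cancel_left' dist_commute dist_norm)
    ultimately show ?thesis by simp
  qed
  \<comment> \<open>The second difference is the increment of \<open>?g\<close> over
    \<open>[0, h]\<close>: the mean value theorem is applied along \<open>u\<close>, and to its
    outcome once more along \<open>v\<close>.\<close>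
  let ?g = "\<lambda>s. f (x + s *\<^sub>R u + h *\<^sub>R v) - f (x + s *\<^sub>R u)"
  have line: "((\<lambda>s. f (z + s *\<^sub>R w)) has_real_derivative frechet_derivative f (at (z + s *\<^sub>R w)) w) (at s)"
    if "z + s *\<^sub>R w \<in> ball x e" for s z w
  proof -
    have "((\<lambda>s. f (z + s *\<^sub>R w)) has_derivative
        (\<lambda>t. frechet_derivative f (at (z + s *\<^sub>R w)) (t *\<^sub>R w))) (at s)"
      by (rule has_derivative_compose[where g=f and f="\<lambda>s. z + s *\<^sub>R w", OF _ f'[OF that]])
         (auto intro!: derivative_eq_intros)
    then show ?thesis
      by (rule has_derivative_imp_has_field_derivative)
        (simp add: linear_cmul[OF has_derivative_linear[OF f'[OF that]]])
  qed
  have "\<exists>a>0. a < h \<and> ?g h - ?g 0 =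
     (h - 0) * (frechet_derivative f (at (x + a *\<^sub>R u + h *\<^sub>R v)) u - frechet_derivative f (at (x + a *\<^sub>R u)) u)"
  proof (rule MVT2[OF h(1)])
    fix s assume s: "0 \<le> s" "s \<le> h"
    have "((\<lambda>s. f (x + h *\<^sub>R v + s *\<^sub>R u)) has_real_derivative
        frechet_derivative f (at (x + h *\<^sub>R v + s *\<^sub>R u)) u) (at s)"
      using inb[of s h] s h(1) by (intro line) (simp add: algebra_simps)
    moreover have "((\<lambda>s. f (x + s *\<^sub>R u)) has_real_derivative frechet_derivative f (at (x + s *\<^sub>R u)) u) (at s)"
      using inb[of s 0] s h(1) by (intro line) (simp add: algebra_simps)
    ultimately show "(?g has_real_derivative frechet_derivative f (at (x + s *\<^sub>R u + h *\<^sub>R v)) u -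
         frechet_derivative f (at (x + s *\<^sub>R u)) u) (at s)"
      by (auto intro!: DERIV_diff simp: add_ac)
  qed
  then obtain a where a: "0 < a" "a < h" and 1: "?g h - ?g 0 = h *
      (frechet_derivative f (at (x + a *\<^sub>R u + h *\<^sub>R v)) u - frechet_derivative f (at (x + a *\<^sub>R u)) u)"
    by auto
  let ?k = "\<lambda>s. frechet_derivative f (at (x + a *\<^sub>R u + s *\<^sub>R v)) u"
  have "\<exists>b>0. b < h \<and> ?k h - ?k 0 = (h - 0) *
     frechet_derivative (\<lambda>y. frechet_derivative f (at y) u) (at (x + a *\<^sub>R u + b *\<^sub>R v)) v"
  proof (rule MVT2[OF h(1)])
    fix s assume s: "0 \<le> s" "s \<le> h"
    let ?D = "frechet_derivative (\<lambda>y. frechet_derivative f (at y) u) (at (x + a *\<^sub>R u + s *\<^sub>R v))"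
    have d: "((\<lambda>y. frechet_derivative f (at y) u) has_derivative ?D) (at (x + a *\<^sub>R u + s *\<^sub>R v))"
      using a s inb[of a s] by (intro f'') auto
    have "(?k has_derivative (\<lambda>t. ?D (t *\<^sub>R v))) (at s)"
      by (rule has_derivative_compose[where f="\<lambda>s. x + a *\<^sub>R u + s *\<^sub>R v", OF _ d])
         (auto intro!: derivative_eq_intros)
    then show "(?k has_real_derivative ?D v) (at s)"
      by (rule has_derivative_imp_has_field_derivative) (simp add: linear_cmul[OF has_derivative_linear[OF d]])
  qed
  then obtain b where b: "0 < b" "b < h" and 2: "?k h - ?k 0 = h *
     frechet_derivative (\<lambda>y. frechet_derivative f (at y) u) (at (x + a *\<^sub>R u + b *\<^sub>R v)) v"
    by auto
  show ?thesis
    by (rule that[OF a b]) (use 1 2 in simp)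
qed

lemma symmetric_second_derivative_real:
  fixes f :: "'a::real_normed_vector \<Rightarrow> real"
  assumes "open S" "Ck_on 2 f S" "x \<in> S"
  shows "frechet_derivative (\<lambda>y. frechet_derivative f (at y) u) (at x) v =
         frechet_derivative (\<lambda>y. frechet_derivative f (at y) v) (at x) u"
proof -
  obtain e where e: "e > 0" "ball x e \<subseteq> S"
    using assms openE by blast
  have f: "Ck_on 2 f (ball x e)"
    using Ck_on_subset assms(2) e(2) by blast
  define D where "D u v y = frechet_derivative (\<lambda>y. frechet_derivative f (at y) u) (at y) v" for u v y
  have cont: "isCont (D u v) x" for u v
  proof -
    have "Ck_on 0 (D u v) (ball x e)"
      using f by (simp add: numeral_2_eq_2 D_def[abs_def])
    then show ?thesis using e(1) by (simp add: continuous_on_eq_continuous_at)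
  qed
  have small: "\<bar>D u v x - D v u x\<bar> \<le> 2 * \<epsilon>" if eps: "\<epsilon> > 0" for \<epsilon>
  proof -
    obtain d1 where d1: "d1 > 0" "\<And>y. dist y x < d1 \<Longrightarrow> \<bar>D u v y - D u v x\<bar> < \<epsilon>"
      using cont[of u v] eps unfolding continuous_at_eps_delta dist_real_def by blast
    obtain d2 where d2: "d2 > 0" "\<And>y. dist y x < d2 \<Longrightarrow> \<bar>D v u y - D v u x\<bar> < \<epsilon>"
      using cont[of v u] eps unfolding continuous_at_eps_delta dist_real_def by blast
    define m where "m = Min {e, d1, d2}"
    \<comment> \<open>The summand \<open>1\<close> keeps the quotient meaningful for
      \<open>u = v = 0\<close>. With this \<open>h\<close> all intermediate points lie within
      \<open>m\<close> of \<open>x\<close>.\<close>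
    define h where "h = m / (norm u + norm v + 1)"
    have m: "m > 0" "m \<le> e" "m \<le> d1" "m \<le> d2" using e d1 d2 by (auto simp: m_def)
    have h: "h > 0" using m by (simp add: h_def add_nonneg_pos)
    have "m * (norm u + norm v) < m * (norm u + norm v + 1)"
      using m by simp
    then have hm: "h * (norm u + norm v) < m"
      unfolding h_def using norm_ge_zero[of u] norm_ge_zero[of v]
      by (simp add: divide_less_eq add_nonneg_pos)
    have near: "norm (a *\<^sub>R u + b *\<^sub>R v) < m" if "0 < a" "a < h" "0 < b" "b < h" for a b
    proof -
      have "norm (a *\<^sub>R u + b *\<^sub>R v) \<le> a * norm u + b * norm v"
        using norm_triangle_ineq[of "a *\<^sub>R u" "b *\<^sub>R v"] that by simp
      also have "\<dots> \<le> h * norm u + h * norm v"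
        using that by (intro add_mono mult_right_mono) auto
      finally show ?thesis using hm by (simp add: algebra_simps)
    qed
    have h1: "h * (norm u + norm v) < e" and h2: "h * (norm v + norm u) < e"
      using hm m by (auto simp: add.commute)
    obtain a b where ab: "0 < a" "a < h" "0 < b" "b < h" and
      1: "f (x + h *\<^sub>R u + h *\<^sub>R v) - f (x + h *\<^sub>R u) - f (x + h *\<^sub>R v) + f x =
        h * h * D u v (x + a *\<^sub>R u + b *\<^sub>R v)"
      unfolding D_def by (rule second_difference_mean_value[OF f h h1])
    obtain a' b' where ab': "0 < a'" "a' < h" "0 < b'" "b' < h" and
      2: "f (x + h *\<^sub>R v + h *\<^sub>R u) - f (x + h *\<^sub>R v) - f (x + h *\<^sub>R u) + f x =
        h * h * D v u (x + a' *\<^sub>R v + b' *\<^sub>R u)"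
      unfolding D_def by (rule second_difference_mean_value[OF f h h2])
    have "h * h * D u v (x + a *\<^sub>R u + b *\<^sub>R v) = h * h * D v u (x + a' *\<^sub>R v + b' *\<^sub>R u)"
    proof -
      have "f (x + h *\<^sub>R u + h *\<^sub>R v) = f (x + h *\<^sub>R v + h *\<^sub>R u)" by (simp add: add_ac)
      with 1 2 show ?thesis by linarith
    qed
    then have eq: "D u v (x + a *\<^sub>R u + b *\<^sub>R v) = D v u (x + a' *\<^sub>R v + b' *\<^sub>R u)"
      using h by simp
    have "\<bar>D u v (x + a *\<^sub>R u + b *\<^sub>R v) - D u v x\<bar> < \<epsilon>"
      using near[OF ab] m by (intro d1(2)) (simp add: dist_norm add.assoc)
    moreover have "\<bar>D v u (x + a' *\<^sub>R v + b' *\<^sub>R u) - D v u x\<bar> < \<epsilon>"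
      using near[OF ab'(3,4,1,2)] m by (intro d2(2)) (simp add: dist_norm add.assoc add.commute)
    ultimately show ?thesis unfolding eq by linarith
  qed
  have "\<bar>D u v x - D v u x\<bar> \<le> 0"
  proof (rule field_le_epsilon)
    fix \<epsilon> :: real assume "\<epsilon> > 0"
    then show "\<bar>D u v x - D v u x\<bar> \<le> 0 + \<epsilon>" using small[of "\<epsilon> / 2"] by linarith
  qed
  then show ?thesis by (simp add: D_def)
qed

lemma symmetric_second_derivative:
  fixes f :: "'a::real_normed_vector \<Rightarrow> 'b::euclidean_space"
  assumes "open S" "Ck_on 2 f S" "x \<in> S"
  shows "frechet_derivative (\<lambda>y. frechet_derivative f (at y) u) (at x) v =
         frechet_derivative (\<lambda>y. frechet_derivative f (at y) v) (at x) u"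
proof (rule euclidean_eqI)
  fix i :: 'b assume "i \<in> Basis"
  have 1: "frechet_derivative (\<lambda>x. f x \<bullet> i) (at y) w = frechet_derivative f (at y) w \<bullet> i" if "y \<in> S" for y w
    using assms that by (subst frechet_derivative_eqI[OF frechet_derivative_euclidean_inner])
      (auto simp: numeral_2_eq_2)
  have 2: "frechet_derivative (\<lambda>y. frechet_derivative (\<lambda>x. f x \<bullet> i) (at y) w) (at x) z =
      frechet_derivative (\<lambda>y. frechet_derivative f (at y) w) (at x) z \<bullet> i" for w z
  proof -
    have "frechet_derivative (\<lambda>y. frechet_derivative (\<lambda>x. f x \<bullet> i) (at y) w) (at x) =
      frechet_derivative (\<lambda>y. frechet_derivative f (at y) w \<bullet> i) (at x)"
      by (rule frechet_derivative_cong_open[OF assms(1,3)]) (rule 1)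
    also have "\<dots> = (\<lambda>z. frechet_derivative (\<lambda>y. frechet_derivative f (at y) w) (at x) z \<bullet> i)"
      using assms by (intro frechet_derivative_eqI frechet_derivative_euclidean_inner)
        (auto simp: numeral_2_eq_2)
    finally show ?thesis by simp
  qed
  have "Ck_on 2 (\<lambda>x. f x \<bullet> i) S"
    by (rule Ck_on_bounded_linear_compose[OF bounded_linear_inner_left assms(1,2)])
  from symmetric_second_derivative_real[OF assms(1) this assms(3)]
  show "frechet_derivative (\<lambda>y. frechet_derivative f (at y) u) (at x) v \<bullet> i =
        frechet_derivative (\<lambda>y. frechet_derivative f (at y) v) (at x) u \<bullet> i"
    by (simp add: 2)
qed

text \<open>Integrating along rays: closedness lets the derivative of the integrand be rewritten as
  the \<open>t\<close>-derivative of \<open>t *\<^sub>R \<eta> (x\<^sub>0 + t *\<^sub>R (x - x\<^sub>0))\<close>.\<close>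

lemma poincare_lemma:
  fixes \<eta> :: "'a::euclidean_space \<Rightarrow> 'a \<Rightarrow>\<^sub>L 'b::euclidean_space"
    and \<eta>' :: "'a \<Rightarrow> 'a \<Rightarrow>\<^sub>L ('a \<Rightarrow>\<^sub>L 'b)"
  assumes d: "\<And>x. x \<in> ball x0 r \<Longrightarrow> (\<eta> has_derivative \<eta>' x) (at x)"
    and cont: "continuous_on (ball x0 r) \<eta>'"
    and closed: "\<And>x v w. x \<in> ball x0 r \<Longrightarrow> \<eta>' x v w = \<eta>' x w v"
  obtains F where "F x0 = 0" "\<And>x. x \<in> ball x0 r \<Longrightarrow> (F has_derivative \<eta> x) (at x)"
proof -
  let ?p = "\<lambda>x t. x0 + t *\<^sub>R (x - x0)"
  define F where "F x = integral (cbox 0 1) (\<lambda>t. \<eta> (?p x t) (x - x0))" for x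
  let ?fx = "\<lambda>x t. \<eta> (?p x t) + t *\<^sub>R \<eta>' (?p x t) (x - x0)"
  have inb: "?p x t \<in> ball x0 r" if "x \<in> ball x0 r" "t \<in> cbox 0 1" for x and t::real
  proof -
    have "norm (t *\<^sub>R (x - x0)) \<le> norm (x - x0)"
      using that by (simp add: mult_left_le_one_le)
    then show ?thesis using that by (simp add: dist_norm norm_minus_commute)
  qed
  have contp: "continuous_on (ball x0 r \<times> cbox 0 1) (\<lambda>(x,t). ?p x t)"
    by (auto simp: case_prod_beta intro!: continuous_intros)
  have conteta: "continuous_on (ball x0 r) \<eta>"
    using d by (meson continuous_at_imp_continuous_on has_derivative_continuous)
  have deriv: "(F has_derivative \<eta> x) (at x)" if x: "x \<in> ball x0 r" for x
  proof -
    have "((\<lambda>x. integral (cbox 0 1) (\<lambda>t. \<eta> (?p x t) (x - x0))) has_derivative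
        integral (cbox 0 1) (?fx x)) (at x within ball x0 r)"
    proof (rule leibniz_rule[OF _ _ _ x convex_ball])
      fix y and t :: real assume y: "y \<in> ball x0 r" "t \<in> cbox 0 1"
      have 1: "((\<lambda>x. ?p x t) has_derivative (\<lambda>v. t *\<^sub>R v)) (at y)"
        by (auto intro!: derivative_eq_intros)
      have "((\<lambda>x. \<eta> (?p x t)) has_derivative (\<lambda>v. \<eta>' (?p y t) (t *\<^sub>R v))) (at y)"
        by (rule has_derivative_compose[OF 1 d[OF inb[OF y]]])
      then have "((\<lambda>x. \<eta> (?p x t) (x - x0)) has_derivative
          (\<lambda>v. \<eta> (?p y t) v + \<eta>' (?p y t) (t *\<^sub>R v) (y - x0))) (at y)"
        by (auto intro!: derivative_eq_intros bounded_bilinear.FDERIV[OF bounded_bilinear_blinfun_apply])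
      moreover have "(\<lambda>v. \<eta> (?p y t) v + \<eta>' (?p y t) (t *\<^sub>R v) (y - x0)) = ?fx y t"
      proof
        fix v
        show "\<eta> (?p y t) v + \<eta>' (?p y t) (t *\<^sub>R v) (y - x0) = ?fx y t v"
          using closed[OF inb[OF y], of v "y - x0"] by (simp only: blinfun.add_left blinfun.scaleR_left blinfun.scaleR_right)
      qed
      ultimately show "((\<lambda>x. \<eta> (?p x t) (x - x0)) has_derivative ?fx y t) (at y within ball x0 r)"
        by (simp add: has_derivative_at_withinI)
    next
      fix y assume y: "y \<in> ball x0 r"
      show "(\<lambda>t. \<eta> (?p y t) (y - x0)) integrable_on cbox 0 1"
        by (rule integrable_continuous)
          (auto intro!: continuous_intros continuous_on_compose2[OF conteta] inb[OF y, simplified])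
    next
      show "continuous_on (ball x0 r \<times> cbox 0 1) (\<lambda>(x, t). ?fx x t)"
        unfolding case_prod_beta
        by (intro continuous_intros continuous_on_compose2[OF conteta] continuous_on_compose2[OF cont])
          (auto simp: mem_Times_iff simp del: mem_ball intro!: inb)
    qed
    moreover have "integral (cbox 0 1) (?fx x) = \<eta> x"
    proof -
      have "(?fx x has_integral (1 *\<^sub>R \<eta> (?p x 1) - 0 *\<^sub>R \<eta> (?p x 0))) {0..1}"
      proof (rule fundamental_theorem_of_calculus)
        fix t :: real assume t: "t \<in> {0..1}"
        have 1: "((\<lambda>t. ?p x t) has_derivative (\<lambda>s. s *\<^sub>R (x - x0))) (at t)"
          by (auto intro!: derivative_eq_intros)
        have "((\<lambda>t. \<eta> (?p x t)) has_derivative (\<lambda>s. \<eta>' (?p x t) (s *\<^sub>R (x - x0)))) (at t)"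
          by (rule has_derivative_compose[OF 1 d]) (use inb[OF x] t in auto)
        then have "((\<lambda>t. t *\<^sub>R \<eta> (?p x t)) has_derivative
            (\<lambda>s. t *\<^sub>R \<eta>' (?p x t) (s *\<^sub>R (x - x0)) + s *\<^sub>R \<eta> (?p x t))) (at t)"
          by (intro has_derivative_scaleR has_derivative_ident)
        then show "((\<lambda>t. t *\<^sub>R \<eta> (?p x t)) has_vector_derivative ?fx x t) (at t within {0..1})"
          unfolding has_vector_derivative_def
          by (auto intro!: has_derivative_at_withinI simp: blinfun.bilinear_simps algebra_simps)
      qed simp
      then show ?thesis by (simp add: integral_unique)
    qed
    ultimately show ?thesis
      using x by (simp add: F_def[abs_def] at_within_open[OF x open_ball])
  qed
  show ?thesis
    by (rule that[of F]) (auto simp: F_def deriv)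
qed

section \<open>From a local isomorphism to a global one\<close>

context group
begin

definition pw :: "'a \<Rightarrow> nat \<Rightarrow> 'a"
  where "pw a n = ((\<lambda>x. a \<^bold>* x) ^^ n) \<^bold>1"

lemma pw_simps [simp]: "pw a 0 = \<^bold>1" "pw a (Suc n) = a \<^bold>* pw a n"
  by (simp_all add: pw_def)

lemma pw_add: "pw a (m + n) = pw a m \<^bold>* pw a n"
  by (induction m) (simp_all add: assoc)

lemma pw_mult: "pw a (m * n) = pw (pw a m) n"
  by (induction n) (simp_all add: pw_add)

lemma pw_commute: "a \<^bold>* c = c \<^bold>* a \<Longrightarrow> pw a n \<^bold>* c = c \<^bold>* pw a n"
proof (induction n)
  case (Suc n)
  then show ?case by simp (metis assoc)
qed simp

lemma pw_distrib:
  assumes "a \<^bold>* c = c \<^bold>* a"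
  shows "pw (a \<^bold>* c) n = pw a n \<^bold>* pw c n"
proof (induction n)
  case (Suc n)
  have "pw (a \<^bold>* c) (Suc n) = a \<^bold>* (c \<^bold>* pw a n) \<^bold>* pw c n"
    using Suc by (simp add: assoc)
  also have "c \<^bold>* pw a n = pw a n \<^bold>* c"
    using pw_commute[OF assms] by simp
  finally show ?case by (simp add: assoc)
qed simp

text \<open>Each of the \<open>n\<close> factors \<open>x\<close> that \<open>y\<close> passes
  leaves one \<open>c\<close> behind; as \<open>c\<close> commutes with \<open>x\<close>, these
  copies can be gathered at the end.\<close>

lemma pw_shift:
  assumes "x \<^bold>* y = y \<^bold>* (x \<^bold>* c)" "c \<^bold>* x = x \<^bold>* c"
  shows "pw x n \<^bold>* y = y \<^bold>* (pw x n \<^bold>* pw c n)"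
proof (induction n)
  case (Suc n)
  have "pw x (Suc n) \<^bold>* y = (x \<^bold>* y) \<^bold>* (pw x n \<^bold>* pw c n)"
    using Suc by (simp add: assoc)
  also have "\<dots> = y \<^bold>* (x \<^bold>* ((c \<^bold>* pw x n) \<^bold>* pw c n))"
    using assms(1) by (simp add: assoc)
  also have "c \<^bold>* pw x n = pw x n \<^bold>* c"
    using pw_commute[of x c n] assms(2) by simp
  finally show ?case by (simp add: assoc)
qed simp

text \<open>The case \<open>x y = y x d\<^sup>2\<close> of the class-two collection formula; the square root \<open>d\<close> of the
  commutator avoids halving \<open>n (n - 1)\<close>.\<close>

lemma pw_collect:
  assumes xy: "x \<^bold>* y = y \<^bold>* (x \<^bold>* (d \<^bold>* d))" and dx: "d \<^bold>* x = x \<^bold>* d" and dy: "d \<^bold>* y = y \<^bold>* d"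
  shows "pw x n \<^bold>* pw y n = pw (x \<^bold>* y) n \<^bold>* pw d (n * (n - 1))"
proof (induction n)
  case (Suc n)
  let ?z = "x \<^bold>* y"
  have dz: "d \<^bold>* ?z = ?z \<^bold>* d"
    using dx dy by (metis assoc)
  have "?z \<^bold>* y = y \<^bold>* (x \<^bold>* (d \<^bold>* d)) \<^bold>* y"
    using xy by simp
  also have "\<dots> = y \<^bold>* (?z \<^bold>* (d \<^bold>* d))"
    using dy by (metis assoc)
  finally have zy: "pw ?z n \<^bold>* y = y \<^bold>* (pw ?z n \<^bold>* pw (d \<^bold>* d) n)"
    by (rule pw_shift) (use dz in \<open>metis assoc\<close>)
  have dd: "pw (d \<^bold>* d) n = pw d (2 * n)"
    by (simp add: pw_distrib pw_add mult_2)
  have "pw x (Suc n) \<^bold>* pw y (Suc n) = x \<^bold>* (pw x n \<^bold>* pw y n) \<^bold>* y"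
    using pw_commute[of y y n] by (simp add: assoc)
  also have "\<dots> = x \<^bold>* (pw ?z n \<^bold>* (pw d (n * (n - 1)) \<^bold>* y))"
    using Suc by (simp add: assoc)
  also have "pw d (n * (n - 1)) \<^bold>* y = y \<^bold>* pw d (n * (n - 1))"
    by (rule pw_commute[OF dy])
  also have "x \<^bold>* (pw ?z n \<^bold>* (y \<^bold>* pw d (n * (n - 1)))) = x \<^bold>* ((pw ?z n \<^bold>* y) \<^bold>* pw d (n * (n - 1)))"
    by (simp add: assoc)
  also have "\<dots> = ?z \<^bold>* (pw ?z n \<^bold>* (pw d (2 * n) \<^bold>* pw d (n * (n - 1))))"
    unfolding zy dd by (simp add: assoc)
  also have "pw d (2 * n) \<^bold>* pw d (n * (n - 1)) = pw d (Suc n * (Suc n - 1))"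
  proof -
    have "2 * n + n * (n - 1) = Suc n * (Suc n - 1)" by (cases n) auto
    then show ?thesis by (metis pw_add)
  qed
  finally show ?case by (simp add: assoc)
qed simp

end

text \<open>By the Baker--Campbell--Hausdorff formula, \<open>hmul\<close> is the group law of the simply connected
  group with Lie bracket \<open>b\<close>, in exponential coordinates.\<close>

locale step_two_bracket =
  fixes b :: "'a::euclidean_space \<Rightarrow> 'a \<Rightarrow> 'a"
  assumes bilinear: "bounded_bilinear b"
    and antisym: "b y x = - b x y"
    and nilpotent: "b (b x y) z = 0"
begin

sublocale bounded_bilinear b by (rule bilinear)

lemma nilpotent' [simp]: "b x (b y z) = 0"
  using antisym nilpotent by (metis neg_equal_0_iff_equal)

declare nilpotent [simp]

lemma bracket_self [simp]: "b x x = 0"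
  using antisym[of x x] by (metis eq_neg_iff_add_eq_0 scaleR_2 scaleR_eq_0_iff zero_neq_numeral)

definition hmul :: "'a \<Rightarrow> 'a \<Rightarrow> 'a"
  where "hmul x y = x + y + (1/2) *\<^sub>R b x y"

text \<open>Triple brackets vanish, so on both sides only \<open>x + y + z\<close> and half of the
  three pairwise brackets remain.\<close>

lemma hmul_assoc: "hmul (hmul x y) z = hmul x (hmul y z)"
  by (simp add: hmul_def add_left add_right scaleR_left scaleR_right algebra_simps)

lemma hmul_0 [simp]: "hmul 0 x = x" "hmul x 0 = x"
  by (simp_all add: hmul_def zero_left zero_right)

lemma hmul_minus [simp]: "hmul (- x) x = 0" "hmul x (- x) = 0"
  by (simp_all add: hmul_def minus_left minus_right)

lemma hmul_cancel [simp]: "hmul (- x) (hmul x y) = y" "hmul x (hmul (- x) y) = y"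
  by (simp_all flip: hmul_assoc)

lemma hmul_scaleR: "hmul (s *\<^sub>R x) (t *\<^sub>R x) = (s + t) *\<^sub>R x"
  by (simp add: hmul_def scaleR_left scaleR_right algebra_simps)

lemma continuous_on_hmul [continuous_intros]:
  "continuous_on S f \<Longrightarrow> continuous_on S g \<Longrightarrow> continuous_on S (\<lambda>x. hmul (f x) (g x))"
  unfolding hmul_def by (intro continuous_intros continuous_on)

end

locale topological_group = grp: group gmul gunit ginv
  for gmul :: "'g::t2_space \<Rightarrow> 'g \<Rightarrow> 'g" and gunit :: 'g and ginv :: "'g \<Rightarrow> 'g" +
  assumes continuous_gmul: "continuous_on UNIV (\<lambda>(p, q). gmul p q)"
    and continuous_ginv: "continuous_on UNIV ginv"
begin

lemma continuous_on_gmul [continuous_intros]: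
  "continuous_on T f \<Longrightarrow> continuous_on T h \<Longrightarrow> continuous_on T (\<lambda>x. gmul (f x) (h x))"
  using continuous_on_compose2[OF continuous_gmul, of T "\<lambda>x. (f x, h x)"]
  by (simp add: continuous_on_Pair)

lemma continuous_on_ginv [continuous_intros]:
  "continuous_on T f \<Longrightarrow> continuous_on T (\<lambda>x. ginv (f x))"
  using continuous_on_compose2[OF continuous_ginv, of T f] by simp

end

text \<open>\<open>S\<close> is a homeomorphism of a ball onto an open set. Multiplicativity is
  asked for any two points of the ball, even if their product leaves it, so \<open>S\<close> must
  have the right value at such products as well.\<close>

locale local_isomorphism = step_two_bracket b + topological_group gmul gunit ginv
  for b :: "'a::euclidean_space \<Rightarrow> 'a \<Rightarrow> 'a"
    and gmul :: "'g::t2_space \<Rightarrow> 'g \<Rightarrow> 'g" and gunit :: 'g and ginv :: "'g \<Rightarrow> 'g" +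
  fixes S :: "'a \<Rightarrow> 'g" and \<epsilon> :: real
  assumes connected_G: "connected (UNIV :: 'g set)"
    and simply_connected_G: "simply_connected (UNIV :: 'g set)"
    and eps: "\<epsilon> > 0"
    and S_hmul: "\<And>x y. norm x < \<epsilon> \<Longrightarrow> norm y < \<epsilon> \<Longrightarrow> S (hmul x y) = gmul (S x) (S y)"
    and continuous_S: "continuous_on (ball 0 \<epsilon>) S"
    and inj_S: "inj_on S (ball 0 \<epsilon>)"
    and open_S: "\<And>U. open U \<Longrightarrow> U \<subseteq> ball 0 \<epsilon> \<Longrightarrow> open (S ` U)"
begin

lemma S_0 [simp]: "S 0 = gunit"
proof -
  have "gmul (S 0) (S 0) = gmul (S 0) gunit"
    using S_hmul[of 0 0] eps by simp
  then show ?thesis by (simp only: grp.left_cancel)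
qed

lemma S_scaleR_nat:
  assumes "norm (real k *\<^sub>R w) < \<epsilon>"
  shows "S (real k *\<^sub>R w) = grp.pw (S w) k"
  using assms
proof (induction k)
  case (Suc k)
  show ?case
  proof -
    have "norm (real k *\<^sub>R w) \<le> norm (real (Suc k) *\<^sub>R w)" "norm w \<le> norm (real (Suc k) *\<^sub>R w)"
      by (auto simp: mult_right_mono intro: mult_right_mono[of 1 "1 + real k" "norm w", simplified])
    then have "norm (real k *\<^sub>R w) < \<epsilon>" "norm w < \<epsilon>"
      using Suc.prems by linarith+
    moreover have "real (Suc k) *\<^sub>R w = hmul w (real k *\<^sub>R w)"
      using hmul_scaleR[of 1 w "real k"] by simp
    ultimately show ?thesis using Suc.IH S_hmul by simp
  qed
qed simp

text \<open>Every element of the model group is an \<open>n\<close>-th power of an element near \<open>0\<close>, so \<open>S\<close> extends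
  by \<open>n\<close>-th powers.\<close>

definition E :: "'a \<Rightarrow> 'g"
  where "E u = (let n = Suc (nat \<lceil>norm u / \<epsilon>\<rceil>) in grp.pw (S ((1 / real n) *\<^sub>R u)) n)"

text \<open>Both roots of \<open>u\<close> are multiples of the common root \<open>w\<close>, which
  is \<open>u\<close> divided by \<open>m n\<close>; both sides are the power of \<open>S w\<close>
  with exponent \<open>m n\<close>.\<close>

lemma root_independent:
  assumes m: "m > 0" "norm u < real m * \<epsilon>" and n: "n > 0" "norm u < real n * \<epsilon>"
  shows "grp.pw (S ((1 / real m) *\<^sub>R u)) m = grp.pw (S ((1 / real n) *\<^sub>R u)) n"
proof -
  define w where "w = (1 / (real m * real n)) *\<^sub>R u"
  have w: "(1 / real m) *\<^sub>R u = real n *\<^sub>R w" "(1 / real n) *\<^sub>R u = real m *\<^sub>R w"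
    using m n by (simp_all add: w_def)
  have small: "norm (real n *\<^sub>R w) < \<epsilon>" "norm (real m *\<^sub>R w) < \<epsilon>"
    unfolding w[symmetric] using m n by (simp_all add: divide_less_eq mult.commute)
  show ?thesis
    unfolding w using small by (simp only: S_scaleR_nat grp.pw_mult[symmetric] mult.commute)
qed

lemma E_eq:
  assumes "n > 0" "norm u < real n * \<epsilon>"
  shows "E u = grp.pw (S ((1 / real n) *\<^sub>R u)) n"
  unfolding E_def Let_def
proof (rule root_independent[OF _ _ assms])
  have "norm u / \<epsilon> < real (Suc (nat \<lceil>norm u / \<epsilon>\<rceil>))"
    using eps by (simp add: le_nat_iff) linarith
  then show "norm u < real (Suc (nat \<lceil>norm u / \<epsilon>\<rceil>)) * \<epsilon>"
    using eps by (simp only: pos_divide_less_eq)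
qed simp

lemma E_eq_S: "norm u < \<epsilon> \<Longrightarrow> E u = S u"
  using E_eq[of 1 u] by simp

lemma E_0 [simp]: "E 0 = gunit"
  using E_eq_S[of 0] eps by simp

text \<open>With \<open>x = u / n\<close>, \<open>y = v / n\<close> and
  \<open>z = b x y / 2\<close>, everything takes place in the ball, and \<open>S z\<close> is a
  square root of the commutator of \<open>S x\<close> and \<open>S y\<close> that commutes with
  both. Collecting powers contributes the exponent \<open>n (n - 1)\<close> of \<open>S z\<close>,
  and \<open>S x S y = S (x + y) S z\<close> contributes \<open>n\<close> more. The total is
  \<open>n * n\<close>, and \<open>n * n\<close> times \<open>z\<close> is exactly
  \<open>b u v / 2\<close>.\<close>

lemma E_hmul: "E (hmul u v) = gmul (E u) (E v)"
proof -
  \<comment> \<open>Divided by \<open>n\<close>, this bounds the norm of every argument of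
    \<open>S\<close> below, so a single choice of \<open>n\<close> serves for all of them.\<close>
  define K where "K = norm u + norm v + norm (b u v)"
  obtain n :: nat where n0: "real n > K / \<epsilon>"
    using reals_Archimedean2 by blast
  have K: "K \<ge> 0" by (simp add: K_def)
  have n: "n > 0" "real n \<ge> 1" "K < real n * \<epsilon>"
  proof -
    have "K / \<epsilon> \<ge> 0" using K eps by simp
    then show "n > 0" using n0 by (cases n) auto
    then show "real n \<ge> 1" by simp
    show "K < real n * \<epsilon>" using n0 eps by (simp add: pos_divide_less_eq)
  qed
  define x y where "x = (1 / real n) *\<^sub>R u" and "y = (1 / real n) *\<^sub>R v"
  define z where "z = (1/2) *\<^sub>R b x y"
  have Kn: "K / real n < \<epsilon>" using n by (simp add: divide_less_eq mult.commute)
  have nx: "norm x = norm u / n" "norm y = norm v / n"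
    using n by (simp_all add: x_def y_def)
  define \<beta> where "\<beta> = norm (b u v) / n"
  have nz: "norm (real n *\<^sub>R z) \<le> \<beta> / 2"
    using n by (simp add: z_def x_def y_def \<beta>_def scaleR_left scaleR_right)
  have "norm z * 1 \<le> norm z * real n"
    using n by (intro mult_left_mono) auto
  then have nz': "norm z \<le> \<beta> / 2"
    using nz n by (simp add: mult.commute)
  have sum: "norm x + norm y + \<beta> < \<epsilon>"
    using Kn by (simp add: K_def nx \<beta>_def add_divide_distrib)
  have "\<beta> \<ge> 0" by (simp add: \<beta>_def)
  have s: "norm x < \<epsilon>" "norm y < \<epsilon>" "norm (x + y) < \<epsilon>" "norm z < \<epsilon>" "norm (real n *\<^sub>R z) < \<epsilon>"
      "norm (x + y - z) < \<epsilon>" "norm (x + y + real n *\<^sub>R z) < \<epsilon>" 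
    using sum nz nz' norm_triangle_ineq[of x y] norm_triangle_ineq4[of "x + y" z]
      norm_triangle_ineq[of "x + y" "real n *\<^sub>R z"] norm_ge_zero[of x] norm_ge_zero[of y]
      \<open>\<beta> \<ge> 0\<close>
    by linarith+
  have [simp]: "b z w = 0" "b w z = 0" for w by (simp_all add: z_def scaleR_left scaleR_right)
  have xy: "gmul (S x) (S y) = gmul (S (x + y)) (S z)"
  proof -
    have "hmul x y = hmul (x + y) z" by (simp add: hmul_def z_def add_left scaleR_right)
    then show ?thesis using s by (metis S_hmul)
  qed
  have comm: "gmul (S z) (S w) = gmul (S w) (S z)" if "norm w < \<epsilon>" for w
  proof -
    have "hmul w z = hmul z w" by (simp add: hmul_def)
    then show ?thesis using s that by (metis S_hmul)
  qed
  have yx: "S (x + y) = gmul (gmul (S y) (S x)) (S z)"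
  proof -
    have "hmul y x = x + y - z" using antisym[of x y] by (simp add: hmul_def z_def)
    moreover have "hmul (x + y - z) z = x + y" by (simp add: hmul_def)
    ultimately show ?thesis using s by (metis S_hmul)
  qed
  have "gmul (E u) (E v) = gmul (grp.pw (S x) n) (grp.pw (S y) n)"
  proof -
    have "norm u < real n * \<epsilon>" "norm v < real n * \<epsilon>"
      using n(3) unfolding K_def by (smt (verit) norm_ge_zero)+
    then show ?thesis using E_eq[OF n(1)] by (simp add: x_def y_def)
  qed
  also have "\<dots> = gmul (grp.pw (gmul (S x) (S y)) n) (grp.pw (S z) (n * (n - 1)))"
  proof (rule grp.pw_collect)
    show "gmul (S x) (S y) = gmul (S y) (gmul (S x) (gmul (S z) (S z)))"
      using xy yx by (simp add: grp.assoc)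
  qed (use comm s in auto)
  also have "\<dots> = gmul (grp.pw (S (x + y)) n) (gmul (grp.pw (S z) n) (grp.pw (S z) (n * (n - 1))))"
    using comm[OF s(3)] by (simp add: xy grp.pw_distrib grp.assoc)
  also have "gmul (grp.pw (S z) n) (grp.pw (S z) (n * (n - 1))) = grp.pw (S z) (n * n)"
  proof -
    have "n + n * (n - 1) = n * n" using n by (cases n) auto
    then show ?thesis by (metis grp.pw_add)
  qed
  also have "\<dots> = grp.pw (S (real n *\<^sub>R z)) n"
    using s by (simp only: grp.pw_mult S_scaleR_nat)
  also have "gmul (grp.pw (S (x + y)) n) (grp.pw (S (real n *\<^sub>R z)) n) =
      grp.pw (gmul (S (x + y)) (S (real n *\<^sub>R z))) n"
    using s comm[of "x + y"] grp.pw_commute[of "S z" "S (x + y)" n]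
    by (subst grp.pw_distrib) (simp_all add: S_scaleR_nat)
  also have "gmul (S (x + y)) (S (real n *\<^sub>R z)) = S (x + y + real n *\<^sub>R z)"
    using S_hmul[of "x + y" "real n *\<^sub>R z"] s by (simp add: hmul_def scaleR_right)
  also have "x + y + real n *\<^sub>R z = (1 / real n) *\<^sub>R hmul u v"
    using n by (simp add: hmul_def x_def y_def z_def scaleR_left scaleR_right algebra_simps)
  also have "grp.pw (S ((1 / real n) *\<^sub>R hmul u v)) n = E (hmul u v)"
  proof -
    have "norm (hmul u v) \<le> norm u + norm v + norm (b u v) / 2"
      unfolding hmul_def using norm_triangle_ineq[of u v] norm_triangle_ineq[of "u + v" "(1/2) *\<^sub>R b u v"]
      by simp
    also have "\<dots> \<le> K" by (simp add: K_def)
    finally show ?thesis using n E_eq[OF n(1), of "hmul u v"] by simp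
  qed
  finally show ?thesis by simp
qed

lemma E_minus: "E (- u) = ginv (E u)"
  by (metis E_0 E_hmul grp.inverse_unique hmul_minus(1) grp.inverse_inverse)

lemma E_translate: "norm (hmul (- u) v) < \<epsilon> \<Longrightarrow> E v = gmul (E u) (S (hmul (- u) v))"
  by (metis E_eq_S E_hmul hmul_cancel(2))

lemma continuous_E: "continuous_on UNIV E"
proof (rule continuous_at_imp_continuous_on, rule ballI)
  fix u
  let ?W = "{v. norm (hmul (- u) v) < \<epsilon>}"
  have W: "open ?W"
    by (intro open_Collect_less continuous_intros)
  have "continuous_on ?W (\<lambda>v. gmul (E u) (S (hmul (- u) v)))"
    by (intro continuous_intros continuous_on_compose2[OF continuous_S]) auto
  then have "continuous_on ?W E"
    by (rule continuous_on_eq) (simp add: E_translate)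
  then show "isCont E u"
    using W eps by (simp add: continuous_on_eq_continuous_at)
qed

lemma open_translate:
  assumes "open U" shows "open {q. gmul a q \<in> U}"
proof -
  have "continuous_on UNIV (gmul a)" by (intro continuous_intros)
  then show ?thesis using open_vimage[OF assms] by (simp add: vimage_def)
qed

lemma open_E:
  assumes "open U" shows "open (E ` U)"
proof (subst open_subopen, clarify)
  fix u assume u: "u \<in> U"
  let ?V = "{w. norm w < \<epsilon> \<and> hmul u w \<in> U}"
  have "open {w. hmul u w \<in> U}"
  proof -
    have "continuous_on UNIV (hmul u)" by (intro continuous_intros)
    then show ?thesis using open_vimage[OF assms] by (simp add: vimage_def)
  qed
  then have V: "open ?V"
    by (intro open_Collect_conj open_Collect_less continuous_intros)
  have "open {q. gmul (ginv (E u)) q \<in> S ` ?V}"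
    by (intro open_translate open_S V) auto
  moreover have "E u \<in> {q. gmul (ginv (E u)) q \<in> S ` ?V}"
    using u eps by (auto intro!: image_eqI[of _ _ 0])
  moreover have "{q. gmul (ginv (E u)) q \<in> S ` ?V} \<subseteq> E ` U"
  proof clarify
    fix q w assume w: "gmul (ginv (E u)) q = S w" "norm w < \<epsilon>" "hmul u w \<in> U"
    have "q = gmul (E u) (gmul (ginv (E u)) q)"
      by (simp flip: grp.assoc)
    then have "q = E (hmul u w)" using w by (simp add: E_hmul E_eq_S)
    then show "q \<in> E ` U" using w by blast
  qed
  ultimately show "\<exists>T. open T \<and> E u \<in> T \<and> T \<subseteq> E ` U" by blast
qed

text \<open>The range is an open subgroup. Its translate to a point outside is open and disjoint
  from it, so the complement is open too and connectedness decides.\<close>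

lemma surj_E: "surj E"
proof -
  have rng: "gmul (ginv p) q \<in> range E" if "p \<in> range E" "q \<in> range E" for p q
    using that by (auto simp flip: E_minus E_hmul)
  have "open (- range E)"
  proof (subst open_subopen, rule ballI)
    fix q assume q: "q \<in> - range E"
    have "open {x. gmul (ginv q) x \<in> range E}"
      by (intro open_translate open_E) simp
    moreover have "q \<in> {x. gmul (ginv q) x \<in> range E}"
      using E_0 by (auto simp: image_iff intro: exI[of _ 0])
    moreover have "x \<notin> range E" if x: "gmul (ginv q) x \<in> range E" for x
    proof
      assume "x \<in> range E"
      then obtain u v where uv: "gmul (ginv q) x = E u" "x = E v" using x by blast
      have "q = gmul (E v) (E (- u))"
        unfolding E_minus uv(1)[symmetric] uv(2)[symmetric]
        by (simp add: grp.inverse_distrib_swap flip: grp.assoc)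
      then show False using q by (metis ComplD E_hmul rangeI)
    qed
    ultimately show "\<exists>T. open T \<and> q \<in> T \<and> T \<subseteq> - range E" by blast
  qed
  moreover have "open (range E)" by (rule open_E) simp
  ultimately have "range E \<inter> UNIV = {} \<or> - range E \<inter> UNIV = {}"
    by (intro connectedD[OF connected_G]) auto
  then show ?thesis by auto
qed

lemma open_image_S: "open (S ` ball 0 \<epsilon>)"
  by (rule open_S) auto

definition L :: "'g \<Rightarrow> 'a"
  where "L = inv_into (ball 0 \<epsilon>) S"

lemma L_S [simp]: "norm u < \<epsilon> \<Longrightarrow> L (S u) = u"
  using inj_S by (simp add: L_def)

lemma continuous_L: "continuous_on (S ` ball 0 \<epsilon>) L"
proof (rule continuous_on_inverse_open_map[OF continuous_S refl])
  fix U :: "'a set" assume "openin (top_of_set (ball 0 \<epsilon>)) U"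
  then have "open U" "U \<subseteq> ball 0 \<epsilon>" by (auto simp: openin_open_eq)
  then have "open (S ` U)" "S ` U \<subseteq> S ` ball 0 \<epsilon>" using open_S by auto
  then show "openin (top_of_set (S ` ball 0 \<epsilon>)) (S ` U)"
    by (simp add: openin_open_eq open_image_S)
qed simp

text \<open>Near \<open>x\<close> the map \<open>E\<close> is a left translate of \<open>S\<close>,
  which is injective on the ball; hence \<open>x\<close> is isolated in its fibre.\<close>

lemma kernel_discrete:
  obtains d where "d > 0" "\<And>y. E y = E x \<Longrightarrow> norm (y - x) < d \<Longrightarrow> y = x"
proof -
  have "continuous_on UNIV (\<lambda>y. norm (hmul (- x) y))" by (intro continuous_intros)
  then have "isCont (\<lambda>y. norm (hmul (- x) y)) x" by (simp add: continuous_on_eq_continuous_at)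
  then obtain d where d: "d > 0" "\<And>y. dist y x < d \<Longrightarrow> norm (hmul (- x) y) < \<epsilon>"
    unfolding continuous_at_eps_delta using eps by (auto simp: dist_norm)
  show ?thesis
  proof (rule that[OF d(1)])
    fix y assume y: "E y = E x" "norm (y - x) < d"
    then have s: "norm (hmul (- x) y) < \<epsilon>" using d(2) by (simp add: dist_norm)
    then have "S (hmul (- x) y) = S 0"
      using y by (simp add: E_eq_S[symmetric] E_hmul E_minus)
    then have "hmul (- x) y = 0" using s eps by (metis L_S norm_zero)
    then show "y = x" by (metis hmul_0(2) hmul_cancel(2))
  qed
qed

text \<open>A null-homotopy \<open>h\<close> of the loop \<open>E (t *\<^sub>R k)\<close> is lifted by multiplying up the small
  increments \<open>L (ginv (h (s, i/N)) (h (s, (i+1)/N)))\<close>; the endpoint \<open>l N s\<close> of the lift moves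
  continuously in the discrete kernel from \<open>k\<close> at \<open>s = 0\<close> to \<open>0\<close> at \<open>s = 1\<close>. (The lifting theorems
  of the library require the base to be a normed space.)\<close>

lemma kernel_E:
  assumes k: "E k = gunit"
  shows "k = 0"
proof -
  have "path (\<lambda>t. E (t *\<^sub>R k))"
    unfolding path_def by (intro continuous_on_compose2[OF continuous_E] continuous_intros) auto
  moreover have "path (\<lambda>t. gunit)" by (simp add: path_def)
  ultimately have "homotopic_loops UNIV (\<lambda>t. E (t *\<^sub>R k)) (\<lambda>t. gunit)"
    using simply_connected_G k unfolding simply_connected_def
    by (simp add: pathstart_def pathfinish_def)
  then obtain h :: "real \<times> real \<Rightarrow> 'g" where h: "continuous_on ({0..1} \<times> {0..1}) h"
      "\<forall>t\<in>{0..1}. h (0, t) = E (t *\<^sub>R k)" "\<forall>t\<in>{0..1}. h (1, t) = gunit"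
      "\<forall>s\<in>{0..1}. h (s, 1) = h (s, 0)"
    unfolding homotopic_loops pathstart_def pathfinish_def o_def by metis
  let ?W = "S ` ball 0 \<epsilon>"
  let ?T = "({0..1} \<times> {0..1} \<times> {0..1}) :: (real \<times> real \<times> real) set"
  let ?f = "\<lambda>(s, t, t'). gmul (ginv (h (s, t))) (h (s, t'))"
  have contf: "continuous_on ?T ?f"
    unfolding case_prod_beta
    by (intro continuous_intros continuous_on_compose2[OF h(1)]) auto
  obtain d where d: "d > 0" "\<And>s t t'. s \<in> {0..1} \<Longrightarrow> t \<in> {0..1} \<Longrightarrow> t' \<in> {0..1} \<Longrightarrow> \<bar>t - t'\<bar> < d \<Longrightarrow>
      gmul (ginv (h (s, t))) (h (s, t')) \<in> ?W"
  proof -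
    \<comment> \<open>\<open>K\<close> collects the triples whose increment is not in
      \<open>?W\<close>. It is compact and misses the diagonal \<open>t = t'\<close>, so
      \<open>\<bar>t - t'\<bar>\<close> has a positive minimum on it, which serves as
      \<open>d\<close>.\<close>
    define K where "K = ?T \<inter> ?f -` (- ?W)"
    have "closed K" unfolding K_def
      by (rule continuous_closed_preimage[OF contf]) (auto intro: closed_Times simp: open_image_S closed_Compl)
    then have "compact (?T \<inter> K)"
      by (intro compact_Int_closed compact_Times) auto
    then have K: "compact K" by (simp add: K_def Int_assoc[symmetric])
    have memK: "(s, t, t') \<in> K" if "s \<in> {0..1}" "t \<in> {0..1}" "t' \<in> {0..1}"
      "gmul (ginv (h (s, t))) (h (s, t')) \<notin> ?W" for s t t'
      using that by (simp add: K_def)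
    show ?thesis
    proof (cases "K = {}")
      case True
      show ?thesis
      proof (rule that[of 1])
        fix s t t' :: real assume "s \<in> {0..1}" "t \<in> {0..1}" "t' \<in> {0..1}"
        with memK True show "gmul (ginv (h (s, t))) (h (s, t')) \<in> ?W" by (metis empty_iff)
      qed simp
    next
      case False
      have "continuous_on K (\<lambda>(s, t, t'). \<bar>t - t'\<bar>)"
        unfolding case_prod_beta by (intro continuous_intros)
      from continuous_attains_inf[OF K False this]
      obtain z where z: "z \<in> K" "\<forall>y\<in>K. (\<lambda>(s, t, t'). \<bar>t - t'\<bar>) z \<le> (\<lambda>(s, t, t'). \<bar>t - t'\<bar>) y"
        by blast
      obtain s0 t0 t0' where z_eq: "z = (s0, t0, t0')" by (metis prod.exhaust)
      have m: "(s0, t0, t0') \<in> K" "\<And>s t t'. (s, t, t') \<in> K \<Longrightarrow> \<bar>t0 - t0'\<bar> \<le> \<bar>t - t'\<bar>"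
        using z(1) z(2)[rule_format, of "(s, t, t')" for s t t'] by (simp_all add: z_eq)
      have "t0 \<noteq> t0'"
      proof
        assume "t0 = t0'"
        then have "gunit \<notin> ?W" using m(1) by (simp add: K_def)
        moreover have "gunit \<in> ?W" using eps by (intro image_eqI[of _ _ 0]) auto
        ultimately show False by blast
      qed
      show ?thesis
      proof (rule that[of "\<bar>t0 - t0'\<bar>"])
        show "\<bar>t0 - t0'\<bar> > 0" using \<open>t0 \<noteq> t0'\<close> by simp
        fix s t t' :: real
        assume *: "s \<in> {0..1}" "t \<in> {0..1}" "t' \<in> {0..1}" "\<bar>t - t'\<bar> < \<bar>t0 - t0'\<bar>"
        show "gmul (ginv (h (s, t))) (h (s, t')) \<in> ?W"
        proof (rule ccontr)
          assume "gmul (ginv (h (s, t))) (h (s, t')) \<notin> ?W"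
          from m(2)[OF memK[OF *(1-3) this]] *(4) show False by linarith
        qed
      qed
    qed
  qed
  \<comment> \<open>The summand \<open>1 / d\<close> makes the increments over steps of length
    \<open>1 / N\<close> small enough for \<open>L\<close>; the summand
    \<open>norm k / \<epsilon>\<close> puts \<open>k / N\<close> into the ball, where
    \<open>L\<close> recovers it from \<open>S\<close>.\<close>
  obtain N :: nat where N: "real N > 1 / d + norm k / \<epsilon>"
    using reals_Archimedean2 by blast
  have pos: "1 / d > 0" "norm k / \<epsilon> \<ge> 0" using d eps by auto
  then have N0: "real N > 0" using N by linarith
  have "1 / d < real N" "norm k / \<epsilon> < real N" using N pos by linarith+
  then have N1: "1 / real N < d" and N2: "norm k / real N < \<epsilon>"
    using N0 d eps by (simp_all add: field_simps)
  define st where "st i s = gmul (ginv (h (s, real i / N))) (h (s, real (Suc i) / N))" for i s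
  define l where "l = rec_nat (\<lambda>s. 0) (\<lambda>i f s. hmul (f s) (L (st i s)))"
  have l_0: "l 0 s = 0" and l_Suc: "l (Suc i) s = hmul (l i s) (L (st i s))" for i s
    by (simp_all add: l_def)
  have in01: "real i / N \<in> {0..1}" if "i \<le> N" for i
    using that N0 by simp
  have st: "st i s \<in> ?W" if "i < N" "s \<in> {0..1}" for i s
    unfolding st_def
  proof (rule d(2)[OF that(2)])
    show "\<bar>real i / N - real (Suc i) / N\<bar> < d" using N0 N1 by (simp add: diff_divide_distrib[symmetric])
  qed (use in01[of i] in01[of "Suc i"] that in auto)
  have l: "continuous_on {0..1} (l i) \<and> (\<forall>s\<in>{0..1}. E (l i s) = gmul (ginv (h (s, 0))) (h (s, real i / N)))"
    if "i \<le> N" for i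
    using that
  proof (induction i)
    case 0
    have "l 0 = (\<lambda>s. 0)" by (simp add: l_0 fun_eq_iff)
    then show ?case by simp
  next
    case (Suc i)
    have "continuous_on {0..1} (\<lambda>s. st i s)"
      unfolding st_def using in01[of i] in01[of "Suc i"] Suc.prems
      by (intro continuous_intros continuous_on_compose2[OF h(1)]) auto
    then have "continuous_on {0..1} (\<lambda>s. hmul (l i s) (L (st i s)))"
      using Suc st by (intro continuous_intros continuous_on_compose2[OF continuous_L]) auto
    moreover have "l (Suc i) = (\<lambda>s. hmul (l i s) (L (st i s)))" by (simp add: l_Suc fun_eq_iff)
    moreover have "E (l (Suc i) s) = gmul (ginv (h (s, 0))) (h (s, real (Suc i) / N))" if s: "s \<in> {0..1}" for s
    proof -
      obtain w where w: "norm w < \<epsilon>" "st i s = S w"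
        using st[of i s] Suc.prems s by auto
      have "E (L (st i s)) = st i s" using w by (simp add: E_eq_S)
      moreover have "gmul x (gmul (ginv y) z) = gmul (gmul x (ginv y)) z" for x y z
        by (simp add: grp.assoc)
      ultimately show ?thesis
        using Suc s by (simp add: l_Suc E_hmul st_def grp.assoc) (simp flip: grp.assoc)
    qed
    ultimately show ?case by simp
  qed
  have E1: "E (l N t) = gunit" if "t \<in> {0..1}" for t
    using l[of N] h(4) that N0 by simp
  have eq: "l N 0 = l N 1"
  proof (rule connected_local_const[of "{0..1}"])
    show "\<forall>s\<in>{0..1}. eventually (\<lambda>t. l N s = l N t) (at s within {0..1})"
    proof
      fix s :: real assume s: "s \<in> {0..1}"
      obtain e where e: "e > 0" "\<And>y. E y = E (l N s) \<Longrightarrow> norm (y - l N s) < e \<Longrightarrow> y = l N s"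
        using kernel_discrete by blast
      have "(l N \<longlongrightarrow> l N s) (at s within {0..1})"
        using l[of N] s unfolding continuous_on_def by blast
      then have "eventually (\<lambda>t. dist (l N t) (l N s) < e) (at s within {0..1})"
        using e(1) by (rule tendstoD)
      moreover have "eventually (\<lambda>t. t \<in> {0..1}) (at s within {0..1})"
        by (simp add: eventually_at_filter)
      ultimately show "eventually (\<lambda>t. l N s = l N t) (at s within {0..1})"
        by eventually_elim (use e(2) E1 s in \<open>metis dist_norm\<close>)
    qed
  qed auto
  have "l i 1 = 0" if "i \<le> N" for i
    using that
  proof (induction i)
    case (Suc i)
    have "st i 1 = S 0"
      using h(3) in01[of i] in01[of "Suc i"] Suc.prems by (simp add: st_def)
    then have "L (st i 1) = 0" using eps by (simp only: L_S norm_zero)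
    then show ?case using Suc by (simp add: l_Suc)
  qed (simp add: l_0)
  moreover have "l i 0 = (real i / N) *\<^sub>R k" if "i \<le> N" for i
    using that
  proof (induction i)
    case (Suc i)
    have "st i 0 = E (hmul (- ((real i / N) *\<^sub>R k)) ((real (Suc i) / N) *\<^sub>R k))"
      using h(2) in01[of i] in01[of "Suc i"] Suc.prems by (simp add: st_def E_hmul E_minus)
    also have "hmul (- ((real i / N) *\<^sub>R k)) ((real (Suc i) / N) *\<^sub>R k) = (1 / N) *\<^sub>R k"
      using hmul_scaleR[of "- (real i / N)" k "real (Suc i) / N"] by (simp add: add_divide_distrib)
    also have "E \<dots> = S \<dots>" using N2 by (intro E_eq_S) simp
    finally have "L (st i 0) = (1 / N) *\<^sub>R k" using N2 by simp
    then show ?case using Suc hmul_scaleR[of "real i / N" k "1 / N"]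
      by (simp add: l_Suc add_divide_distrib add.commute)
  qed (simp add: l_0)
  ultimately show ?thesis using eq N0 by simp
qed

lemma bij_E: "bij E"
proof -
  have "x = y" if "E x = E y" for x y
  proof -
    have "E (hmul (- x) y) = gunit" using that by (simp add: E_hmul E_minus)
    then have "hmul (- x) y = 0" by (rule kernel_E)
    then show ?thesis by (metis hmul_0(2) hmul_cancel(2))
  qed
  then show ?thesis using surj_E by (auto simp: bij_def inj_def)
qed

end

section \<open>Lie groups in charts\<close>

text \<open>A Leibniz rule for a family of linear maps whose differentiability is known only on each
  fixed argument. Expansion in a basis reduces it to products of functions, and uniqueness of
  derivatives shows that \<open>G' w\<close> is linear in \<open>w\<close>.\<close>

lemma has_derivative_linear_apply:
  fixes G :: "'a::real_normed_vector \<Rightarrow> 'b::euclidean_space \<Rightarrow> 'c::real_normed_vector"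
  assumes "open S" "y0 \<in> S" and lin: "\<And>y. y \<in> S \<Longrightarrow> linear (G y)"
    and G': "\<And>w. ((\<lambda>y. G y w) has_derivative G' w) (at y0)"
    and h: "(h has_derivative h') (at y0)"
  shows "((\<lambda>y. G y (h y)) has_derivative (\<lambda>v. G y0 (h' v) + G' (h y0) v)) (at y0)"
proof -
  have exp: "G y w = (\<Sum>i\<in>Basis. (w \<bullet> i) *\<^sub>R G y i)" if "y \<in> S" for y w
    by (rule linear_basis_expansion[OF lin[OF that]])
  have sum: "((\<lambda>y. \<Sum>i\<in>Basis. (h y \<bullet> i) *\<^sub>R G y i) has_derivative
      (\<lambda>v. \<Sum>i\<in>Basis. (h y0 \<bullet> i) *\<^sub>R G' i v + (h' v \<bullet> i) *\<^sub>R G y0 i)) (at y0)"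
    by (intro has_derivative_sum has_derivative_scaleR has_derivative_inner_left h G')
  have "G' w = (\<lambda>v. \<Sum>i\<in>Basis. (w \<bullet> i) *\<^sub>R G' i v)" for w
  proof -
    have "((\<lambda>y. \<Sum>i\<in>Basis. (w \<bullet> i) *\<^sub>R G y i) has_derivative (\<lambda>v. \<Sum>i\<in>Basis. (w \<bullet> i) *\<^sub>R G' i v)) (at y0)"
      by (intro has_derivative_sum has_derivative_scaleR_right G')
    then have "((\<lambda>y. G y w) has_derivative (\<lambda>v. \<Sum>i\<in>Basis. (w \<bullet> i) *\<^sub>R G' i v)) (at y0)"
      by (rule has_derivative_transform_within_open[OF _ assms(1,2)]) (simp add: exp)
    then show ?thesis by (rule has_derivative_unique[OF G'])
  qed
  then have 1: "G' w v = (\<Sum>i\<in>Basis. (w \<bullet> i) *\<^sub>R G' i v)" for w v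
    by metis
  have 2: "(\<lambda>v. \<Sum>i\<in>Basis. (h y0 \<bullet> i) *\<^sub>R G' i v + (h' v \<bullet> i) *\<^sub>R G y0 i) = (\<lambda>v. G y0 (h' v) + G' (h y0) v)"
    by (rule ext, subst 1, subst exp[OF assms(2)]) (simp add: sum.distrib add.commute)
  show ?thesis
    by (rule has_derivative_transform_within_open[OF sum[unfolded 2] assms(1,2)]) (simp add: exp)
qed

lemma has_derivative_partial_snd:
  assumes "(f has_derivative f') (at (x, y))"
  shows "((\<lambda>y. f (x, y)) has_derivative (\<lambda>v. f' (0, v))) (at y)"
  by (rule has_derivative_compose[where f="\<lambda>y. (x, y)", OF _ assms])
    (auto intro!: derivative_eq_intros)

text \<open>A partial derivative is the total derivative in a direction \<open>(0, v)\<close>. This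
  yields the smooth dependence on the base point of the differential of a left translation.\<close>

lemma smooth_on_partial_derivative:
  fixes f :: "'a::euclidean_space \<times> 'b::euclidean_space \<Rightarrow> 'c::real_normed_vector"
  assumes f: "smooth_on W f" "open W" and "smooth_on S h" "smooth_on S k" "open S"
    and "\<And>x. x \<in> S \<Longrightarrow> (h x, k x) \<in> W"
  shows "smooth_on S (\<lambda>x. frechet_derivative (\<lambda>y. f (h x, y)) (at (k x)) v)"
proof -
  have "smooth_on S (\<lambda>x. frechet_derivative f (at (h x, k x)) (0, v))"
    by (rule smooth_on_compose[where f="\<lambda>x. (h x, k x)",
          OF assms(5,2) _ smooth_on_frechet_derivative[OF f(1), of "(0, v)"]])
      (use assms in \<open>auto simp: smooth_on_def intro!: Ck_on_Pair\<close>)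
  moreover have "frechet_derivative f (at (h x, k x)) (0, v) = frechet_derivative (\<lambda>y. f (h x, y)) (at (k x)) v"
    if "x \<in> S" for x
    using frechet_derivative_eqI[OF has_derivative_partial_snd[OF smooth_on_has_derivative[OF f(1) assms(6)[OF that]]]]
    by simp
  ultimately show ?thesis
    by (rule smooth_on_cong[OF assms(5), rotated])
qed

lemma smooth_on_const [simp]: "smooth_on S (\<lambda>x. a)"
  by (simp add: smooth_on_def)

lemma smooth_on_bounded_linear: "bounded_linear L \<Longrightarrow> smooth_on S L"
  by (simp add: smooth_on_def Ck_on_bounded_linear)

lemma smooth_on_ident [simp]: "smooth_on S (\<lambda>x. x)"
  by (simp add: smooth_on_bounded_linear bounded_linear_ident)

lemma smooth_on_Pair: "open S \<Longrightarrow> smooth_on S f \<Longrightarrow> smooth_on S g \<Longrightarrow> smooth_on S (\<lambda>x. (f x, g x))"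
  by (simp add: smooth_on_def Ck_on_Pair)

section \<open>Smooth maps and their differentials in charts\<close>

locale lie_group_charts =
  fixes A :: "('g::{t2_space,second_countable_topology}, 'n::finite) chart set"
    and gmul :: "'g \<Rightarrow> 'g \<Rightarrow> 'g" and gunit :: 'g and ginv :: "'g \<Rightarrow> 'g"
  assumes lie: "lie_group A gmul gunit ginv"
begin

sublocale topological_group gmul gunit ginv
  using lie by (simp add: lie_group_def topological_group_def topological_group_axioms_def)

lemma is_chart: "c \<in> A \<Longrightarrow> is_chart c"
  using lie by (simp add: lie_group_def smooth_structure_def)

lemma open_chart_dom: "c \<in> A \<Longrightarrow> open (chart_dom c)"
  and open_chart_image: "c \<in> A \<Longrightarrow> open (chart_map c ` chart_dom c)"
  and continuous_on_chart_map: "c \<in> A \<Longrightarrow> continuous_on (chart_dom c) (chart_map c)"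
  and continuous_on_chart_inv: "c \<in> A \<Longrightarrow> continuous_on (chart_map c ` chart_dom c) (chart_inv c)"
  using is_chart[of c] by (auto simp: is_chart_def homeomorphism_def)

lemma chart_inv_map: "c \<in> A \<Longrightarrow> p \<in> chart_dom c \<Longrightarrow> chart_inv c (chart_map c p) = p"
  using is_chart[of c] by (auto simp: is_chart_def homeomorphism_def)

lemma chart_map_inv: "c \<in> A \<Longrightarrow> x \<in> chart_map c ` chart_dom c \<Longrightarrow> chart_map c (chart_inv c x) = x"
  and chart_inv_in_dom: "c \<in> A \<Longrightarrow> x \<in> chart_map c ` chart_dom c \<Longrightarrow> chart_inv c x \<in> chart_dom c"
  by (auto simp: chart_inv_map)

lemma chart_at: "chart_at A p \<in> A" "p \<in> chart_dom (chart_at A p)"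
proof -
  have "\<exists>c. c \<in> A \<and> p \<in> chart_dom c"
    using lie unfolding lie_group_def smooth_structure_def by blast
  from someI_ex[OF this] show "chart_at A p \<in> A" "p \<in> chart_dom (chart_at A p)"
    by (simp_all add: chart_at_def)
qed

lemma open_chart_vimage:
  assumes "c \<in> A" "continuous_on UNIV f" "open W"
  shows "open {x \<in> chart_map c ` chart_dom c. f (chart_inv c x) \<in> W}"
proof -
  have "continuous_on (chart_map c ` chart_dom c) (\<lambda>x. f (chart_inv c x))"
    using continuous_on_compose2[OF assms(2) continuous_on_chart_inv[OF assms(1)]] by auto
  from continuous_open_preimage[OF this open_chart_image[OF assms(1)] assms(3)]
  show ?thesis by (simp add: Int_def vimage_def)
qed

abbreviation mult_dom :: "('g, 'n) chart \<Rightarrow> ('g, 'n) chart \<Rightarrow> ('g, 'n) chart \<Rightarrow> ((real ^ 'n) \<times> (real ^ 'n)) set"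
  where "mult_dom c d e \<equiv> {(x, y). x \<in> chart_map c ` chart_dom c \<and> y \<in> chart_map d ` chart_dom d \<and>
                 gmul (chart_inv c x) (chart_inv d y) \<in> chart_dom e}"

lemma open_mult_dom:
  assumes "c \<in> A" "d \<in> A" "e \<in> A"
  shows "open (mult_dom c d e)"
proof -
  let ?I = "(chart_map c ` chart_dom c) \<times> (chart_map d ` chart_dom d)"
  have "continuous_on ?I (\<lambda>z. gmul (chart_inv c (fst z)) (chart_inv d (snd z)))"
    by (intro continuous_intros continuous_on_compose2[OF continuous_on_chart_inv[OF assms(1)]]
          continuous_on_compose2[OF continuous_on_chart_inv[OF assms(2)]]) auto
  from continuous_open_preimage[OF this open_Times[OF open_chart_image[OF assms(1)] open_chart_image[OF assms(2)]]
      open_chart_dom[OF assms(3)]]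
  show ?thesis by (rule back_subst[where P="open"]) auto
qed

lemma smooth_mult:
  "c \<in> A \<Longrightarrow> d \<in> A \<Longrightarrow> e \<in> A \<Longrightarrow>
    smooth_on (mult_dom c d e) (\<lambda>(x, y). chart_map e (gmul (chart_inv c x) (chart_inv d y)))"
  using lie unfolding lie_group_def by blast

text \<open>Continuity makes the sets on which smoothness is demanded open, as
  \<open>smooth_on\<close> presupposes.\<close>

definition smooth_map :: "('g \<Rightarrow> 'g) \<Rightarrow> bool"
  where "smooth_map f \<longleftrightarrow> continuous_on UNIV f \<and>
    (\<forall>c\<in>A. \<forall>d\<in>A. smooth_on {x \<in> chart_map c ` chart_dom c. f (chart_inv c x) \<in> chart_dom d}
       (\<lambda>x. chart_map d (f (chart_inv c x))))"

lemma smooth_map_ident: "smooth_map (\<lambda>p. p)"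
  unfolding smooth_map_def
proof (intro conjI ballI)
  fix c d assume cd: "c \<in> A" "d \<in> A"
  then have "smooth_on (chart_map c ` (chart_dom c \<inter> chart_dom d)) (chart_map d \<circ> chart_inv c)"
    using lie by (simp add: lie_group_def smooth_structure_def smoothly_compatible_def)
  moreover have "chart_map c ` (chart_dom c \<inter> chart_dom d) =
      {x \<in> chart_map c ` chart_dom c. chart_inv c x \<in> chart_dom d}"
    using chart_inv_map[OF cd(1)] by force
  ultimately show "smooth_on {x \<in> chart_map c ` chart_dom c. chart_inv c x \<in> chart_dom d}
       (\<lambda>x. chart_map d (chart_inv c x))" by (simp add: o_def)
qed simp

lemma smooth_map_gmul: "smooth_map (gmul a)"
  unfolding smooth_map_def
proof (intro conjI ballI)
  show "continuous_on UNIV (gmul a)" by (intro continuous_intros)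
  fix c d assume cd: "c \<in> A" "d \<in> A"
  let ?e = "chart_at A a"
  let ?W = "{y \<in> chart_map c ` chart_dom c. gmul a (chart_inv c y) \<in> chart_dom d}"
  have a: "chart_inv ?e (chart_map ?e a) = a"
    by (rule chart_inv_map[OF chart_at])
  have W: "open ?W"
    by (rule open_chart_vimage[OF cd(1) _ open_chart_dom[OF cd(2)]]) (intro continuous_intros)
  have "smooth_on ?W (\<lambda>y. (chart_map ?e a, y))"
    by (intro smooth_on_Pair W smooth_on_const smooth_on_ident)
  from smooth_on_compose[OF W open_mult_dom[OF chart_at(1)[of a] cd] this smooth_mult[OF chart_at(1)[of a] cd]]
  have "(\<lambda>y. (chart_map ?e a, y)) ` ?W \<subseteq> mult_dom ?e c d \<Longrightarrow>
      smooth_on ?W (\<lambda>y. chart_map d (gmul a (chart_inv c y)))" by (simp add: a)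
  moreover have "(\<lambda>y. (chart_map ?e a, y)) ` ?W \<subseteq> mult_dom ?e c d"
    using chart_at(2)[of a] by (auto simp: a)
  ultimately show "smooth_on ?W (\<lambda>y. chart_map d (gmul a (chart_inv c y)))" .
qed

text \<open>The differential of \<open>f\<close> between explicitly named charts. Push-forwards and
  changes of chart are both instances, so a single chain rule serves for all of them.\<close>

definition dmap :: "('g \<Rightarrow> 'g) \<Rightarrow> ('g, 'n) chart \<Rightarrow> ('g, 'n) chart \<Rightarrow> 'g \<Rightarrow> real ^ 'n \<Rightarrow> real ^ 'n"
  where "dmap f c d p = frechet_derivative (\<lambda>x. chart_map d (f (chart_inv c x))) (at (chart_map c p))"

lemma pushforward_dmap: "pushforward A f p = dmap f (chart_at A p) (chart_at A (f p)) p"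
  by (simp add: pushforward_def dmap_def o_def)

lemma chart_change_dmap: "chart_change c d p = dmap (\<lambda>p. p) c d p"
  by (simp add: chart_change_def dmap_def o_def)

lemma has_derivative_dmap:
  assumes "smooth_map f" "c \<in> A" "d \<in> A" "p \<in> chart_dom c" "f p \<in> chart_dom d"
  shows "((\<lambda>x. chart_map d (f (chart_inv c x))) has_derivative dmap f c d p) (at (chart_map c p))"
  unfolding dmap_def
proof (rule smooth_on_has_derivative)
  show "smooth_on {x \<in> chart_map c ` chart_dom c. f (chart_inv c x) \<in> chart_dom d}
       (\<lambda>x. chart_map d (f (chart_inv c x)))"
    using assms(1-3) by (simp add: smooth_map_def)
qed (use assms in \<open>simp add: chart_inv_map\<close>)

lemma linear_dmap:
  assumes "smooth_map f" "c \<in> A" "d \<in> A" "p \<in> chart_dom c" "f p \<in> chart_dom d"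
  shows "linear (dmap f c d p)"
  using has_derivative_dmap[OF assms] by (rule has_derivative_linear)

lemma dmap_chain:
  assumes f: "smooth_map f" "c \<in> A" "d \<in> A" "p \<in> chart_dom c" "f p \<in> chart_dom d"
    and h: "smooth_map h" "e \<in> A" "h (f p) \<in> chart_dom e"
  shows "dmap (\<lambda>p. h (f p)) c e p v = dmap h d e (f p) (dmap f c d p v)"
proof -
  let ?W = "{x \<in> chart_map c ` chart_dom c. f (chart_inv c x) \<in> chart_dom d}"
  have "((\<lambda>y. chart_map e (h (chart_inv d y))) has_derivative dmap h d e (f p))
      (at (chart_map d (f (chart_inv c (chart_map c p)))))"
    using has_derivative_dmap[OF h(1) f(3) h(2) f(5) h(3)] by (simp add: chart_inv_map[OF f(2,4)])
  from has_derivative_compose[OF has_derivative_dmap[OF f] this]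
  have "((\<lambda>x. chart_map e (h (f (chart_inv c x)))) has_derivative
      (\<lambda>v. dmap h d e (f p) (dmap f c d p v))) (at (chart_map c p))"
  proof (rule has_derivative_transform_within_open)
    show "open ?W" "chart_map c p \<in> ?W"
      using f by (auto intro!: open_chart_vimage open_chart_dom simp: smooth_map_def chart_inv_map)
    show "chart_map e (h (chart_inv d (chart_map d (f (chart_inv c x))))) = chart_map e (h (f (chart_inv c x)))"
      if "x \<in> ?W" for x
      using that f by (simp add: chart_inv_map)
  qed
  from frechet_derivative_eqI[OF this] show ?thesis
    by (simp add: dmap_def)
qed

lemma dmap_ident [simp]:
  assumes "c \<in> A" "p \<in> chart_dom c"
  shows "dmap (\<lambda>p. p) c c p v = v"
proof -
  have "((\<lambda>x. chart_map c (chart_inv c x)) has_derivative (\<lambda>v. v)) (at (chart_map c p))"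
    by (rule has_derivative_transform_within_open[OF has_derivative_ident open_chart_image[OF assms(1)]])
      (use assms chart_map_inv in auto)
  from frechet_derivative_eqI[OF this] show ?thesis by (simp add: dmap_def)
qed

lemma pushforward_gmul_gmul:
  "pushforward A (gmul (gmul a p)) q v = pushforward A (gmul a) (gmul p q) (pushforward A (gmul p) q v)"
  unfolding pushforward_dmap
  using dmap_chain[OF smooth_map_gmul chart_at(1) chart_at(1) chart_at(2) chart_at(2) smooth_map_gmul chart_at(1) chart_at(2),
      of a p q v]
  by (simp add: grp.assoc[abs_def])

text \<open>\<open>M x\<close> sends a tangent vector at the identity to the value at \<open>x\<close> of the left-invariant field it
  generates, and \<open>\<theta> x\<close> is its inverse, the Maurer--Cartan form. Writing \<open>\<theta>\<close> as a differential of
  the multiplication makes its smoothness immediate.\<close>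

definition c0 :: "('g, 'n) chart" where "c0 = chart_at A gunit"
definition x0 :: "real ^ 'n" where "x0 = chart_map c0 gunit"
definition U0 :: "(real ^ 'n) set" where "U0 = chart_map c0 ` chart_dom c0"
definition M :: "real ^ 'n \<Rightarrow> real ^ 'n \<Rightarrow> real ^ 'n"
  where "M x = dmap (gmul (chart_inv c0 x)) c0 c0 gunit"
definition \<theta> :: "real ^ 'n \<Rightarrow> real ^ 'n \<Rightarrow> real ^ 'n"
  where "\<theta> x = dmap (gmul (ginv (chart_inv c0 x))) c0 c0 (chart_inv c0 x)"
text \<open>On this set the inverse has coordinates in \<open>c0\<close> as well, so
  \<open>\<theta>\<close> is a partial differential of the multiplication written in that one
  chart.\<close>

definition U1 :: "(real ^ 'n) set"
  where "U1 = {x \<in> U0. ginv (chart_inv c0 x) \<in> chart_dom c0}"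
text \<open>Since \<open>M x0\<close> is the identity, this is the coordinate formula for the Lie
  bracket, at the identity, of the left-invariant fields generated by \<open>v\<close> and
  \<open>w\<close>.\<close>

definition bracket :: "real ^ 'n \<Rightarrow> real ^ 'n \<Rightarrow> real ^ 'n"
  where "bracket v w = frechet_derivative (\<lambda>x. M x w) (at x0) v - frechet_derivative (\<lambda>x. M x v) (at x0) w"

lemma c0: "c0 \<in> A" "gunit \<in> chart_dom c0"
  using chart_at by (simp_all add: c0_def)

lemma inv_x0 [simp]: "chart_inv c0 x0 = gunit"
  using chart_inv_map[OF c0] by (simp add: x0_def)

lemma U0: "open U0" "x0 \<in> U0"
  using open_chart_image[OF c0(1)] c0 by (auto simp: U0_def x0_def)

lemma U0_inv: "x \<in> U0 \<Longrightarrow> chart_inv c0 x \<in> chart_dom c0" "x \<in> U0 \<Longrightarrow> chart_map c0 (chart_inv c0 x) = x"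
  using chart_map_inv[OF c0(1)] chart_inv_in_dom[OF c0(1)] by (auto simp: U0_def)

lemma inverse_gunit [simp]: "ginv gunit = gunit"
  by (metis grp.left_inverse grp.right_neutral)

lemma U1: "open U1" "x0 \<in> U1" "U1 \<subseteq> U0"
proof -
  show "open U1" unfolding U1_def U0_def
    by (rule open_chart_vimage[OF c0(1) continuous_ginv open_chart_dom[OF c0(1)]])
  show "x0 \<in> U1" "U1 \<subseteq> U0" using U0 c0 by (auto simp: U1_def)
qed

lemma linear_M: "x \<in> U0 \<Longrightarrow> linear (M x)"
  unfolding M_def using U0_inv(1) c0 by (intro linear_dmap smooth_map_gmul) auto

lemma linear_\<theta>: "x \<in> U0 \<Longrightarrow> linear (\<theta> x)"
  unfolding \<theta>_def using U0_inv(1) c0 by (intro linear_dmap smooth_map_gmul) auto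

lemma \<theta>_M: "x \<in> U0 \<Longrightarrow> \<theta> x (M x v) = v"
  using dmap_chain[of "gmul (chart_inv c0 x)" c0 c0 gunit "gmul (ginv (chart_inv c0 x))" c0 v]
    U0_inv(1)[of x] c0 smooth_map_gmul
  by (simp add: \<theta>_def M_def flip: grp.assoc)

lemma M_\<theta>: "x \<in> U0 \<Longrightarrow> M x (\<theta> x v) = v"
  using dmap_chain[of "gmul (ginv (chart_inv c0 x))" c0 c0 "chart_inv c0 x" "gmul (chart_inv c0 x)" c0 v]
    U0_inv(1)[of x] c0 smooth_map_gmul
  by (simp add: \<theta>_def M_def flip: grp.assoc)

lemma gmul_gunit [simp]: "gmul gunit = (\<lambda>p. p)"
  by (simp add: fun_eq_iff)

lemma M_x0 [simp]: "M x0 v = v"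
  using c0 by (simp add: M_def)

definition mult0 :: "real ^ 'n \<Rightarrow> real ^ 'n \<Rightarrow> real ^ 'n"
  where "mult0 x y = chart_map c0 (gmul (chart_inv c0 x) (chart_inv c0 y))"

lemma smooth_mult0: "smooth_on (mult_dom c0 c0 c0) (\<lambda>z. mult0 (fst z) (snd z))"
  using smooth_mult[OF c0(1) c0(1) c0(1)] by (simp add: mult0_def case_prod_unfold)

lemma smooth_dmap_gmul:
  assumes "c \<in> A"
  shows "smooth_on (chart_map c ` chart_dom c) (\<lambda>x. dmap (gmul (chart_inv c x)) c0 c gunit v)"
proof -
  have "smooth_on (chart_map c ` chart_dom c) (\<lambda>x. frechet_derivative
      (\<lambda>y. (\<lambda>(x, y). chart_map c (gmul (chart_inv c x) (chart_inv c0 y))) (x, y)) (at x0) v)"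
    by (rule smooth_on_partial_derivative[OF smooth_mult[OF assms c0(1) assms] open_mult_dom[OF assms c0(1) assms]])
      (use assms c0 U0 open_chart_image chart_inv_in_dom in \<open>auto simp: U0_def[symmetric]\<close>)
  then show ?thesis by (simp add: dmap_def x0_def)
qed

lemma smooth_M: "smooth_on U0 (\<lambda>x. M x v)"
  unfolding M_def U0_def by (rule smooth_dmap_gmul[OF c0(1)])

lemma smooth_\<theta>: "smooth_on U1 (\<lambda>x. \<theta> x v)"
proof -
  have "smooth_on U1 (\<lambda>x. chart_map c0 (ginv (chart_inv c0 x)))"
    using lie c0(1) unfolding lie_group_def U1_def U0_def by blast
  then have "smooth_on U1 (\<lambda>x. frechet_derivative
      (\<lambda>y. (\<lambda>(x, y). chart_map c0 (gmul (chart_inv c0 x) (chart_inv c0 y)))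
         (chart_map c0 (ginv (chart_inv c0 x)), y)) (at x) v)"
    by (intro smooth_on_partial_derivative[OF smooth_mult[OF c0(1) c0(1) c0(1)] open_mult_dom[OF c0(1) c0(1) c0(1)]] U1(1)
       smooth_on_ident)
      (use c0 in \<open>auto simp: U1_def U0_def chart_inv_map\<close>)
  then show ?thesis
    by (rule smooth_on_cong[OF U1(1), rotated]) (use c0 in \<open>auto simp: U1_def U0_def \<theta>_def dmap_def chart_inv_map\<close>)
qed

section \<open>Left-invariant vector fields\<close>

definition left_field :: "real ^ 'n \<Rightarrow> 'g \<Rightarrow> real ^ 'n"
  where "left_field v p = pushforward A (gmul p) gunit v"

lemma local_left_field:
  assumes "c \<in> A" "x \<in> chart_map c ` chart_dom c"
  shows "local_field A c (left_field v) x = dmap (gmul (chart_inv c x)) c0 c gunit v"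
proof -
  let ?p = "chart_inv c x"
  have "dmap (\<lambda>q. gmul ?p q) c0 c gunit v =
      dmap (\<lambda>q. q) (chart_at A ?p) c (gmul ?p gunit) (dmap (gmul ?p) c0 (chart_at A ?p) gunit v)"
    by (rule dmap_chain) (use assms chart_at c0 smooth_map_gmul smooth_map_ident chart_inv_in_dom in auto)
  then show ?thesis
    by (simp add: local_field_def tangent_to_chart_def chart_change_dmap left_field_def pushforward_dmap c0_def)
qed

lemma local_left_field_c0: "x \<in> U0 \<Longrightarrow> local_field A c0 (left_field v) x = M x v"
  using local_left_field[OF c0(1)] by (simp add: U0_def M_def)

lemma left_field_gunit [simp]: "left_field v gunit = v"
  using c0 by (simp add: left_field_def pushforward_dmap c0_def[symmetric])

lemma left_field_in_lie_algebra: "left_field v \<in> lie_algebra A gmul"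
  unfolding lie_algebra_def smooth_vector_field_def mem_Collect_eq
proof (intro conjI ballI allI)
  fix c assume c: "c \<in> A"
  show "smooth_on (chart_map c ` chart_dom c) (local_field A c (left_field v))"
    by (rule smooth_on_cong[OF open_chart_image[OF c] _ smooth_dmap_gmul[OF c, of v]])
      (use local_left_field[OF c] in auto)
next
  fix a p show "left_field v (gmul a p) = pushforward A (gmul a) p (left_field v p)"
    using pushforward_gmul_gmul[of a p gunit v] by (simp add: left_field_def)
qed

lemma lie_algebra_left_field:
  assumes "X \<in> lie_algebra A gmul"
  shows "X = left_field (X gunit)"
proof
  fix p
  have "X (gmul p gunit) = pushforward A (gmul p) gunit (X gunit)"
    using assms unfolding lie_algebra_def by blast
  then show "X p = left_field (X gunit) p" by (simp add: left_field_def)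
qed

lemma lie_bracket_gunit:
  assumes "X \<in> lie_algebra A gmul" "Y \<in> lie_algebra A gmul"
  shows "lie_bracket A X Y gunit = bracket (X gunit) (Y gunit)"
proof -
  have fd: "frechet_derivative (local_field A c0 (left_field v)) (at x0) = frechet_derivative (\<lambda>x. M x v) (at x0)" for v
    by (rule frechet_derivative_cong_open[OF U0]) (rule local_left_field_c0)
  show ?thesis
    by (subst lie_algebra_left_field[OF assms(1)], subst lie_algebra_left_field[OF assms(2)])
      (simp add: lie_bracket_def Let_def c0_def[symmetric] x0_def[symmetric] fd local_left_field_c0 U0 bracket_def)
qed

section \<open>The Maurer-Cartan equation and the Jacobi identity\<close>

abbreviation DM :: "real ^ 'n \<Rightarrow> real ^ 'n \<Rightarrow> real ^ 'n \<Rightarrow> real ^ 'n"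
  where "DM w x \<equiv> frechet_derivative (\<lambda>x. M x w) (at x)"

lemma has_derivative_M: "x \<in> U0 \<Longrightarrow> ((\<lambda>x. M x w) has_derivative DM w x) (at x)"
  by (rule smooth_on_has_derivative[OF smooth_M])

lemma has_derivative_mult0:
  assumes "x \<in> U0" "y \<in> U0" "gmul (chart_inv c0 x) (chart_inv c0 y) \<in> chart_dom c0"
  shows "(mult0 x has_derivative dmap (gmul (chart_inv c0 x)) c0 c0 (chart_inv c0 y)) (at y)"
  using has_derivative_dmap[OF smooth_map_gmul c0(1) c0(1), of "chart_inv c0 y" "chart_inv c0 x"] assms U0_inv
  by (simp add: mult0_def[abs_def])

lemma M_mult0:
  assumes "x \<in> U0" "y \<in> U0" "gmul (chart_inv c0 x) (chart_inv c0 y) \<in> chart_dom c0"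
  shows "M (mult0 x y) w = dmap (gmul (chart_inv c0 x)) c0 c0 (chart_inv c0 y) (M y w)"
  using dmap_chain[OF smooth_map_gmul c0(1) c0(1) c0(2) _ smooth_map_gmul c0(1),
      of "chart_inv c0 y" "chart_inv c0 x" w] assms U0_inv
  by (simp add: M_def mult0_def chart_inv_map[OF c0(1)] grp.assoc[abs_def])

text \<open>Associativity gives \<open>M (x y) w = D\<^sub>2 mult0 (x, y) (M y w)\<close>; differentiating in \<open>y\<close> at the
  identity, the second derivatives of \<open>mult0\<close> cancel by symmetry.\<close>

lemma maurer_cartan:
  assumes x: "x \<in> U0"
  shows "DM w x (M x v) - DM v x (M x w)
    = M x (bracket v w)"
proof -
  let ?p = "chart_inv c0 x"
  define f where "f z = mult0 (fst z) (snd z)" for z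
  define W where "W = {y \<in> U0. gmul ?p (chart_inv c0 y) \<in> chart_dom c0}"
  define H where "H w = frechet_derivative (\<lambda>z. frechet_derivative f (at z) (0, w)) (at (x, x0))" for w
  have W: "open W" "x0 \<in> W" "W \<subseteq> U0"
  proof -
    show "open W" unfolding W_def U0_def
      by (rule open_chart_vimage[OF c0(1) _ open_chart_dom[OF c0(1)]]) (intro continuous_intros)
    show "x0 \<in> W" "W \<subseteq> U0" using U0 x U0_inv(1) by (auto simp: W_def)
  qed
  have f: "smooth_on (mult_dom c0 c0 c0) f"
    using smooth_mult0 by (simp add: f_def[abs_def])
  have xy: "(x, y) \<in> mult_dom c0 c0 c0" if "y \<in> W" for y
    using that x by (auto simp: W_def U0_def)
  define G where "G y = dmap (gmul ?p) c0 c0 (chart_inv c0 y)" for y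
  have G: "G y w = frechet_derivative f (at (x, y)) (0, w)" if "y \<in> W" for y w
  proof -
    have 1: "(mult0 x has_derivative G y) (at y)"
      unfolding G_def by (rule has_derivative_mult0) (use that x in \<open>auto simp: W_def\<close>)
    have "((\<lambda>y. f (x, y)) has_derivative (\<lambda>v. frechet_derivative f (at (x, y)) (0, v))) (at y)"
      by (rule has_derivative_partial_snd[OF smooth_on_has_derivative[OF f xy[OF that]]])
    then show ?thesis using has_derivative_unique[OF 1] by (simp add: f_def)
  qed
  have G': "((\<lambda>y. G y w) has_derivative (\<lambda>v. H w (0, v))) (at x0)" for w
  proof -
    have "((\<lambda>y. frechet_derivative f (at (x, y)) (0, w)) has_derivative (\<lambda>v. H w (0, v))) (at x0)"
      unfolding H_def
      by (rule has_derivative_partial_snd[OF smooth_on_has_derivative[OF smooth_on_frechet_derivative[OF f] xy[OF W(2)]]])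
    then show ?thesis
      by (rule has_derivative_transform_within_open[OF _ W(1,2)]) (simp add: G)
  qed
  have G_x0: "G x0 = M x" by (simp add: G_def M_def)
  have mx0: "mult0 x x0 = x" using x U0_inv by (simp add: mult0_def)
  have main: "DM w x (M x v) =
      M x (DM w x0 v) + H w (0, v)" for v w
  proof -
    have "(mult0 x has_derivative M x) (at x0)"
      using has_derivative_mult0[OF x U0(2)] U0_inv(1)[OF x] by (simp add: M_def)
    then have 1: "((\<lambda>y. M (mult0 x y) w) has_derivative (\<lambda>v. DM w x (M x v))) (at x0)"
      by (rule has_derivative_compose[where g="\<lambda>x. M x w"]) (use has_derivative_M[OF x] mx0 in simp)
    have "((\<lambda>y. G y (M y w)) has_derivative
        (\<lambda>v. G x0 (DM w x0 v) + H (M x0 w) (0, v))) (at x0)"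
    proof (rule has_derivative_linear_apply[OF W(1,2)])
      show "linear (G y)" if "y \<in> W" for y
        unfolding G_def by (rule linear_dmap[OF smooth_map_gmul c0(1) c0(1)])
          (use that U0_inv in \<open>auto simp: W_def\<close>)
      show "((\<lambda>y. G y w) has_derivative (\<lambda>v. H w (0, v))) (at x0)" for w by (rule G')
      show "((\<lambda>y. M y w) has_derivative DM w x0) (at x0)"
        by (rule has_derivative_M[OF U0(2)])
    qed
    then have "((\<lambda>y. M (mult0 x y) w) has_derivative
        (\<lambda>v. M x (DM w x0 v) + H w (0, v))) (at x0)"
      unfolding G_x0 M_x0
      by (rule has_derivative_transform_within_open[OF _ W(1,2)])
        (use M_mult0[OF x] in \<open>auto simp: W_def G_def\<close>)
    from fun_cong[OF has_derivative_unique[OF 1 this], of v] show ?thesis .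
  qed
  have "H w (0, v) = H v (0, w)"
    unfolding H_def
    by (rule symmetric_second_derivative[OF open_mult_dom[OF c0(1) c0(1) c0(1)] smooth_onD[OF f] xy[OF W(2)]])
  then show ?thesis
    unfolding main bracket_def by (simp add: linear_diff[OF linear_M[OF x]])
qed

lemma linear_derivative_M: "linear (\<lambda>w. DM w x0 v)"
proof (rule linearI)
  have *: "DM (a *\<^sub>R w + w') x0 =
      (\<lambda>v. a *\<^sub>R DM w x0 v + DM w' x0 v)" for a w w'
  proof (rule frechet_derivative_eqI)
    have "((\<lambda>x. a *\<^sub>R M x w + M x w') has_derivative
      (\<lambda>v. a *\<^sub>R DM w x0 v + DM w' x0 v)) (at x0)"
      by (intro has_derivative_add has_derivative_scaleR_right has_derivative_M U0)
    then show "((\<lambda>x. M x (a *\<^sub>R w + w')) has_derivative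
      (\<lambda>v. a *\<^sub>R DM w x0 v + DM w' x0 v)) (at x0)"
      by (rule has_derivative_transform_within_open[OF _ U0])
        (simp add: linear_add[OF linear_M] linear_cmul[OF linear_M])
  qed
  show "DM (w + w') x0 v =
      DM w x0 v + DM w' x0 v" for w w'
    using *[of 1 w w'] by simp
  have "frechet_derivative (\<lambda>x. M x 0) (at x0) v = 0"
    using fun_cong[OF *[of 1 0 0], of v] by simp
  then show "DM (a *\<^sub>R w) x0 v = a *\<^sub>R DM w x0 v" for a w
    using *[of a w 0] by simp
qed

lemma linear_derivative_M': "linear (DM w x0)"
  using has_derivative_linear[OF has_derivative_M[OF U0(2)]] .

lemma bilinear_bracket: "bounded_bilinear bracket"
proof -
  have "bilinear bracket"
    unfolding bilinear_def bracket_def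
    by (intro conjI allI linear_compose_sub linear_derivative_M linear_derivative_M')
  then show ?thesis by (simp add: bilinear_conv_bounded_bilinear)
qed

lemma bracket_antisym: "bracket w v = - bracket v w"
  by (simp add: bracket_def)

text \<open>Obtained by differentiating the Maurer--Cartan equation at the identity.\<close>

lemma bracket_jacobi: "bracket (bracket u v) w + bracket (bracket v w) u + bracket (bracket w u) v = 0"
proof -
  define q where "q u w = DM w x0 u" for u w
  define T where "T w a u = frechet_derivative (\<lambda>x. DM w x a) (at x0) u" for w a u
  have sym: "T w a u = T w u a" for w a u
    unfolding T_def by (rule symmetric_second_derivative[OF U0(1) smooth_onD[OF smooth_M] U0(2)])
  have q: "q (u - u') w = q u w - q u' w" for u u' w
    unfolding q_def by (rule linear_diff[OF linear_derivative_M'])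
  have d: "((\<lambda>x. DM w x (M x v)) has_derivative
      (\<lambda>u. q (q u v) w + T w v u)) (at x0)" for v w
  proof -
    have "((\<lambda>x. DM w x (M x v)) has_derivative
      (\<lambda>u. DM w x0 (q u v) + T w (M x0 v) u)) (at x0)"
    proof (rule has_derivative_linear_apply[OF U0])
      show "linear (DM w y)" if "y \<in> U0" for y
        using has_derivative_linear[OF has_derivative_M[OF that]] .
      show "((\<lambda>y. DM w y a) has_derivative T w a) (at x0)" for a
        unfolding T_def[abs_def]
        by (rule smooth_on_has_derivative[OF smooth_on_frechet_derivative[OF smooth_M] U0(2)])
      show "((\<lambda>x. M x v) has_derivative (\<lambda>u. q u v)) (at x0)"
        unfolding q_def by (rule has_derivative_M[OF U0(2)])
    qed
    then show ?thesis by (simp add: q_def)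
  qed
  have eq: "q (q u v) w + T w v u - (q (q u w) v + T v w u) = q u (bracket v w)" for u v w
  proof -
    have 1: "((\<lambda>x. M x (bracket v w)) has_derivative
      (\<lambda>u. q (q u v) w + T w v u - (q (q u w) v + T v w u))) (at x0)"
      by (rule has_derivative_transform_within_open[OF has_derivative_diff[OF d d] U0]) (rule maurer_cartan)
    have 2: "((\<lambda>x. M x (bracket v w)) has_derivative (\<lambda>u. q u (bracket v w))) (at x0)"
      unfolding q_def by (rule has_derivative_M[OF U0(2)])
    show ?thesis using fun_cong[OF has_derivative_unique[OF 1 2], of u] .
  qed
  have b: "bracket v w = q v w - q w v" for v w by (simp add: bracket_def q_def)
  have bb: "bracket (bracket u v) w = q (q u v) w - q (q v u) w - q w (bracket u v)" for u v w
    using b[of "bracket u v" w] b[of u v] q by simp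
  \<comment> \<open>In the cyclic sum the second derivatives \<open>T\<close> cancel in pairs by
    symmetry, and the terms \<open>q (q _ _) _\<close> cancel against those of the double
    brackets.\<close>
  show ?thesis
    unfolding bb eq[of u v w, symmetric] eq[of v w u, symmetric] eq[of w u v, symmetric]
      sym[of w v u] sym[of u w v] sym[of v u w]
    by simp
qed

end

section \<open>Canonical local coordinates\<close>

lemma Ck_on_linear_apply:
  fixes G :: "'a::real_normed_vector \<Rightarrow> 'b::euclidean_space \<Rightarrow> 'c::real_normed_vector"
  assumes "open S" and lin: "\<And>y. y \<in> S \<Longrightarrow> linear (G y)"
    and "\<And>w. Ck_on k (\<lambda>y. G y w) S" "Ck_on k h S"
  shows "Ck_on k (\<lambda>y. G y (h y)) S"
proof -
  have "Ck_on k (\<lambda>y. \<Sum>i\<in>Basis. (h y \<bullet> i) *\<^sub>R G y i) S"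
    by (intro Ck_on_sum assms(1) Ck_on_bilinear[OF bounded_bilinear_scaleR]
      Ck_on_bounded_linear_compose[OF bounded_linear_inner_left assms(1,4)] assms(3))
  moreover have "(\<Sum>i\<in>Basis. (h y \<bullet> i) *\<^sub>R G y i) = G y (h y)" if "y \<in> S" for y
    by (rule linear_basis_expansion[OF lin[OF that], symmetric])
  ultimately show ?thesis
    by (rule Ck_on_cong[OF assms(1), rotated])
qed

definition form_blinfun :: "'a set \<Rightarrow> ('a::euclidean_space \<Rightarrow> 'a \<Rightarrow> 'b::real_normed_vector) \<Rightarrow> 'a \<Rightarrow> 'a \<Rightarrow>\<^sub>L 'b"
  where "form_blinfun S w x = Blinfun (if x \<in> S then w x else (\<lambda>v. 0))"

lemma form_blinfun_apply:
  fixes w :: "'a::euclidean_space \<Rightarrow> 'a \<Rightarrow> 'b::real_normed_vector"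
  shows "x \<in> S \<Longrightarrow> linear (w x) \<Longrightarrow> blinfun_apply (form_blinfun S w x) = w x"
  by (simp add: form_blinfun_def bounded_linear_Blinfun_apply linear_conv_bounded_linear)

lemma Ck_on_form_blinfun:
  fixes w :: "'a::euclidean_space \<Rightarrow> 'a \<Rightarrow> 'b::real_normed_vector"
  assumes "open S" "\<And>x. x \<in> S \<Longrightarrow> linear (w x)" "\<And>v. Ck_on k (\<lambda>x. w x v) S"
  shows "Ck_on k (form_blinfun S w) S"
proof (rule Ck_on_blinfun[OF assms(1)])
  show "Ck_on k (\<lambda>x. form_blinfun S w x v) S" for v
    by (rule Ck_on_cong[OF assms(1) _ assms(3)[of v]]) (simp add: form_blinfun_apply assms(2))
qed

text \<open>Smoothness of each \<open>w x v\<close> is upgraded to the operator-valued form that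
  \<open>poincare_lemma\<close> integrates; the primitive is smooth because its derivative
  is.\<close>

lemma poincare_lemma_smooth:
  fixes w :: "'a::euclidean_space \<Rightarrow> 'a \<Rightarrow> 'b::euclidean_space"
  assumes lin: "\<And>x. x \<in> ball x0 r \<Longrightarrow> linear (w x)"
    and sm: "\<And>v. smooth_on (ball x0 r) (\<lambda>x. w x v)"
    and closed: "\<And>x v u. x \<in> ball x0 r \<Longrightarrow>
      frechet_derivative (\<lambda>x. w x v) (at x) u = frechet_derivative (\<lambda>x. w x u) (at x) v"
  obtains F where "F x0 = 0" "\<And>x. x \<in> ball x0 r \<Longrightarrow> (F has_derivative w x) (at x)"
    "smooth_on (ball x0 r) F"
proof -
  let ?B = "ball x0 r"
  define \<eta> where "\<eta> = form_blinfun ?B w"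
  have \<eta>: "blinfun_apply (\<eta> x) = w x" if "x \<in> ?B" for x
    using that lin by (simp add: \<eta>_def form_blinfun_apply del: mem_ball)
  have Ck: "Ck_on k \<eta> ?B" for k
    unfolding \<eta>_def using lin sm by (intro Ck_on_form_blinfun) (auto simp: smooth_onD)
  define \<eta>' where "\<eta>' x = Blinfun (frechet_derivative \<eta> (at x))" for x
  have d: "(\<eta> has_derivative frechet_derivative \<eta> (at x)) (at x)" if "x \<in> ?B" for x
    by (rule Ck_on_SucD[OF Ck that])
  have \<eta>': "blinfun_apply (\<eta>' x) = frechet_derivative \<eta> (at x)" if "x \<in> ?B" for x
    unfolding \<eta>'_def by (rule bounded_linear_Blinfun_apply[OF has_derivative_bounded_linear[OF d[OF that]]])
  have d': "frechet_derivative (\<lambda>x. w x v) (at x) u = \<eta>' x u v" if x: "x \<in> ?B" for x u v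
  proof -
    have "((\<lambda>x. \<eta> x v) has_derivative (\<lambda>u. \<eta>' x u v)) (at x)"
      unfolding \<eta>'[OF x]
      by (rule bounded_linear.has_derivative[OF bounded_bilinear.bounded_linear_left[OF bounded_bilinear_blinfun_apply] d[OF x]])
    then have "((\<lambda>x. w x v) has_derivative (\<lambda>u. \<eta>' x u v)) (at x)"
      by (rule has_derivative_transform_within_open[OF _ open_ball x]) (simp add: \<eta> del: mem_ball)
    from frechet_derivative_eqI[OF this] show ?thesis by simp
  qed
  obtain F where F: "F x0 = 0" "\<And>x. x \<in> ?B \<Longrightarrow> (F has_derivative \<eta> x) (at x)"
  proof (rule poincare_lemma[of x0 r \<eta> \<eta>'])
    show "(\<eta> has_derivative \<eta>' x) (at x)" if "x \<in> ?B" for x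
      using d[OF that] \<eta>'[OF that] by simp
    have "Ck_on 0 \<eta>' ?B"
    proof (rule Ck_on_blinfun[OF open_ball])
      show "Ck_on 0 (\<lambda>x. \<eta>' x v) ?B" for v
      proof (rule Ck_on_cong[OF open_ball])
        show "Ck_on 0 (\<lambda>x. frechet_derivative \<eta> (at x) v) ?B" using Ck[of 1] by simp
      qed (simp add: \<eta>' del: mem_ball)
    qed
    then show "continuous_on ?B \<eta>'" by simp
    show "\<eta>' x v u = \<eta>' x u v" if "x \<in> ?B" for x u v
      using closed[OF that, of v u] unfolding d'[OF that] by simp
  qed (rule that)
  have F': "(F has_derivative w x) (at x)" if "x \<in> ?B" for x
    using F(2)[OF that] \<eta>[OF that] by simp
  have "Ck_on k F ?B" for k
    by (rule Ck_on_decrease, rule Ck_on_SucI[OF open_ball F']) (use sm in \<open>auto simp: smooth_onD\<close>)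
  then show ?thesis using that F(1) F' by (simp add: smooth_on_def)
qed

lemma half_identity: "(a - c) + (1/2) *\<^sub>R (d + c) = a + (1/2) *\<^sub>R (d + - c)" for a :: "'a::euclidean_space"
proof (rule euclidean_eqI)
  fix i :: 'a
  show "((a - c) + (1/2) *\<^sub>R (d + c)) \<bullet> i = (a + (1/2) *\<^sub>R (d + - c)) \<bullet> i"
    by (simp add: inner_add_left inner_diff_left)
qed

text \<open>The group enters only through a frame \<open>M\<close> with constant structure
  coefficients \<open>b\<close> and its dual coframe \<open>\<theta>\<close>. The conditions on
  \<open>P\<close> say that brackets lie in its kernel and that its kernel is central.\<close>

locale canonical_coordinates = step_two_bracket b
  for b :: "'a::euclidean_space \<Rightarrow> 'a \<Rightarrow> 'a" +
  fixes U :: "'a set" and x0 :: 'a and M \<theta> :: "'a \<Rightarrow> 'a \<Rightarrow> 'a" and P :: "'a \<Rightarrow> 'a"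
  assumes U: "open U" "x0 \<in> U"
    and linear_M: "\<And>x. x \<in> U \<Longrightarrow> linear (M x)" and linear_\<theta>: "\<And>x. x \<in> U \<Longrightarrow> linear (\<theta> x)"
    and \<theta>_M: "\<And>x v. x \<in> U \<Longrightarrow> \<theta> x (M x v) = v" and M_\<theta>: "\<And>x v. x \<in> U \<Longrightarrow> M x (\<theta> x v) = v"
    and smooth_M: "\<And>v. smooth_on U (\<lambda>x. M x v)" and smooth_\<theta>: "\<And>v. smooth_on U (\<lambda>x. \<theta> x v)"
    and maurer_cartan: "\<And>x v w. x \<in> U \<Longrightarrow>
      frechet_derivative (\<lambda>x. M x w) (at x) (M x v) - frechet_derivative (\<lambda>x. M x v) (at x) (M x w)
        = M x (b v w)"
    and P: "bounded_linear P" "\<And>v w. P (b v w) = 0" "\<And>v w. b (P v) w = b v w"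
begin

abbreviation DM :: "'a \<Rightarrow> 'a \<Rightarrow> 'a \<Rightarrow> 'a"
  where "DM w x \<equiv> frechet_derivative (\<lambda>x. M x w) (at x)"

abbreviation D\<theta> :: "'a \<Rightarrow> 'a \<Rightarrow> 'a \<Rightarrow> 'a"
  where "D\<theta> w x \<equiv> frechet_derivative (\<lambda>x. \<theta> x w) (at x)"

lemma linear_P: "linear P"
  using P(1) by (rule bounded_linear.linear)

lemma has_derivative_\<theta>: "x \<in> U \<Longrightarrow> ((\<lambda>x. \<theta> x w) has_derivative D\<theta> w x) (at x)"
  by (rule smooth_on_has_derivative[OF smooth_\<theta>])

lemma has_derivative_M: "x \<in> U \<Longrightarrow> ((\<lambda>x. M x w) has_derivative DM w x) (at x)"
  by (rule smooth_on_has_derivative[OF smooth_M])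

text \<open>Differentiating \<open>\<theta> x (M x v) = v\<close> expresses the derivative of the
  coframe through that of the frame, whereby the frame equation passes to the coframe with the
  opposite sign.\<close>

lemma maurer_cartan_\<theta>:
  assumes x: "x \<in> U"
  shows "D\<theta> v x u - D\<theta> u x v = - b (\<theta> x u) (\<theta> x v)"
proof -
  have 1: "D\<theta> (M y v) y c = - \<theta> y (DM v y c)"
    if y: "y \<in> U" for v c y
  proof -
    have "((\<lambda>x. \<theta> x (M x v)) has_derivative (\<lambda>c. \<theta> y (DM v y c)
        + D\<theta> (M y v) y c)) (at y)"
      by (rule has_derivative_linear_apply[OF U(1) y linear_\<theta> has_derivative_\<theta>[OF y] has_derivative_M[OF y]])
    then have 1: "((\<lambda>x. v) has_derivative (\<lambda>c. \<theta> y (DM v y c)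
        + D\<theta> (M y v) y c)) (at y)"
      by (rule has_derivative_transform_within_open[OF _ U(1) y]) (rule \<theta>_M)
    show ?thesis
      by (rule minus_unique[symmetric]) (rule fun_cong[OF has_derivative_unique[OF 1 has_derivative_const], of c])
  qed
  have "D\<theta> (M x v) x (M x u) - D\<theta> (M x u) x (M x v)
      = - \<theta> x (M x (b u v))" for u v
    unfolding 1[OF x] maurer_cartan[OF x, symmetric] by (simp add: linear_diff[OF linear_\<theta>[OF x]])
  from this[of "\<theta> x v" "\<theta> x u"] show ?thesis
    by (simp add: M_\<theta>[OF x] \<theta>_M[OF x])
qed

text \<open>\<open>P\<close> is a projection along the second layer. Then \<open>P \<theta> = dX\<close> is closed, and so is
  \<open>\<theta> + b X \<theta> / 2\<close>, because \<open>d (b X \<theta>)\<close> contributes twice the term \<open>b \<theta> \<theta>\<close> with the sign opposite to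
  the Maurer--Cartan equation. Its primitive \<open>F\<close> has \<open>P F = X\<close>.\<close>

lemma exists_primitive:
  assumes r: "ball x0 r \<subseteq> U"
  obtains F where "F x0 = 0" "smooth_on (ball x0 r) F"
    "\<And>x. x \<in> ball x0 r \<Longrightarrow> (F has_derivative (\<lambda>v. \<theta> x v + (1/2) *\<^sub>R b (F x) (\<theta> x v))) (at x)"
proof -
  let ?B = "ball x0 r"
  have U': "x \<in> U" if "x \<in> ?B" for x using r that by blast
  have sm: "smooth_on ?B (\<lambda>x. \<theta> x v)" for v
    using smooth_on_subset[OF smooth_\<theta> r] .
  obtain X where X: "X x0 = 0" "\<And>x. x \<in> ?B \<Longrightarrow> (X has_derivative (\<lambda>v. P (\<theta> x v))) (at x)" "smooth_on ?B X"
  proof (rule poincare_lemma_smooth[of x0 r "\<lambda>x v. P (\<theta> x v)"])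
    show "linear (\<lambda>v. P (\<theta> x v))" if "x \<in> ?B" for x
      using linear_compose[OF linear_\<theta>[OF U'[OF that]] linear_P] by (simp add: o_def)
    show "smooth_on ?B (\<lambda>x. P (\<theta> x v))" for v
      using Ck_on_bounded_linear_compose[OF P(1) open_ball] sm unfolding smooth_on_def by blast
    fix x u v assume x: "x \<in> ?B"
    have "frechet_derivative (\<lambda>x. P (\<theta> x v)) (at x) u = P (D\<theta> v x u)" for u v
      using fun_cong[OF frechet_derivative_eqI[OF bounded_linear.has_derivative[OF P(1) has_derivative_\<theta>[OF U'[OF x]]]], of v u] .
    then have "frechet_derivative (\<lambda>x. P (\<theta> x v)) (at x) u - frechet_derivative (\<lambda>x. P (\<theta> x u)) (at x) v
        = P (- b (\<theta> x u) (\<theta> x v))"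
      by (simp add: linear_diff[OF linear_P, symmetric] maurer_cartan_\<theta>[OF U'[OF x]])
    then show "frechet_derivative (\<lambda>x. P (\<theta> x v)) (at x) u = frechet_derivative (\<lambda>x. P (\<theta> x u)) (at x) v"
      by (simp add: linear_neg[OF linear_P] P(2))
  qed (rule that)
  let ?w = "\<lambda>x v. \<theta> x v + (1/2) *\<^sub>R b (X x) (\<theta> x v)"
  obtain F where F: "F x0 = 0" "\<And>x. x \<in> ?B \<Longrightarrow> (F has_derivative ?w x) (at x)" "smooth_on ?B F"
  proof (rule poincare_lemma_smooth[of x0 r ?w])
    show "linear (?w x)" if "x \<in> ?B" for x
    proof (rule linearI)
      show "?w x (v + v') = ?w x v + ?w x v'" for v v'
        by (simp add: linear_add[OF linear_\<theta>[OF U'[OF that]]] add_right scaleR_add_right)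
      show "?w x (a *\<^sub>R v) = a *\<^sub>R ?w x v" for a v
        by (simp add: linear_cmul[OF linear_\<theta>[OF U'[OF that]]] scaleR_right scaleR_add_right)
    qed
    show "smooth_on ?B (\<lambda>x. ?w x v)" for v
      unfolding smooth_on_def
      by (intro allI Ck_on_add Ck_on_bounded_linear_compose[OF bounded_linear_scaleR_right] Ck_on_bilinear[OF bilinear]
          smooth_onD sm X open_ball)
    fix x u v assume x: "x \<in> ?B"
    let ?D = "\<lambda>v u. D\<theta> v x u"
    have D: "frechet_derivative (\<lambda>x. ?w x v) (at x) u =
        ?D v u + (1/2) *\<^sub>R (b (X x) (?D v u) + b (\<theta> x u) (\<theta> x v))" for u v
    proof -
      have "((\<lambda>x. ?w x v) has_derivative (\<lambda>u. ?D v u + (1/2) *\<^sub>R (b (X x) (?D v u) + b (P (\<theta> x u)) (\<theta> x v)))) (at x)"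
        by (intro has_derivative_add has_derivative_scaleR_right FDERIV X(2)[OF x] has_derivative_\<theta>[OF U'[OF x]])
      from frechet_derivative_eqI[OF this] show ?thesis by (simp add: P(3))
    qed
    have d: "?D v u = ?D u v - b (\<theta> x u) (\<theta> x v)"
      using maurer_cartan_\<theta>[OF U'[OF x], of v u] by (simp add: algebra_simps)
    show "frechet_derivative (\<lambda>x. ?w x v) (at x) u = frechet_derivative (\<lambda>x. ?w x u) (at x) v"
    proof -
      define \<beta> where "\<beta> = b (\<theta> x u) (\<theta> x v)"
      have swap: "b (\<theta> x v) (\<theta> x u) = - \<beta>" and X\<beta>: "b (X x) \<beta> = 0"
        using antisym[of "\<theta> x v" "\<theta> x u"] by (simp_all add: \<beta>_def)
      have "?D v u + (1/2) *\<^sub>R (b (X x) (?D v u) + \<beta>) = (?D u v - \<beta>) + (1/2) *\<^sub>R (b (X x) (?D u v) + \<beta>)"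
        unfolding d \<beta>_def[symmetric] diff_right X\<beta> by simp
      also have "\<dots> = ?D u v + (1/2) *\<^sub>R (b (X x) (?D u v) + - \<beta>)"
        by (rule half_identity)
      finally show ?thesis unfolding D swap \<beta>_def[symmetric] .
    qed
  qed (rule that)
  have PF: "P (F x) = X x" if x: "x \<in> ?B" for x
  proof -
    have "P (F x) - X x = P (F x0) - X x0"
    proof (rule has_derivative_zero_unique[OF convex_ball _ x])
      fix y assume y: "y \<in> ?B"
      have "((\<lambda>x. P (F x) - X x) has_derivative (\<lambda>v. P (?w y v) - P (\<theta> y v))) (at y)"
        by (intro has_derivative_diff bounded_linear.has_derivative[OF P(1)] F(2) X(2) y)
      moreover have "(\<lambda>v. P (?w y v) - P (\<theta> y v)) = (\<lambda>v. 0)"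
        by (simp add: linear_add[OF linear_P] linear_cmul[OF linear_P] P(2))
      ultimately show "((\<lambda>x. P (F x) - X x) has_derivative (\<lambda>v. 0)) (at y within ?B)"
        by (simp add: has_derivative_at_withinI)
    qed (use x in \<open>auto intro: le_less_trans[OF zero_le_dist]\<close>)
    then show ?thesis by (simp add: F(1) X(1) linear_0[OF linear_P])
  qed
  \<comment> \<open>\<open>b\<close> sees only the \<open>P\<close>-part of its argument, so the
    auxiliary \<open>X\<close> can be replaced by \<open>F\<close> and the equation for
    \<open>F\<close> becomes self-contained.\<close>
  have "b (X x) v = b (F x) v" if "x \<in> ?B" for x v
    using PF[OF that] P(3)[of "F x" v] by simp
  then show ?thesis
    using that[OF F(1,3)] F(2) by (simp del: mem_ball)
qed

text \<open>Both sides satisfy the same differential equation as \<open>F\<close>. Their difference \<open>K\<close> therefore has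
  \<open>dK = b K \<theta> / 2\<close>, which first forces \<open>P K = 0\<close> and then \<open>dK = 0\<close>.\<close>

lemma primitive_left_translation:
  assumes F: "\<And>x. x \<in> ball x0 r \<Longrightarrow> (F has_derivative (\<lambda>v. \<theta> x v + (1/2) *\<^sub>R b (F x) (\<theta> x v))) (at x)"
    and F0: "F x0 = 0" and r: "ball x0 r \<subseteq> U" and s: "0 < s" "s \<le> r"
    and f: "\<And>y. y \<in> ball x0 s \<Longrightarrow> f y \<in> ball x0 r"
    and f': "\<And>y. y \<in> ball x0 s \<Longrightarrow> (f has_derivative f' y) (at y)"
      "\<And>y v. y \<in> ball x0 s \<Longrightarrow> f' y (M y v) = M (f y) v"
    and y: "y \<in> ball x0 s"
  shows "F (f y) = hmul (F (f x0)) (F y)"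
proof -
  let ?B = "ball x0 s"
  define c where "c = F (f x0)"
  define K where "K y = F (f y) - hmul c (F y)" for y
  have sr: "z \<in> ball x0 r" "z \<in> U" if "z \<in> ?B" for z using that s r by auto
  have K': "(K has_derivative (\<lambda>u. (1/2) *\<^sub>R b (K z) (\<theta> z u))) (at z)" if z: "z \<in> ?B" for z
  proof -
    let ?d = "\<lambda>u. \<theta> z u + (1/2) *\<^sub>R b (F z) (\<theta> z u)"
    have Ff: "((\<lambda>y. F (f y)) has_derivative
        (\<lambda>u. \<theta> (f z) (f' z u) + (1/2) *\<^sub>R b (F (f z)) (\<theta> (f z) (f' z u)))) (at z)"
      by (rule has_derivative_compose[OF f'(1)[OF z] F[OF f[OF z]]])
    have 1: "(K has_derivative
        (\<lambda>u. (\<theta> (f z) (f' z u) + (1/2) *\<^sub>R b (F (f z)) (\<theta> (f z) (f' z u)))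
          - (0 + ?d u + (1/2) *\<^sub>R (b c (?d u) + b 0 (F z))))) (at z)"
      unfolding K_def[abs_def] hmul_def
      by (intro has_derivative_diff Ff has_derivative_add has_derivative_scaleR_right FDERIV
          has_derivative_const F sr(1)[OF z])
    \<comment> \<open>\<open>f\<close> preserves the frame and so pulls \<open>\<theta>\<close> back
      to itself; this is why only the term with \<open>b (K z)\<close> survives in the derivative of
      \<open>K\<close>.\<close>
    have "f' z u = M (f z) (\<theta> z u)" for u
      using f'(2)[OF z, of "\<theta> z u"] M_\<theta>[OF sr(2)[OF z]] by simp
    then have "\<theta> (f z) (f' z u) = \<theta> z u" for u
      using f[OF z] r by (simp add: \<theta>_M subset_iff)
    then have "(\<lambda>u. (\<theta> (f z) (f' z u) + (1/2) *\<^sub>R b (F (f z)) (\<theta> (f z) (f' z u)))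
          - (0 + ?d u + (1/2) *\<^sub>R (b c (?d u) + b 0 (F z)))) = (\<lambda>u. (1/2) *\<^sub>R b (K z) (\<theta> z u))"
      by (simp add: fun_eq_iff K_def hmul_def add_left diff_left add_right scaleR_left scaleR_right zero_left
          algebra_simps)
    with 1 show ?thesis by simp
  qed
  have x0: "x0 \<in> ?B" using s by simp
  have K0: "K x0 = 0" by (simp add: K_def c_def F0)
  have PK: "P (K z) = 0" if z: "z \<in> ?B" for z
  proof -
    have "P (K z) = P (K x0)"
    proof (rule has_derivative_zero_unique[OF convex_ball _ z x0])
      fix y assume "y \<in> ?B"
      from bounded_linear.has_derivative[OF P(1) K'[OF this]]
      show "((\<lambda>x. P (K x)) has_derivative (\<lambda>v. 0)) (at y within ?B)"
        by (simp add: has_derivative_at_withinI linear_cmul[OF linear_P] P(2))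
    qed
    then show ?thesis by (simp add: K0 linear_0[OF linear_P])
  qed
  have "K y = K x0"
  proof (rule has_derivative_zero_unique[OF convex_ball _ y x0])
    fix z assume z: "z \<in> ?B"
    have "b (K z) v = 0" for v
      using P(3)[of "K z" v] PK[OF z] by (simp add: zero_left)
    with K'[OF z] show "(K has_derivative (\<lambda>v. 0)) (at z within ?B)"
      by (simp add: has_derivative_at_withinI)
  qed
  then have "K y = 0" by (simp only: K0)
  then show ?thesis by (simp add: K_def c_def)
qed

text \<open>The derivative of \<open>F\<close> at \<open>x0\<close> is \<open>\<theta> x0\<close>,
  with inverse \<open>M x0\<close>, so the inverse function theorem applies. The local inverse
  \<open>s\<close> is the exponential map read in the chart.\<close>

lemma primitive_inverse:
  assumes F: "\<And>x. x \<in> ball x0 r \<Longrightarrow> (F has_derivative (\<lambda>v. \<theta> x v + (1/2) *\<^sub>R b (F x) (\<theta> x v))) (at x)"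
    and F0: "F x0 = 0" and r: "r > 0" "ball x0 r \<subseteq> U" and smF: "smooth_on (ball x0 r) F"
  obtains V W s where "open V" "x0 \<in> V" "V \<subseteq> ball x0 r" "open W" "0 \<in> W" "homeomorphism V W F s"
    "smooth_on W s" "(s has_derivative M x0) (at 0)"
proof -
  let ?B = "ball x0 r"
  let ?w = "\<lambda>x v. \<theta> x v + (1/2) *\<^sub>R b (F x) (\<theta> x v)"
  define \<eta> where "\<eta> = form_blinfun ?B ?w"
  have lin: "linear (?w x)" if "x \<in> ?B" for x
    by (rule has_derivative_linear[OF F[OF that]])
  have \<eta>: "blinfun_apply (\<eta> x) = ?w x" if "x \<in> ?B" for x
    using that lin by (simp add: \<eta>_def form_blinfun_apply del: mem_ball)
  have "Ck_on 0 \<eta> ?B"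
    unfolding \<eta>_def
    by (intro Ck_on_form_blinfun open_ball lin Ck_on_add Ck_on_bounded_linear_compose[OF bounded_linear_scaleR_right]
      Ck_on_bilinear[OF bilinear] smooth_onD[OF smF] smooth_onD[OF smooth_on_subset[OF smooth_\<theta> r(2)]])
  then have cont: "continuous_on ?B \<eta>" by simp
  have x0: "x0 \<in> ?B" using r by simp
  have "Blinfun (M x0) o\<^sub>L \<eta> x0 = id_blinfun"
    by (rule blinfun_eqI)
      (use linear_M[OF U(2)] in \<open>simp add: \<eta>[OF x0] F0 zero_left M_\<theta>[OF U(2)] bounded_linear_Blinfun_apply linear_conv_bounded_linear\<close>)
  note inv0 = this
  have FB: "(F has_derivative blinfun_apply (\<eta> x)) (at x)" if "x \<in> ?B" for x
    using F[OF that] \<eta>[OF that] by simp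
  obtain V W s s' where V: "open V" "V \<subseteq> ?B" "x0 \<in> V" and W: "open W" "F x0 \<in> W" and hom: "homeomorphism V W F s"
    and s': "\<And>y. y \<in> W \<Longrightarrow> (s has_derivative s' y) (at y)"
      "\<And>y. y \<in> W \<Longrightarrow> s' y = inv (blinfun_apply (\<eta> (s y)))"
      "\<And>y. y \<in> W \<Longrightarrow> bij (blinfun_apply (\<eta> (s y)))"
    by (rule inverse_function_theorem[OF open_ball FB cont x0 inv0]) (assumption, rule that)
  have sV: "s y \<in> V" "F (s y) = y" if "y \<in> W" for y
    using hom that by (auto simp: homeomorphism_def)
  have sU: "s y \<in> U" if "y \<in> W" for y using sV(1)[OF that] V r by blast
  \<comment> \<open>By two-step nilpotency the map \<open>b y\<close> squares to zero, so the
    identity minus half of it inverts the identity plus half of it.\<close>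
  have s'_eq: "s' y u = M (s y) (u - (1/2) *\<^sub>R b y u)" if y: "y \<in> W" for y u
  proof -
    have "inv (blinfun_apply (\<eta> (s y))) = (\<lambda>u. M (s y) (u - (1/2) *\<^sub>R b y u))"
    proof (rule inv_equality)
      have w: "blinfun_apply (\<eta> (s y)) v = \<theta> (s y) v + (1/2) *\<^sub>R b y (\<theta> (s y) v)" for v
        using \<eta>[of "s y"] sV[OF y] V by auto
      show "M (s y) (\<eta> (s y) v - (1/2) *\<^sub>R b y (\<eta> (s y) v)) = v" for v
        unfolding w by (simp add: add_right scaleR_right M_\<theta>[OF sU[OF y]])
      show "\<eta> (s y) (M (s y) (u - (1/2) *\<^sub>R b y u)) = u" for u
        unfolding w by (simp add: diff_right scaleR_right \<theta>_M[OF sU[OF y]])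
    qed
    then show ?thesis using s'(2)[OF y] by simp
  qed
  have d: "(s has_derivative (\<lambda>u. M (s y) (u - (1/2) *\<^sub>R b y u))) (at y)" if "y \<in> W" for y
  proof -
    have "s' y = (\<lambda>u. M (s y) (u - (1/2) *\<^sub>R b y u))"
      by (rule ext) (rule s'_eq[OF that])
    then show ?thesis using s'(1)[OF that] by simp
  qed
  txt \<open>The formula \<open>d\<close> expresses the derivative of \<open>s\<close> through \<open>s\<close> itself.\<close>
  have "Ck_on k s W" for k
  proof (induction k)
    case 0
    show ?case using hom by (simp add: homeomorphism_def)
  next
    case (Suc k)
    show ?case
    proof (rule Ck_on_SucI[OF W(1) d])
      fix u
      show "Ck_on k (\<lambda>y. M (s y) (u - (1/2) *\<^sub>R b y u)) W"
      proof (rule Ck_on_linear_apply[where G="\<lambda>y. M (s y)", OF W(1)])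
        show "linear (M (s y))" if "y \<in> W" for y by (rule linear_M[OF sU[OF that]])
        show "Ck_on k (\<lambda>y. M (s y) v) W" for v
          by (rule Ck_on_compose[OF W(1) U(1) Suc smooth_onD[OF smooth_M]]) (use sU in auto)
        show "Ck_on k (\<lambda>y. u - (1/2) *\<^sub>R b y u) W"
          by (intro Ck_on_diff Ck_on_const Ck_on_bounded_linear_compose[OF bounded_linear_scaleR_right]
            Ck_on_bounded_linear bounded_linear_left W)
      qed
    qed
  qed
  then have "smooth_on W s" by (simp add: smooth_on_def)
  moreover have "s 0 = x0" using hom V(3) F0 by (metis homeomorphism_apply1)
  then have "(s has_derivative M x0) (at 0)"
    using d[of 0] W(2) by (simp add: F0 zero_left)
  ultimately show ?thesis
    using that[OF V(1,3,2) W(1) _ hom] W(2) by (simp add: F0)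
qed

end

section \<open>Global exponential coordinates\<close>

text \<open>\<open>T\<close> identifies the coordinate space with the tangent space at the identity,
  and \<open>b\<close> is the bracket read there. This leaves the coordinates free to be adapted to
  the layers and to the metric; \<open>P\<close> stands for the projection to a first layer.\<close>

locale adapted_frame = lie_group_charts A gmul gunit ginv + step_two_bracket b
  for A :: "('g::{t2_space,second_countable_topology}, 'n::finite) chart set"
    and gmul :: "'g \<Rightarrow> 'g \<Rightarrow> 'g" and gunit :: 'g and ginv :: "'g \<Rightarrow> 'g"
    and b :: "real ^ 'n \<Rightarrow> real ^ 'n \<Rightarrow> real ^ 'n" +
  fixes T P :: "real ^ 'n \<Rightarrow> real ^ 'n"
  assumes connected_G: "connected (UNIV :: 'g set)"
    and simply_connected_G: "simply_connected (UNIV :: 'g set)"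
    and linear_T: "linear T" and bij_T: "bij T"
    and T_bracket: "\<And>v w. T (b v w) = bracket (T v) (T w)"
    and P: "bounded_linear P" "\<And>v w. P (b v w) = 0" "\<And>v w. b (P v) w = b v w"
begin

lemma inv_T [simp]: "inv T (T v) = v" "T (inv T v) = v"
  using bij_T by (simp_all add: bij_is_inj bij_is_surj surj_f_inv_f)

lemma linear_inv_T: "linear (inv T)"
  using linear_T bij_T by (simp add: bij_is_inj inj_linear_imp_inv_linear)

lemma canonical: "canonical_coordinates b U1 x0 (\<lambda>x v. M x (T v)) (\<lambda>x v. inv T (\<theta> x v)) P"
proof (rule canonical_coordinates.intro[OF step_two_bracket_axioms], rule canonical_coordinates_axioms.intro)
  show "linear (\<lambda>v. M x (T v))" "linear (\<lambda>v. inv T (\<theta> x v))" if "x \<in> U1" for x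
    using that U1(3) linear_compose[OF linear_T linear_M] linear_compose[OF linear_\<theta> linear_inv_T]
    by (auto simp: o_def)
  show "smooth_on U1 (\<lambda>x. M x (T v))" for v
    using smooth_on_subset[OF smooth_M U1(3)] .
  show "smooth_on U1 (\<lambda>x. inv T (\<theta> x v))" for v
    using Ck_on_bounded_linear_compose[OF linear_inv_T[unfolded linear_conv_bounded_linear] U1(1)] smooth_\<theta>
    unfolding smooth_on_def by blast
  show "frechet_derivative (\<lambda>x. M x (T w)) (at x) (M x (T v)) - frechet_derivative (\<lambda>x. M x (T v)) (at x) (M x (T w))
        = M x (T (b v w))" if "x \<in> U1" for x v w
    using maurer_cartan[of x "T w" "T v"] that U1(3) by (auto simp: T_bracket)
qed (use U1 \<theta>_M M_\<theta> P in auto)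

text \<open>Besides the global isomorphism \<open>E\<close>, the local data \<open>s\<close>,
  \<open>F\<close> and \<open>V\<close> are handed on: they describe \<open>E\<close> and its
  inverse near the identity as smooth maps in the chart \<open>c0\<close>, which is what later puts
  the coordinates into the atlas.\<close>

lemma exponential_exists:
  obtains E :: "real ^ 'n \<Rightarrow> 'g" and s F :: "real ^ 'n \<Rightarrow> real ^ 'n" and V \<epsilon>
  where "bij E" "\<And>u v. E (hmul u v) = gmul (E u) (E v)" "E 0 = gunit"
    "continuous_on UNIV E" "\<And>W. open W \<Longrightarrow> open (E ` W)"
    "\<epsilon> > 0" "smooth_on (ball 0 \<epsilon>) s" "(s has_derivative T) (at 0)"
    "\<And>u. norm u < \<epsilon> \<Longrightarrow> s u \<in> V \<and> F (s u) = u \<and> E u = chart_inv c0 (s u)"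
    "open V" "V \<subseteq> U0" "smooth_on V F"
proof -
  interpret cc: canonical_coordinates b U1 x0 "\<lambda>x v. M x (T v)" "\<lambda>x v. inv T (\<theta> x v)" P
    by (rule canonical)
  obtain r where r: "r > 0" "ball x0 r \<subseteq> U1" using U1 openE by blast
  obtain F where F0: "F x0 = 0" and smF: "smooth_on (ball x0 r) F" and F: "\<And>x. x \<in> ball x0 r \<Longrightarrow>
      (F has_derivative (\<lambda>v. inv T (\<theta> x v) + (1/2) *\<^sub>R b (F x) (inv T (\<theta> x v)))) (at x)"
    by (rule cc.exists_primitive[OF r(2)]) (rule that)
  obtain V W s where V: "open V" "x0 \<in> V" "V \<subseteq> ball x0 r" and W: "open W" "0 \<in> W"
    and hom: "homeomorphism V W F s" and sms: "smooth_on W s" and s0: "(s has_derivative (\<lambda>v. M x0 (T v))) (at 0)"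
    by (rule cc.primitive_inverse[OF F F0 r smF]) (assumption, rule that)
  have sV: "s u \<in> V" "F (s u) = u" if "u \<in> W" for u
    using hom that by (auto simp: homeomorphism_def)
  have sF: "s (F x) = x" if "x \<in> V" for x
    using hom that by (auto simp: homeomorphism_def)
  have VU0: "V \<subseteq> U0" using V r U1 by blast
  \<comment> \<open>Products of points of this ball stay in \<open>V\<close>, where \<open>s\<close>
    inverts \<open>F\<close>; an identity between values of \<open>F\<close> can thus be pulled back
    to the chart.\<close>
  obtain \<rho> where \<rho>: "0 < \<rho>" "\<rho> \<le> r" and mult: "\<And>x y. x \<in> ball x0 \<rho> \<Longrightarrow> y \<in> ball x0 \<rho> \<Longrightarrow>
      x \<in> U0 \<and> y \<in> U0 \<and> gmul (chart_inv c0 x) (chart_inv c0 y) \<in> chart_dom c0 \<and> mult0 x y \<in> V"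
  proof -
    have "open (mult_dom c0 c0 c0 \<inter> (\<lambda>z. mult0 (fst z) (snd z)) -` V)"
      by (rule continuous_open_preimage[OF smooth_on_imp_continuous_on[OF smooth_mult0] open_mult_dom V(1)]) (rule c0)+
    moreover have "(x0, x0) \<in> mult_dom c0 c0 c0 \<inter> (\<lambda>z. mult0 (fst z) (snd z)) -` V"
      using U0(2) c0 V(2) by (auto simp: U0_def[symmetric] mult0_def x0_def[symmetric])
    ultimately obtain X Y where XY: "open X" "open Y" "x0 \<in> X" "x0 \<in> Y"
      "X \<times> Y \<subseteq> mult_dom c0 c0 c0 \<inter> (\<lambda>z. mult0 (fst z) (snd z)) -` V"
      by (rule open_prod_elim) (auto dest: that)
    have "open (X \<inter> Y)" "x0 \<in> X \<inter> Y" using XY by auto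
    then obtain e where e: "e > 0" "ball x0 e \<subseteq> X \<inter> Y" using openE by blast
    have "x \<in> U0 \<and> y \<in> U0 \<and> gmul (chart_inv c0 x) (chart_inv c0 y) \<in> chart_dom c0 \<and> mult0 x y \<in> V"
      if "x \<in> ball x0 (min e r)" "y \<in> ball x0 (min e r)" for x y
    proof -
      have "(x, y) \<in> X \<times> Y" using that e by auto
      then show ?thesis using XY(5) by (auto simp: U0_def)
    qed
    then show ?thesis using that[of "min e r"] e r by simp
  qed
  \<comment> \<open>Left multiplication by \<open>a\<close> carries the left-invariant frame to
    itself, so it qualifies as the map \<open>f\<close> of
    \<open>primitive_left_translation\<close>.\<close>
  have F_mult: "F (mult0 a y) = hmul (F a) (F y)" if a: "a \<in> ball x0 \<rho>" and y: "y \<in> ball x0 \<rho>" for a y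
  proof -
    have "F (mult0 a y) = hmul (F (mult0 a x0)) (F y)"
    proof (rule cc.primitive_left_translation[OF F F0 r(2) \<rho> _ _ _ y])
      fix z assume z: "z \<in> ball x0 \<rho>"
      show "mult0 a z \<in> ball x0 r" using mult[OF a z] V(3) by blast
      show "(mult0 a has_derivative dmap (gmul (chart_inv c0 a)) c0 c0 (chart_inv c0 z)) (at z)"
        using mult[OF a z] by (intro has_derivative_mult0) auto
      show "dmap (gmul (chart_inv c0 a)) c0 c0 (chart_inv c0 z) (M z (T v)) = M (mult0 a z) (T v)" for v
        using mult[OF a z] by (intro M_mult0[symmetric]) auto
    qed
    moreover have "mult0 a x0 = a"
      using mult[OF a a] U0_inv by (simp add: mult0_def)
    ultimately show ?thesis by simp
  qed
  have conts: "continuous_on W s" using sms by (rule smooth_on_imp_continuous_on)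
  have s_0: "s 0 = x0" using sF[OF V(2)] F0 by simp
  obtain \<epsilon> where eps: "\<epsilon> > 0" "ball 0 \<epsilon> \<subseteq> W" "s ` ball 0 \<epsilon> \<subseteq> ball x0 \<rho>"
    and hm: "\<And>u v. norm u < \<epsilon> \<Longrightarrow> norm v < \<epsilon> \<Longrightarrow> hmul u v \<in> W"
  proof -
    have "continuous_on UNIV (\<lambda>z. hmul (fst z) (snd z))" by (intro continuous_intros)
    then have "open ((\<lambda>z. hmul (fst z) (snd z)) -` W)" by (rule open_vimage[OF W(1)])
    moreover have "(0, 0) \<in> (\<lambda>z. hmul (fst z) (snd z)) -` W" using W by simp
    ultimately obtain X Y where XY: "open X" "open Y" "0 \<in> X" "0 \<in> Y" "X \<times> Y \<subseteq> (\<lambda>z. hmul (fst z) (snd z)) -` W"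
      by (rule open_prod_elim) (auto dest: that)
    have "open (W \<inter> s -` ball x0 \<rho>)" by (rule continuous_open_preimage[OF conts W(1) open_ball])
    then have "open (X \<inter> Y \<inter> (W \<inter> s -` ball x0 \<rho>))" by (rule open_Int[OF open_Int[OF XY(1,2)]])
    moreover have "0 \<in> X \<inter> Y \<inter> (W \<inter> s -` ball x0 \<rho>)" using XY W \<rho> by (simp add: s_0)
    ultimately obtain e where e: "e > 0" "ball 0 e \<subseteq> X \<inter> Y \<inter> (W \<inter> s -` ball x0 \<rho>)" using openE by blast
    show ?thesis
    proof (rule that[OF e(1)])
      show "ball 0 e \<subseteq> W" "s ` ball 0 e \<subseteq> ball x0 \<rho>" using e by auto
      fix u v :: "real ^ 'n" assume "norm u < e" "norm v < e"
      then have "u \<in> ball 0 e" "v \<in> ball 0 e" by simp_all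
      then have "(u, v) \<in> X \<times> Y" using e by blast
      then show "hmul u v \<in> W" using XY(5) by auto
    qed
  qed
  define S where "S u = chart_inv c0 (s u)" for u
  have epsW: "u \<in> W" if "norm u < \<epsilon>" for u using eps(2) that by auto
  have sU0: "s u \<in> U0" if "u \<in> W" for u using sV(1)[OF that] VU0 by blast
  interpret E: local_isomorphism b gmul gunit ginv S \<epsilon>
  proof
    show "S (hmul u v) = gmul (S u) (S v)" if u: "norm u < \<epsilon>" and v: "norm v < \<epsilon>" for u v
    proof -
      have su: "s u \<in> ball x0 \<rho>" "s v \<in> ball x0 \<rho>" using eps(3) u v by (simp_all add: image_subset_iff)
      have "F (mult0 (s u) (s v)) = hmul u v"
        using F_mult[OF su] sV epsW u v by simp
      then have "s (hmul u v) = mult0 (s u) (s v)"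
        using sF mult[OF su] by metis
      then show ?thesis
        using mult[OF su] by (simp add: S_def mult0_def chart_inv_map[OF c0(1)])
    qed
    show "continuous_on (ball 0 \<epsilon>) S"
      unfolding S_def
      by (rule continuous_on_compose2[OF continuous_on_chart_inv[OF c0(1)] continuous_on_subset[OF conts eps(2)]])
        (use sU0 eps(2) in \<open>auto simp: U0_def\<close>)
    show "inj_on S (ball 0 \<epsilon>)"
    proof (rule inj_onI)
      fix u v assume "u \<in> ball 0 \<epsilon>" "v \<in> ball 0 \<epsilon>" and eq: "S u = S v"
      then have uv: "u \<in> W" "v \<in> W" using eps by auto
      then have "s u = s v" using eq sU0 U0_inv(2) unfolding S_def by metis
      then show "u = v" using sV(2) uv by metis
    qed
    show "open (S ` X)" if X: "open X" "X \<subseteq> ball 0 \<epsilon>" for X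
    proof -
      have XW: "X \<subseteq> W" using X eps by blast
      have "s ` X = V \<inter> F -` X"
      proof
        show "s ` X \<subseteq> V \<inter> F -` X" using sV XW by auto
        show "V \<inter> F -` X \<subseteq> s ` X"
        proof
          fix x assume "x \<in> V \<inter> F -` X"
          then show "x \<in> s ` X" using sF[of x] by (intro image_eqI[of _ _ "F x"]) auto
        qed
      qed
      moreover have "open (V \<inter> F -` X)"
        using hom X V by (intro continuous_open_preimage) (auto simp: homeomorphism_def)
      ultimately have sX: "open (s ` X)" by simp
      have "S ` X = chart_dom c0 \<inter> chart_map c0 -` (s ` X)"
      proof
        show "S ` X \<subseteq> chart_dom c0 \<inter> chart_map c0 -` (s ` X)"
          using XW sU0 U0_inv by (auto simp: S_def)
        show "chart_dom c0 \<inter> chart_map c0 -` (s ` X) \<subseteq> S ` X"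
        proof
          fix q assume "q \<in> chart_dom c0 \<inter> chart_map c0 -` (s ` X)"
          then obtain u where "q \<in> chart_dom c0" "chart_map c0 q = s u" "u \<in> X" by auto
          then show "q \<in> S ` X" using chart_inv_map[OF c0(1), of q] by (auto simp: S_def)
        qed
      qed
      then show ?thesis
        using continuous_open_preimage[OF continuous_on_chart_map[OF c0(1)] open_chart_dom[OF c0(1)] sX] by simp
    qed
  qed (use continuous_gmul continuous_ginv connected_G simply_connected_G eps in auto)
  show ?thesis
  proof (rule that[of E.E \<epsilon> s V F])
    show "smooth_on (ball 0 \<epsilon>) s" by (rule smooth_on_subset[OF sms eps(2)])
    show "(s has_derivative T) (at 0)" using s0 by simp
    show "s u \<in> V \<and> F (s u) = u \<and> E.E u = chart_inv c0 (s u)" if "norm u < \<epsilon>" for u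
      using sV[OF epsW[OF that]] E.E_eq_S[OF that] by (simp add: S_def)
    show "smooth_on V F" by (rule smooth_on_subset[OF smF V(3)])
  qed (use E.bij_E E.E_hmul E.E_0 E.continuous_E E.open_E eps V VU0 in auto)
qed

end

section \<open>Frames adapted to the stratification\<close>

definition orthonormal_wrt :: "('a \<Rightarrow> 'a \<Rightarrow> real) \<Rightarrow> 'a set \<Rightarrow> bool"
  where "orthonormal_wrt h B \<longleftrightarrow> (\<forall>x\<in>B. \<forall>y\<in>B. h x y = (if x = y then 1 else 0))"

locale inner_product =
  fixes h :: "'a::euclidean_space \<Rightarrow> 'a \<Rightarrow> real"
  assumes bilinear_h: "bilinear h" and sym_h: "h v w = h w v" and pos_h: "v \<noteq> 0 \<Longrightarrow> h v v > 0"
begin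

lemma h_sum_left: "h (\<Sum>i\<in>I. c i *\<^sub>R x i) w = (\<Sum>i\<in>I. c i * h (x i) w)"
proof -
  have l: "linear (\<lambda>v. h v w)" using bilinear_h by (simp add: bilinear_def)
  show ?thesis using linear_sum[OF l, of "\<lambda>i. c i *\<^sub>R x i" I] by (simp add: linear_cmul[OF l])
qed

lemma orthonormal_coeff:
  assumes "orthonormal_wrt h B" "finite B" "w \<in> B"
  shows "h (\<Sum>x\<in>B. c x *\<^sub>R x) w = c w"
proof -
  have "(\<Sum>x\<in>B. c x * h x w) = (\<Sum>x\<in>B. if x = w then c x else 0)"
    using assms by (intro sum.cong) (auto simp: orthonormal_wrt_def)
  then show ?thesis using assms by (simp add: h_sum_left)
qed

lemma orthonormal_independent:
  assumes "orthonormal_wrt h B" "finite B"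
  shows "independent B"
proof (rule independent_if_scalars_zero[OF assms(2)])
  fix c x assume c: "(\<Sum>x\<in>B. c x *\<^sub>R x) = 0" and x: "x \<in> B"
  have "h 0 x = 0" using bilinear_h by (simp add: bilinear_lzero)
  then show "c x = 0" using orthonormal_coeff[OF assms x, of c] c by simp
qed

text \<open>One Gram-Schmidt step: the projection of \<open>v\<close> to the span of
  \<open>B\<close> is subtracted and the remainder normalised.\<close>

lemma orthonormal_extend:
  assumes B: "orthonormal_wrt h B" "finite B" and V: "subspace V" "B \<subseteq> V" and v: "v \<in> V" "v \<notin> span B"
  obtains u where "u \<in> V" "u \<notin> B" "orthonormal_wrt h (insert u B)"
proof -
  define z where "z = v - (\<Sum>x\<in>B. h v x *\<^sub>R x)"
  have zV: "z \<in> V"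
    unfolding z_def using V v by (intro subspace_diff subspace_sum subspace_scale) auto
  have "(\<Sum>x\<in>B. h v x *\<^sub>R x) \<in> span B"
    by (intro span_sum span_scale span_base)
  then have z0: "z \<noteq> 0" using v unfolding z_def by auto
  have zx: "h z x = 0" if "x \<in> B" for x
    using orthonormal_coeff[OF B that, of "h v"] by (simp add: z_def bilinear_lsub[OF bilinear_h])
  define u where "u = (1 / sqrt (h z z)) *\<^sub>R z"
  have ux: "h u x = 0" if "x \<in> B" for x
    using zx[OF that] by (simp add: u_def bilinear_lmul[OF bilinear_h])
  have uu: "h u u = 1"
    using pos_h[OF z0] by (simp add: u_def bilinear_lmul[OF bilinear_h] bilinear_rmul[OF bilinear_h])
  have xu: "h x u = 0" if "x \<in> B" for x
    using ux[OF that] sym_h[of x u] by simp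
  have "u \<notin> B"
  proof
    assume "u \<in> B"
    then show False using ux[of u] uu by simp
  qed
  moreover have "orthonormal_wrt h (insert u B)"
    using B(1) ux xu uu \<open>u \<notin> B\<close> by (auto simp: orthonormal_wrt_def)
  moreover have "u \<in> V" using zV V by (simp add: u_def subspace_scale)
  ultimately show ?thesis using that by blast
qed

lemma orthonormal_basis_extend:
  assumes B: "orthonormal_wrt h B" "finite B" and V: "subspace V" "B \<subseteq> V"
  obtains C where "B \<subseteq> C" "C \<subseteq> V" "finite C" "orthonormal_wrt h C" "span C = V" "card C = dim V"
proof -
  let ?Q = "\<lambda>C. B \<subseteq> C \<and> C \<subseteq> V \<and> finite C \<and> orthonormal_wrt h C"
  \<comment> \<open>Independence bounds the cardinality of orthonormal sets, and one of largest
    cardinality spans, since otherwise a Gram-Schmidt step would enlarge it.\<close>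
  have "\<exists>C. ?Q C \<and> (\<forall>C'. ?Q C' \<longrightarrow> card C' \<le> card C)"
  proof (rule ex_has_greatest_nat[where b="Suc (dim V)"])
    show "?Q B" using B V by auto
    show "\<forall>C. ?Q C \<longrightarrow> card C < Suc (dim V)"
      using independent_card_le_dim orthonormal_independent by (metis le_imp_less_Suc)
  qed
  then obtain C where C: "?Q C" and max: "\<And>C'. ?Q C' \<Longrightarrow> card C' \<le> card C" by blast
  have "V \<subseteq> span C"
  proof (rule ccontr)
    assume "\<not> V \<subseteq> span C"
    then obtain v where v: "v \<in> V" "v \<notin> span C" by blast
    obtain u where "u \<in> V" "u \<notin> C" "orthonormal_wrt h (insert u C)"
      by (rule orthonormal_extend[of C V v]) (use C V v in auto)
    then have "card (insert u C) \<le> card C" using C by (intro max) auto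
    then show False using \<open>u \<notin> C\<close> C by simp
  qed
  then have "span C = V" using C V by (simp add: span_subspace)
  moreover have "card C = dim V"
    using \<open>V \<subseteq> span C\<close> C orthonormal_independent[of C] by (simp add: basis_card_eq_dim)
  ultimately show ?thesis using that C by blast
qed

end

text \<open>An orthonormal basis of \<open>V\<close> is extended to the whole space and indexed by
  the coordinates, with \<open>J\<close> marking the part in \<open>V\<close>. The other basis
  vectors span the orthogonal complement, so that the new first layer is given by the coordinates
  outside \<open>J\<close>.\<close>

lemma adapted_orthonormal_frame:
  fixes h :: "real ^ 'n \<Rightarrow> real ^ 'n \<Rightarrow> real"
  assumes "bilinear h" "\<And>v w. h v w = h w v" "\<And>v. v \<noteq> 0 \<Longrightarrow> h v v > 0" and V: "subspace V"
  obtains T :: "real ^ 'n \<Rightarrow> real ^ 'n" and J where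
    "linear T" "bij T" "\<And>v w. h (T v) (T w) = v \<bullet> w" "T ` {x. \<forall>i. i \<notin> J \<longrightarrow> x $ i = 0} = V" "card J = dim V"
proof -
  interpret inner_product h using assms by unfold_locales
  obtain B where B: "B \<subseteq> V" "finite B" "orthonormal_wrt h B" "span B = V" "card B = dim V"
    by (rule orthonormal_basis_extend[of "{}" V]) (use V in \<open>auto simp: orthonormal_wrt_def\<close>)
  obtain C where C: "B \<subseteq> C" "finite C" "orthonormal_wrt h C" "span C = UNIV" "card C = CARD('n)"
    by (rule orthonormal_basis_extend[of B UNIV]) (use B in auto)
  obtain \<beta> :: "'n \<Rightarrow> real ^ 'n" where \<beta>: "bij_betw \<beta> UNIV C"
    using C(2,5) finite_same_card_bij[of "UNIV :: 'n set" C] by auto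
  define J where "J = {i. \<beta> i \<in> B}"
  define T where "T x = (\<Sum>i\<in>UNIV. x $ i *\<^sub>R \<beta> i)" for x :: "real ^ 'n"
  have \<beta>C: "\<beta> i \<in> C" and \<beta>_eq: "\<beta> i = \<beta> j \<longleftrightarrow> i = j" for i j
    using \<beta> by (auto simp: bij_betw_def inj_on_def)
  have lin: "linear T"
    by (rule linearI) (simp_all add: T_def scaleR_add_left sum.distrib scaleR_sum_right)
  have ortho: "h (T v) (T w) = v \<bullet> w" for v w
  proof -
    have 1: "h (\<beta> i) (T w) = w $ i" for i
    proof -
      have "h (T w) (\<beta> i) = (\<Sum>j\<in>UNIV. w $ j * h (\<beta> j) (\<beta> i))" by (simp add: T_def h_sum_left)
      also have "\<dots> = (\<Sum>j\<in>UNIV. if j = i then w $ j else 0)"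
        using C(3) \<beta>C \<beta>_eq by (intro sum.cong) (auto simp: orthonormal_wrt_def)
      finally show ?thesis by (simp add: sym_h)
    qed
    have "h (T v) (T w) = (\<Sum>i\<in>UNIV. v $ i * h (\<beta> i) (T w))" by (subst (1) T_def) (simp add: h_sum_left)
    then show ?thesis by (simp add: 1 inner_vec_def)
  qed
  have inj: "inj T"
  proof (rule linear_injective_0[OF lin, THEN iffD2], intro allI impI)
    fix v assume "T v = 0"
    then have "v \<bullet> v = 0" using ortho[of v v] by (simp add: bilinear_lzero[OF bilinear_h])
    then show "v = 0" by simp
  qed
  then have bij: "bij T" using lin by (simp add: bij_def linear_injective_imp_surjective)
  let ?W = "{x :: real ^ 'n. \<forall>i. i \<notin> J \<longrightarrow> x $ i = 0}"
  have "T ` ?W = V"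
  proof
    show "T ` ?W \<subseteq> V"
    proof clarify
      fix x :: "real ^ 'n" assume x: "\<forall>i. i \<notin> J \<longrightarrow> x $ i = 0"
      have "x $ i *\<^sub>R \<beta> i \<in> V" for i
        using x B V by (cases "i \<in> J") (auto simp: J_def subspace_scale subspace_0)
      then show "T x \<in> V" unfolding T_def by (intro subspace_sum V)
    qed
    have "subspace ?W" by (auto simp: subspace_def)
    then have "subspace (T ` ?W)" by (rule linear_subspace_image[OF lin])
    moreover have "B \<subseteq> T ` ?W"
    proof
      fix v assume v: "v \<in> B"
      then obtain i where i: "v = \<beta> i" using C(1) \<beta> by (auto simp: bij_betw_def)
      have "T (axis i 1) = (\<Sum>j\<in>UNIV. if j = i then \<beta> j else 0)"
        unfolding T_def by (intro sum.cong) (auto simp: axis_def)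
      then have "v = T (axis i 1)" using i by simp
      moreover have "axis i 1 \<in> ?W" using v i by (auto simp: axis_def J_def)
      ultimately show "v \<in> T ` ?W" by blast
    qed
    ultimately show "V \<subseteq> T ` ?W" using B(4) span_minimal by blast
  qed
  moreover have "card J = dim V"
  proof -
    have "bij_betw \<beta> J B"
      using \<beta> C(1) by (auto simp: J_def bij_betw_def inj_on_def image_iff)
    then show ?thesis using B(5) bij_betw_same_card by metis
  qed
  ultimately show ?thesis using that[OF lin bij ortho] by blast
qed

section \<open>Evaluating left-invariant fields at the identity\<close>

context lie_group_charts
begin

lemma linear_eval: "linear (\<lambda>X :: 'g \<Rightarrow> real ^ 'n. X gunit)"
  by (rule linearI) (simp_all add: plus_fun_def scaleR_fun_def)

lemma inj_eval: "inj_on (\<lambda>X. X gunit) (lie_algebra A gmul)"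
  by (rule inj_onI) (metis lie_algebra_left_field)

text \<open>A left-invariant field is determined by its value at the identity, so evaluation carries
  a basis of \<open>W\<close> to a basis of the image.\<close>

lemma dim_eval:
  assumes "subspace W" "W \<subseteq> lie_algebra A gmul"
  shows "dim ((\<lambda>X. X gunit) ` W) = dim W"
proof -
  obtain B where B: "B \<subseteq> W" "independent B" "W \<subseteq> span B" "card B = dim W"
    using basis_exists by blast
  have sp: "span B = W" using B assms span_subspace by blast
  have inj: "inj_on (\<lambda>X. X gunit) W" using inj_eval assms(2) by (rule inj_on_subset)
  have "independent ((\<lambda>X. X gunit) ` B)"
    by (rule linear_independent_injective_image[OF linear_eval B(2)]) (use inj sp in simp)
  moreover have "span ((\<lambda>X. X gunit) ` B) = span ((\<lambda>X. X gunit) ` W)"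
    using linear_span_image[OF linear_eval, of B] linear_span_image[OF linear_eval, of W] sp assms by (simp add: span_eq_iff[THEN iffD2])
  ultimately have "dim ((\<lambda>X. X gunit) ` W) = card ((\<lambda>X. X gunit) ` B)"
    by (intro dim_eq_card)
  also have "\<dots> = card B" using inj B(1) by (intro card_image) (rule inj_on_subset)
  finally show ?thesis using B(4) by simp
qed

text \<open>Only \<open>[g1, g2] = 0\<close> is part of the definition; that \<open>[g2, g2] = 0\<close> follows from the Jacobi
  identity.\<close>

lemma stratification_bracket:
  assumes "step_two_stratification A gmul g1 g2"
  defines "V \<equiv> (\<lambda>X. X gunit) ` g2"
  shows "subspace V" "dim V = dim g2" "dim g1 + dim g2 = CARD('n)"
    "\<And>v w. bracket v w \<in> V" "\<And>v w. w \<in> V \<Longrightarrow> bracket v w = 0"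
proof -
  let ?ev = "\<lambda>X :: 'g \<Rightarrow> real ^ 'n. X gunit"
  let ?V1 = "?ev ` g1"
  have g: "subspace g1" "subspace g2" "g1 \<inter> g2 = {0}" "{X + Y |X Y. X \<in> g1 \<and> Y \<in> g2} = lie_algebra A gmul"
    "span {lie_bracket A X Y |X Y. X \<in> g1 \<and> Y \<in> g1} = g2" "\<And>X Y. X \<in> g1 \<Longrightarrow> Y \<in> g2 \<Longrightarrow> lie_bracket A X Y = 0"
    using assms by (auto simp: step_two_stratification_def)
  have sub: "g1 \<subseteq> lie_algebra A gmul" "g2 \<subseteq> lie_algebra A gmul"
  proof -
    have "X + 0 \<in> lie_algebra A gmul" if "X \<in> g1" for X
      unfolding g(4)[symmetric] using that subspace_0[OF g(2)] by blast
    then show "g1 \<subseteq> lie_algebra A gmul" by auto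
    have "0 + X \<in> lie_algebra A gmul" if "X \<in> g2" for X
      unfolding g(4)[symmetric] using that subspace_0[OF g(1)] by blast
    then show "g2 \<subseteq> lie_algebra A gmul" by auto
  qed
  interpret br: bounded_bilinear bracket by (rule bilinear_bracket)
  show V: "subspace V" unfolding V_def by (rule linear_subspace_image[OF linear_eval g(2)])
  have V1: "subspace ?V1" by (rule linear_subspace_image[OF linear_eval g(1)])
  show dV: "dim V = dim g2" unfolding V_def by (rule dim_eval[OF g(2) sub(2)])
  have decomp: "\<exists>x\<in>?V1. \<exists>y\<in>V. v = x + y" for v
  proof -
    have "left_field v \<in> {X + Y |X Y. X \<in> g1 \<and> Y \<in> g2}" using g(4) left_field_in_lie_algebra by simp
    then obtain X Y where XY: "X \<in> g1" "Y \<in> g2" "left_field v = X + Y" by blast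
    have "v = ?ev (left_field v)" by simp
    also have "\<dots> = ?ev X + ?ev Y" unfolding XY(3) by (simp add: plus_fun_def)
    finally show ?thesis using XY by (auto simp: V_def)
  qed
  have "?V1 \<inter> V = {0}"
  proof
    show "?V1 \<inter> V \<subseteq> {0}"
    proof
      fix z assume "z \<in> ?V1 \<inter> V"
      then obtain X Y where XY: "X \<in> g1" "Y \<in> g2" "z = ?ev X" "z = ?ev Y" by (auto simp: V_def)
      then have "X = Y" using inj_onD[OF inj_eval, of X Y] sub by auto
      then have "X = 0" using g(3) XY by auto
      then show "z \<in> {0}" using XY by simp
    qed
    show "{0} \<subseteq> ?V1 \<inter> V" using subspace_0[OF V] subspace_0[OF V1] by simp
  qed
  then have "dim {x + y |x y. x \<in> ?V1 \<and> y \<in> V} = dim ?V1 + dim V"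
    using dim_sums_Int[OF V1 V] by simp
  moreover have "{x + y |x y. x \<in> ?V1 \<and> y \<in> V} = UNIV" using decomp by blast
  ultimately show "dim g1 + dim g2 = CARD('n)"
    using dim_eval[OF g(1) sub(1)] dV by simp
  have b11: "bracket x y \<in> V" if "x \<in> ?V1" "y \<in> ?V1" for x y
  proof -
    obtain X Y where XY: "X \<in> g1" "Y \<in> g1" "x = ?ev X" "y = ?ev Y" using \<open>x \<in> ?V1\<close> \<open>y \<in> ?V1\<close> by blast
    have "lie_bracket A X Y \<in> g2" unfolding g(5)[symmetric] using XY by (intro span_base) blast
    moreover have "bracket x y = ?ev (lie_bracket A X Y)"
      using XY sub by (subst lie_bracket_gunit) auto
    ultimately show ?thesis by (simp add: V_def)
  qed
  have b12: "bracket x y = 0" if xy: "x \<in> ?V1" "y \<in> V" for x y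
  proof -
    obtain X Y where XY: "X \<in> g1" "Y \<in> g2" "x = ?ev X" "y = ?ev Y" using xy unfolding V_def by blast
    have "bracket x y = ?ev (lie_bracket A X Y)"
      using XY sub by (subst lie_bracket_gunit) auto
    then show ?thesis using g(6)[OF XY(1,2)] by simp
  qed
  have V_span: "V = span {bracket x y |x y. x \<in> ?V1 \<and> y \<in> ?V1}"
  proof -
    have "V = span (?ev ` {lie_bracket A X Y |X Y. X \<in> g1 \<and> Y \<in> g1})"
      by (simp only: V_def linear_span_image[OF linear_eval] g(5))
    also have "?ev ` {lie_bracket A X Y |X Y. X \<in> g1 \<and> Y \<in> g1} = {bracket x y |x y. x \<in> ?V1 \<and> y \<in> ?V1}"
    proof -
      have ev: "?ev (lie_bracket A X Y) = bracket (?ev X) (?ev Y)" if "X \<in> g1" "Y \<in> g1" for X Y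
        using that sub by (intro lie_bracket_gunit) auto
      show ?thesis
      proof (intro equalityI subsetI)
        fix z assume "z \<in> ?ev ` {lie_bracket A X Y |X Y. X \<in> g1 \<and> Y \<in> g1}"
        then obtain X Y where XY: "X \<in> g1" "Y \<in> g1" "z = ?ev (lie_bracket A X Y)" by blast
        then have "z = bracket (?ev X) (?ev Y)" using ev by simp
        with XY show "z \<in> {bracket x y |x y. x \<in> ?V1 \<and> y \<in> ?V1}" by blast
      next
        fix z assume "z \<in> {bracket x y |x y. x \<in> ?V1 \<and> y \<in> ?V1}"
        then obtain X Y where XY: "X \<in> g1" "Y \<in> g1" "z = bracket (?ev X) (?ev Y)" by blast
        then have "z = ?ev (lie_bracket A X Y)" using ev by simp
        with XY show "z \<in> ?ev ` {lie_bracket A X Y |X Y. X \<in> g1 \<and> Y \<in> g1}" by blast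
      qed
    qed
    finally show ?thesis .
  qed
  \<comment> \<open>The second layer is spanned by brackets of first-layer vectors, so
    \<open>y\<close> may be taken to be one of these; two of the three Jacobi terms then contain a
    bracket between the layers and vanish.\<close>
  have b22: "bracket y z = 0" if y: "y \<in> V" and z: "z \<in> V" for y z
  proof -
    have "subspace {y. bracket y z = 0}"
      by (auto simp: subspace_def br.zero_left br.add_left br.scaleR_left)
    moreover have "{bracket u v |u v. u \<in> ?V1 \<and> v \<in> ?V1} \<subseteq> {y. bracket y z = 0}"
    proof (rule subsetI)
      fix x assume "x \<in> {bracket u v |u v. u \<in> ?V1 \<and> v \<in> ?V1}"
      then obtain X Y where XY: "X \<in> g1" "Y \<in> g1" and x: "x = bracket (?ev X) (?ev Y)" by blast
      have "bracket (?ev Y) z = 0" "bracket (?ev X) z = 0" using XY z b12 by auto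
      moreover have "bracket z (?ev X) = 0"
        using bracket_antisym[of z "?ev X"] calculation by simp
      ultimately show "x \<in> {y. bracket y z = 0}"
        using bracket_jacobi[of "?ev X" "?ev Y" z] by (simp add: x br.zero_left)
    qed
    ultimately have "V \<subseteq> {y. bracket y z = 0}" unfolding V_span by (rule span_minimal[rotated])
    then show ?thesis using y by blast
  qed
  show b2: "bracket v w = 0" if w: "w \<in> V" for v w
    using decomp[of v] b12 b22 w by (auto simp: br.add_left)
  show "bracket v w \<in> V" for v w
  proof -
    obtain x y x' y' where "x \<in> ?V1" "y \<in> V" "v = x + y" "x' \<in> ?V1" "y' \<in> V" "w = x' + y'"
      using decomp[of v] decomp[of w] by blast
    moreover have "bracket y x' = 0" using bracket_antisym[of y x'] b12 calculation by simp
    ultimately show ?thesis using b11 b12 b22 by (simp add: br.add_left br.add_right)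
  qed
qed

end

section \<open>The metric in global coordinates\<close>

text \<open>In its use \<open>J\<close> indexes the second layer, so this is the orthogonal
  projection to the new first layer.\<close>

definition coord_proj :: "'n set \<Rightarrow> real ^ 'n::finite \<Rightarrow> real ^ 'n"
  where "coord_proj J v = (\<chi> i. if i \<in> J then 0 else v $ i)"

lemma coord_proj_coord_proj [simp]: "coord_proj J (coord_proj J v) = coord_proj J v"
  by (simp add: coord_proj_def vec_eq_iff)

locale exponential_chart = adapted_frame A gmul gunit ginv b T "coord_proj J"
  for A :: "('g::{t2_space,second_countable_topology}, 'n::finite) chart set"
    and gmul :: "'g \<Rightarrow> 'g \<Rightarrow> 'g" and gunit :: 'g and ginv :: "'g \<Rightarrow> 'g"
    and b :: "real ^ 'n \<Rightarrow> real ^ 'n \<Rightarrow> real ^ 'n" and T :: "real ^ 'n \<Rightarrow> real ^ 'n" and J :: "'n set" +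
  fixes E :: "real ^ 'n \<Rightarrow> 'g" and s F :: "real ^ 'n \<Rightarrow> real ^ 'n" and V :: "(real ^ 'n) set" and \<epsilon> :: real
    and g :: "'g \<Rightarrow> real ^ 'n \<Rightarrow> real ^ 'n \<Rightarrow> real"
  assumes bij_E: "bij E" and E_hmul: "\<And>u v. E (hmul u v) = gmul (E u) (E v)" and E_0 [simp]: "E 0 = gunit"
    and continuous_E: "continuous_on UNIV E" and open_E: "\<And>W. open W \<Longrightarrow> open (E ` W)"
    and eps: "\<epsilon> > 0" and smooth_s: "smooth_on (ball 0 \<epsilon>) s" and derivative_s: "(s has_derivative T) (at 0)"
    and s: "\<And>u. norm u < \<epsilon> \<Longrightarrow> s u \<in> V \<and> F (s u) = u \<and> E u = chart_inv c0 (s u)"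
    and V: "open V" "V \<subseteq> U0" and smooth_F: "smooth_on V F"
    and left_invariant: "left_invariant_metric A gmul g"
    and orthonormal: "\<And>v w. g gunit (T v) (T w) = v \<bullet> w"
begin

lemma inv_E [simp]: "inv E (E u) = u" "E (inv E q) = q"
  using bij_E by (simp_all add: bij_is_inj bij_is_surj surj_f_inv_f)

lemma continuous_inv_E: "continuous_on UNIV (inv E)"
proof (rule continuous_on_inverse_open_map[OF continuous_E])
  show "range E = UNIV" using bij_E by (simp add: bij_is_surj)
qed (use open_E in auto)

text \<open>Global exponential coordinates centred at \<open>p\<close>. Since left translations are
  isometries, this centring makes the coordinate description of balls and volumes the same for every
  \<open>p\<close>.\<close>

definition gchart :: "'g \<Rightarrow> ('g, 'n) chart"
  where "gchart p = (UNIV, \<lambda>q. inv E (gmul (ginv p) q))"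

lemma gchart_simps [simp]: "chart_dom (gchart p) = UNIV" "chart_map (gchart p) q = inv E (gmul (ginv p) q)"
  by (simp_all add: gchart_def)

lemma inverse_cancel [simp]: "gmul (ginv p) (gmul p q) = q" "gmul p (gmul (ginv p) q) = q"
  by (simp_all flip: grp.assoc)

lemma range_gchart [simp]: "range (chart_map (gchart p)) = UNIV"
  by (rule surjI[where f="\<lambda>x. gmul p (E x)"]) simp

lemma chart_inv_gchart [simp]: "chart_inv (gchart p) x = gmul p (E x)"
proof -
  have "inj (chart_map (gchart p))"
    by (rule injI) (metis gchart_simps(2) inv_E(2) inverse_cancel(2))
  moreover have "chart_map (gchart p) (gmul p (E x)) = x" by simp
  ultimately show ?thesis unfolding chart_inv_def gchart_simps(1) by (metis inv_f_f)
qed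

lemma is_chart_gchart: "is_chart (gchart p)"
proof -
  have "continuous_on UNIV (chart_map (gchart p))"
    unfolding gchart_simps by (intro continuous_on_compose2[OF continuous_inv_E] continuous_intros) auto
  moreover have "continuous_on UNIV (chart_inv (gchart p))"
  proof -
    have "continuous_on UNIV (\<lambda>x. gmul p (E x))" by (intro continuous_intros continuous_E)
    then show ?thesis by (metis chart_inv_gchart continuous_on_cong)
  qed
  ultimately show ?thesis
    unfolding is_chart_def homeomorphism_def gchart_simps(1) range_gchart
    by (auto simp: image_iff) (metis inv_E inverse_cancel)+
qed

lemma smooth_hmul: "smooth_on W (hmul x)"
proof -
  have "smooth_on UNIV (hmul x)"
    unfolding smooth_on_def hmul_def
    by (intro allI Ck_on_add Ck_on_const Ck_on_bounded_linear_compose[OF bounded_linear_scaleR_right]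
      Ck_on_bounded_linear bounded_linear_right bounded_linear_ident open_UNIV)
  then show ?thesis by (rule smooth_on_subset) simp
qed

text \<open>Around \<open>x1\<close> the point \<open>E x\<close> is the product of
  \<open>E x1\<close> and \<open>E (hmul (- x1) x)\<close>. The second factor is near the identity
  and is given there by \<open>s\<close>; what remains is a left translation, which is
  smooth.\<close>

lemma smooth_chart_E:
  assumes d: "d \<in> A"
  shows "smooth_on {x. gmul p (E x) \<in> chart_dom d} (\<lambda>x. chart_map d (gmul p (E x)))"
proof (rule smooth_on_locally)
  fix x1 assume x1: "x1 \<in> {x. gmul p (E x) \<in> chart_dom d}"
  define q where "q = gmul p (E x1)"
  define N where "N = {x. norm (hmul (- x1) x) < \<epsilon>} \<inter> (\<lambda>x. gmul p (E x)) -` chart_dom d"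
  let ?W = "{y \<in> chart_map c0 ` chart_dom c0. gmul q (chart_inv c0 y) \<in> chart_dom d}"
  have contE: "continuous_on UNIV (\<lambda>x. gmul p (E x))" by (intro continuous_intros continuous_E)
  have N: "open N" unfolding N_def
    by (intro open_Int open_Collect_less continuous_intros open_vimage[OF open_chart_dom[OF d] contE])
  have W: "open ?W"
    by (rule open_chart_vimage[OF c0(1) _ open_chart_dom[OF d]]) (intro continuous_intros)
  have eq: "gmul p (E x) = gmul q (chart_inv c0 (s (hmul (- x1) x)))" if "x \<in> N" for x
  proof -
    have "E x = gmul (E x1) (E (hmul (- x1) x))" by (simp flip: E_hmul)
    then show ?thesis using that s[of "hmul (- x1) x"] by (simp add: N_def q_def grp.assoc)
  qed
  have sm: "smooth_on N (\<lambda>x. s (hmul (- x1) x))"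
    by (rule smooth_on_compose[OF N open_ball smooth_hmul smooth_s]) (auto simp: N_def)
  have "smooth_on N (\<lambda>x. chart_map d (gmul q (chart_inv c0 (s (hmul (- x1) x)))))"
  proof (rule smooth_on_compose[OF N W sm])
    show "smooth_on ?W (\<lambda>y. chart_map d (gmul q (chart_inv c0 y)))"
      using smooth_map_gmul c0(1) d unfolding smooth_map_def by blast
    show "(\<lambda>x. s (hmul (- x1) x)) ` N \<subseteq> ?W"
    proof clarify
      fix x assume x: "x \<in> N"
      then have "s (hmul (- x1) x) \<in> U0" using s[of "hmul (- x1) x"] V by (auto simp: N_def)
      moreover have "gmul p (E x) \<in> chart_dom d" using x by (simp add: N_def)
      ultimately show "s (hmul (- x1) x) \<in> chart_map c0 ` chart_dom c0 \<and>
          gmul q (chart_inv c0 (s (hmul (- x1) x))) \<in> chart_dom d"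
        using eq[OF x] by (simp add: U0_def)
    qed
  qed
  then have "smooth_on N (\<lambda>x. chart_map d (gmul p (E x)))"
    by (rule smooth_on_cong[OF N, rotated]) (simp add: eq)
  moreover have "x1 \<in> N" using x1 eps by (simp add: N_def)
  ultimately show "\<exists>U. open U \<and> x1 \<in> U \<and> smooth_on U (\<lambda>x. chart_map d (gmul p (E x)))"
    using N by blast
qed

text \<open>The same translation to the identity, with the local inverse \<open>F\<close> in place
  of \<open>s\<close>.\<close>

lemma smooth_inv_E_chart:
  assumes d: "d \<in> A"
  shows "smooth_on (chart_map d ` chart_dom d) (\<lambda>y. inv E (gmul (ginv p) (chart_inv d y)))"
proof (rule smooth_on_locally)
  fix y1 assume y1: "y1 \<in> chart_map d ` chart_dom d"
  define q where "q = chart_inv d y1"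
  define x1 where "x1 = inv E (gmul (ginv p) q)"
  define N where "N = {y \<in> chart_map d ` chart_dom d. gmul (ginv q) (chart_inv d y) \<in> E ` ball 0 \<epsilon>}"
  let ?W = "{y \<in> chart_map d ` chart_dom d. gmul (ginv q) (chart_inv d y) \<in> chart_dom c0}"
  have N: "open N" unfolding N_def
    by (rule open_chart_vimage[OF d _ open_E[OF open_ball]]) (intro continuous_intros)
  have E_ball: "a \<in> chart_dom c0 \<and> chart_map c0 a \<in> V \<and> F (chart_map c0 a) = inv E a" if a: "a \<in> E ` ball 0 \<epsilon>" for a
  proof -
    obtain u where u: "norm u < \<epsilon>" "a = E u" using a by auto
    have "chart_map c0 a = s u" "a \<in> chart_dom c0"
      using s[OF u(1)] V(2) U0_inv[of "s u"] u(2) by auto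
    moreover have "inv E a = u" by (simp add: u(2))
    ultimately show ?thesis using s[OF u(1)] by simp
  qed
  have NW: "N \<subseteq> ?W" using E_ball by (auto simp: N_def)
  have "smooth_on ?W (\<lambda>y. chart_map c0 (gmul (ginv q) (chart_inv d y)))"
    using smooth_map_gmul c0(1) d unfolding smooth_map_def by blast
  then have sm: "smooth_on N (\<lambda>y. chart_map c0 (gmul (ginv q) (chart_inv d y)))"
    by (rule smooth_on_subset) (rule NW)
  have "smooth_on N (\<lambda>y. F (chart_map c0 (gmul (ginv q) (chart_inv d y))))"
    by (rule smooth_on_compose[OF N V(1) sm smooth_F]) (use E_ball in \<open>auto simp: N_def\<close>)
  then have "smooth_on N (\<lambda>y. hmul x1 (F (chart_map c0 (gmul (ginv q) (chart_inv d y)))))"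
    by (rule smooth_on_compose[OF N open_UNIV _ smooth_hmul]) simp
  then have "smooth_on N (\<lambda>y. inv E (gmul (ginv p) (chart_inv d y)))"
  proof (rule smooth_on_cong[OF N, rotated])
    fix y assume y: "y \<in> N"
    let ?a = "gmul (ginv q) (chart_inv d y)"
    have "E (hmul x1 (F (chart_map c0 ?a))) = gmul (gmul (ginv p) q) ?a"
      using E_ball[of ?a] y by (simp add: N_def E_hmul x1_def)
    also have "\<dots> = gmul (ginv p) (chart_inv d y)" by (simp add: grp.assoc)
    finally show "hmul x1 (F (chart_map c0 ?a)) = inv E (gmul (ginv p) (chart_inv d y))"
      by (metis inv_E(1))
  qed
  moreover have "y1 \<in> N"
    using y1 eps by (auto simp: N_def q_def intro!: image_eqI[of _ _ 0])
  ultimately show "\<exists>U. open U \<and> y1 \<in> U \<and> smooth_on U (\<lambda>y. inv E (gmul (ginv p) (chart_inv d y)))"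
    using N by blast
qed

text \<open>Maximality of the atlas turns compatibility with its charts into membership; length and
  volume can then be computed in this chart.\<close>

lemma gchart_in_atlas: "gchart p \<in> A"
proof -
  have "smoothly_compatible (gchart p) d" if d: "d \<in> A" for d
    unfolding smoothly_compatible_def
  proof
    have "chart_map (gchart p) ` (chart_dom (gchart p) \<inter> chart_dom d) = {x. gmul p (E x) \<in> chart_dom d}"
    proof (intro equalityI subsetI)
      fix x assume "x \<in> {x. gmul p (E x) \<in> chart_dom d}"
      then show "x \<in> chart_map (gchart p) ` (chart_dom (gchart p) \<inter> chart_dom d)"
        by (intro image_eqI[of _ _ "gmul p (E x)"]) auto
    qed auto
    moreover have "chart_map d \<circ> chart_inv (gchart p) = (\<lambda>x. chart_map d (gmul p (E x)))"
      by (simp add: fun_eq_iff)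
    ultimately show "smooth_on (chart_map (gchart p) ` (chart_dom (gchart p) \<inter> chart_dom d))
        (chart_map d \<circ> chart_inv (gchart p))"
      using smooth_chart_E[OF d] by simp
    have "chart_map (gchart p) \<circ> chart_inv d = (\<lambda>y. inv E (gmul (ginv p) (chart_inv d y)))"
      by (simp add: fun_eq_iff)
    then show "smooth_on (chart_map d ` (chart_dom (gchart p) \<inter> chart_dom d))
        (chart_map (gchart p) \<circ> chart_inv d)"
      using smooth_inv_E_chart[OF d] by simp
  qed
  moreover have "\<And>c. is_chart c \<Longrightarrow> (\<forall>d\<in>A. smoothly_compatible c d) \<Longrightarrow> c \<in> A"
    using lie unfolding lie_group_def smooth_structure_def by blast
  ultimately show ?thesis using is_chart_gchart by blast
qed

text \<open>Inverse of the differential at \<open>0\<close> of the left translation \<open>hmul x\<close>.\<close>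

definition N :: "real ^ 'n \<Rightarrow> real ^ 'n \<Rightarrow> real ^ 'n"
  where "N x v = v - (1/2) *\<^sub>R b x v"

text \<open>As a function of \<open>y\<close>, the point
  \<open>gmul p (E (hmul x y)) = gmul q (E y)\<close> is differentiated at \<open>0\<close> in two
  ways: through \<open>gchart p\<close>, where it reads \<open>hmul x y\<close>, and as the left
  translate by \<open>q\<close> of \<open>E\<close>, which in \<open>c0\<close> is \<open>s\<close>
  with derivative \<open>T\<close>.\<close>

lemma tangent_of_gchart:
  assumes q: "q = gmul p (E x)"
  shows "tangent_of_chart A (gchart p) q v = pushforward A (gmul q) gunit (T (N x v))"
proof -
  let ?c = "chart_at A q"
  have c: "?c \<in> A" "q \<in> chart_dom ?c" by (rule chart_at)+
  let ?D = "dmap (\<lambda>p. p) (gchart p) ?c q" and ?D' = "dmap (gmul q) c0 ?c gunit"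
  have x: "chart_map (gchart p) q = x" by (simp add: q)
  have D: "((\<lambda>z. chart_map ?c (gmul p (E z))) has_derivative ?D) (at x)"
    using has_derivative_dmap[OF smooth_map_ident gchart_in_atlas c(1), of q p] c(2) unfolding x by simp
  have hm: "(hmul x has_derivative (\<lambda>u. u + (1/2) *\<^sub>R b x u)) (at 0)"
    unfolding hmul_def[abs_def]
    by (auto intro!: derivative_eq_intros bounded_linear.has_derivative[OF bounded_linear_right])
  have 1: "((\<lambda>y. chart_map ?c (gmul p (E (hmul x y)))) has_derivative (\<lambda>u. ?D (u + (1/2) *\<^sub>R b x u))) (at 0)"
    by (rule has_derivative_compose[OF hm]) (use D in simp)
  have s0: "s 0 = x0"
    using s[of 0] eps V(2) U0_inv(2)[of "s 0"] by (auto simp: x0_def)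
  have D': "((\<lambda>y. chart_map ?c (gmul q (chart_inv c0 y))) has_derivative ?D') (at x0)"
    using has_derivative_dmap[OF smooth_map_gmul c0(1) c(1) c0(2), of q] c(2) by (simp add: x0_def)
  have 2: "((\<lambda>y. chart_map ?c (gmul q (chart_inv c0 (s y)))) has_derivative (\<lambda>u. ?D' (T u))) (at 0)"
    by (rule has_derivative_compose[OF derivative_s]) (use D' s0 in simp)
  then have 3: "((\<lambda>y. chart_map ?c (gmul p (E (hmul x y)))) has_derivative (\<lambda>u. ?D' (T u))) (at 0)"
  proof (rule has_derivative_transform_within_open[OF _ open_ball])
    show "(0 :: real ^ 'n) \<in> ball 0 \<epsilon>" using eps by simp
    fix y :: "real ^ 'n" assume "y \<in> ball 0 \<epsilon>"
    then show "chart_map ?c (gmul q (chart_inv c0 (s y))) = chart_map ?c (gmul p (E (hmul x y)))"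
      using s[of y] by (simp add: q E_hmul grp.assoc)
  qed
  have "?D (u + (1/2) *\<^sub>R b x u) = ?D' (T u)" for u
    using fun_cong[OF has_derivative_unique[OF 1 3], of u] .
  from this[of "N x v"] have "?D v = ?D' (T (N x v))"
    by (simp add: N_def diff_right scaleR_right)
  then show ?thesis
    by (simp add: tangent_of_chart_def chart_change_dmap pushforward_dmap c0_def)
qed

lemma local_metric_gchart: "local_metric A g (gchart p) x v w = N x v \<bullet> N x w"
proof -
  let ?q = "gmul p (E x)"
  have "g (gmul ?q gunit) (pushforward A (gmul ?q) gunit (T (N x v))) (pushforward A (gmul ?q) gunit (T (N x w)))
      = g gunit (T (N x v)) (T (N x w))"
    using left_invariant unfolding left_invariant_metric_def by blast
  then show ?thesis
    by (simp add: local_metric_def Let_def tangent_of_gchart orthonormal)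
qed

end

section \<open>Dilations and the volume of balls\<close>

definition coord_dilation :: "'n set \<Rightarrow> real \<Rightarrow> real ^ 'n::finite \<Rightarrow> real ^ 'n"
  where "coord_dilation J l v = (\<chi> i. (if i \<in> J then l\<^sup>2 else l) * v $ i)"

lemma linear_coord_dilation: "linear (coord_dilation J l)"
  by (rule linearI) (simp_all add: coord_dilation_def vec_eq_iff algebra_simps)

text \<open>The coordinates of the two layers are orthogonal for the standard inner product, so it
  is enough to compare components, where \<open>l\<^sup>2 \<le> l\<close>.\<close>

lemma norm_coord_dilation_le:
  assumes "0 < l" "l \<le> 1"
  shows "norm (coord_dilation J l v) \<le> l * norm v"
proof -
  have "l\<^sup>2 \<le> l" using assms by (simp add: power2_eq_square mult_left_le)
  then have "norm (coord_dilation J l v) \<le> norm (l *\<^sub>R v)"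
    using assms by (intro norm_le_componentwise_cart)
      (auto simp: coord_dilation_def abs_mult intro!: mult_right_mono)
  then show ?thesis using assms by simp
qed

lemma coord_dilation_inverse:
  assumes "l \<noteq> 0"
  shows "coord_dilation J (1 / l) (coord_dilation J l v) = v"
  using assms by (simp add: coord_dilation_def vec_eq_iff power_divide)

lemma emeasure_coord_dilation:
  fixes J :: "'n::finite set"
  assumes l: "l > 0" and B: "open B"
  shows "emeasure lborel (coord_dilation J l ` B) = ennreal (l ^ (card (- J) + 2 * card J)) * emeasure lborel B"
proof -
  let ?d = "coord_dilation J l"
  \<comment> \<open>\<open>lborel_affine_euclidean\<close> treats diagonal affine maps with weights
    indexed by basis vectors; the \<open>0\<close> added in \<open>d_eq\<close> is its translation
    part.\<close>
  define c :: "real ^ 'n \<Rightarrow> real" where "c j = (if \<exists>i\<in>J. j = axis i 1 then l\<^sup>2 else l)" for j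
  have c_axis: "c (axis i 1) = (if i \<in> J then l\<^sup>2 else l)" for i
    by (auto simp: c_def axis_eq_axis)
  have Basis: "(Basis :: (real ^ 'n) set) = (\<lambda>i. axis i 1) ` UNIV"
    by (auto simp: Basis_vec_def)
  have d_eq: "?d x = 0 + (\<Sum>j\<in>Basis. (c j * (x \<bullet> j)) *\<^sub>R j)" for x
  proof (rule euclidean_eqI)
    fix i :: "real ^ 'n" assume i: "i \<in> Basis"
    then obtain k where k: "i = axis k 1" using Basis by auto
    have "(0 + (\<Sum>j\<in>Basis. (c j * (x \<bullet> j)) *\<^sub>R j)) \<bullet> i = c i * (x \<bullet> i)"
      using i by (simp add: inner_sum_left_Basis)
    then show "?d x \<bullet> i = (0 + (\<Sum>j\<in>Basis. (c j * (x \<bullet> j)) *\<^sub>R j)) \<bullet> i"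
      by (simp add: k c_axis coord_dilation_def inner_axis)
  qed
  have "(\<Prod>j\<in>Basis. \<bar>c j\<bar>) = (\<Prod>i\<in>UNIV. if i \<in> J then l\<^sup>2 else l)"
    unfolding Basis using l by (subst prod.reindex) (auto simp: inj_on_def axis_eq_axis c_axis intro!: prod.cong)
  also have "\<dots> = (l\<^sup>2) ^ card J * l ^ card (- J)"
    by (simp add: prod.If_cases Compl_eq)
  also have "\<dots> = l ^ (card (- J) + 2 * card J)" by (simp add: power_add power_mult)
  finally have prod: "(\<Prod>j\<in>Basis. \<bar>c j\<bar>) = l ^ (card (- J) + 2 * card J)" .
  have leb: "lborel = density (distr lborel borel ?d) (\<lambda>_. ennreal (l ^ (card (- J) + 2 * card J)))"
    using lborel_affine_euclidean[of c 0] l unfolding d_eq[symmetric] prod by (simp add: c_def)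
  have inj: "?d ` B = coord_dilation J (1 / l) -` B"
  proof (intro equalityI subsetI)
    fix x assume "x \<in> coord_dilation J (1 / l) -` B"
    then show "x \<in> ?d ` B" using coord_dilation_inverse[of "1 / l" J x] l by (intro image_eqI[of _ _ "coord_dilation J (1 / l) x"]) auto
  qed (use coord_dilation_inverse[of l J] l in auto)
  have "open (?d ` B)"
    unfolding inj by (intro open_vimage B linear_continuous_on) (simp add: linear_conv_bounded_linear[symmetric] linear_coord_dilation)
  then have m: "?d ` B \<in> sets borel" by simp
  have dm: "?d \<in> lborel \<rightarrow>\<^sub>M borel"
    using borel_measurable_continuous_onI[OF linear_continuous_on[of ?d UNIV]]
    by (simp add: linear_conv_bounded_linear[symmetric] linear_coord_dilation)
  have "emeasure lborel (?d ` B) = emeasure (density (distr lborel borel ?d) (\<lambda>_. ennreal (l ^ (card (- J) + 2 * card J)))) (?d ` B)"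
    using leb by simp
  also have "\<dots> = ennreal (l ^ (card (- J) + 2 * card J)) * emeasure (distr lborel borel ?d) (?d ` B)"
    using m by (simp add: emeasure_density_const)
  also have "emeasure (distr lborel borel ?d) (?d ` B) = emeasure lborel (?d -` (?d ` B))"
    using m dm by (simp add: emeasure_distr)
  also have "?d -` (?d ` B) = B"
    by (rule inj_vimage_image_eq) (use coord_dilation_inverse[of l J] l in \<open>metis injI less_irrefl\<close>)
  finally show ?thesis .
qed

text \<open>The vector algebra behind \<open>open_reach\<close>, for the velocity of
  \<open>hmul (x t) (t *\<^sub>R w)\<close>: \<open>u\<close> is the velocity of \<open>x\<close>,
  and \<open>c\<close>, \<open>d\<close>, \<open>e\<close> are \<open>b x u\<close>,
  \<open>b x w\<close> and \<open>b u w\<close>.\<close>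

lemma velocity_identity:
  "u + w + (1/2) *\<^sub>R (d + t *\<^sub>R e) - (1/2) *\<^sub>R (c + d - t *\<^sub>R e) = u - (1/2) *\<^sub>R c + w + t *\<^sub>R e"
  for u :: "'a::euclidean_space"
proof (rule euclidean_eqI)
  fix i :: 'a
  show "(u + w + (1/2) *\<^sub>R (d + t *\<^sub>R e) - (1/2) *\<^sub>R (c + d - t *\<^sub>R e)) \<bullet> i =
      (u - (1/2) *\<^sub>R c + w + t *\<^sub>R e) \<bullet> i"
    by (simp add: inner_add_left inner_diff_left field_simps)
qed

context exponential_chart
begin

section \<open>Riemannian volume in exponential coordinates\<close>

lemma linear_N: "linear (N x)"
  by (rule linearI) (simp_all add: N_def add_right scaleR_right algebra_simps)

lemma bracket_proj: "b v (coord_proj J w) = b v w"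
  using antisym[where y=v and x="coord_proj J w"] antisym[where y=v and x=w] P(3)[of w v] by simp

text \<open>The automorphism \<open>\<alpha>\<close>, equal to \<open>-1\<close> on the first layer and \<open>1\<close> on the second, conjugates
  \<open>N x\<close> to \<open>N (- x)\<close>, its inverse.\<close>

lemma det_N_squared: "det (matrix (N x)) * det (matrix (N x)) = 1"
proof -
  define \<alpha> where "\<alpha> v = v - (coord_proj J v + coord_proj J v)" for v :: "real ^ 'n"
  have linP: "linear (coord_proj J :: real ^ 'n \<Rightarrow> _)" using P(1) by (rule bounded_linear.linear)
  have lin: "linear \<alpha>"
    by (rule linearI) (simp_all add: \<alpha>_def linear_add[OF linP] linear_cmul[OF linP] algebra_simps)
  have inv: "\<alpha> \<circ> \<alpha> = id"
    by (rule ext) (simp add: \<alpha>_def coord_proj_def vec_eq_iff)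
  have b\<alpha>: "b v (\<alpha> w) = - b v w" for v w
    by (simp only: \<alpha>_def diff_right add_right bracket_proj) simp
  have \<alpha>b: "\<alpha> (b v w) = b v w" for v w by (simp add: \<alpha>_def P(2))
  have conj: "N (- x) = \<alpha> \<circ> (N x \<circ> \<alpha>)"
  proof
    fix v
    have "\<alpha> (N x (\<alpha> v)) = \<alpha> (\<alpha> v) + (1/2) *\<^sub>R b x v"
      by (simp add: N_def b\<alpha> linear_add[OF lin] linear_cmul[OF lin] \<alpha>b)
    also have "\<alpha> (\<alpha> v) = v" using fun_cong[OF inv, of v] by simp
    finally show "N (- x) v = (\<alpha> \<circ> (N x \<circ> \<alpha>)) v" by (simp add: N_def minus_left)
  qed
  have "N x \<circ> N (- x) = id"
    by (rule ext) (simp add: N_def minus_left add_right scaleR_right)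
  then have "det (matrix (N x)) * det (matrix (N (- x))) = 1"
    by (metis det_I det_mul linear_N matrix_compose matrix_id_mat_1 id_def)
  moreover have "det (matrix \<alpha>) * det (matrix \<alpha>) = 1"
    using inv by (metis det_I det_mul lin matrix_compose matrix_id_mat_1 id_def)
  moreover have "det (matrix (N (- x))) = det (matrix \<alpha>) * (det (matrix (N x)) * det (matrix \<alpha>))"
    unfolding conj
    by (simp add: matrix_compose[OF linear_compose[OF lin linear_N] lin] matrix_compose[OF lin linear_N] det_mul)
  ultimately show ?thesis by algebra
qed

text \<open>The matrix of the metric is the transpose of \<open>N x\<close> times
  \<open>N x\<close>, so the volume density in these coordinates is constantly
  \<open>1\<close>.\<close>

lemma det_local_metric: "det (\<chi> i j. local_metric A g (gchart p) x (axis i 1) (axis j 1)) = 1"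
proof -
  have "(\<chi> i j. local_metric A g (gchart p) x (axis i 1) (axis j 1)) = transpose (matrix (N x)) ** matrix (N x)"
    by (simp add: local_metric_gchart vec_eq_iff matrix_matrix_mult_def transpose_def matrix_def inner_vec_def)
  then show ?thesis by (simp add: det_mul det_transpose det_N_squared)
qed

lemma volume_gchart:
  assumes \<nu>: "riemannian_volume A g \<nu>" and W: "open W"
  shows "emeasure \<nu> ((\<lambda>x. gmul p (E x)) ` W) = emeasure lborel W"
proof -
  let ?\<Phi> = "\<lambda>x. gmul p (E x)"
  have img: "chart_map (gchart p) ` ?\<Phi> ` W = W" by (simp add: image_image)
  have cont: "continuous_on UNIV (chart_map (gchart p))"
    using continuous_on_chart_map[OF gchart_in_atlas, of p] by simp
  have "?\<Phi> ` W = chart_map (gchart p) -` W"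
  proof (intro equalityI subsetI)
    fix q assume "q \<in> chart_map (gchart p) -` W"
    then show "q \<in> ?\<Phi> ` W" by (intro image_eqI[of _ _ "chart_map (gchart p) q"]) auto
  qed auto
  then have "open (?\<Phi> ` W)" using open_vimage[OF W cont] by simp
  then have "emeasure \<nu> (?\<Phi> ` W) = (\<integral>\<^sup>+x\<in>chart_map (gchart p) ` ?\<Phi> ` W.
      ennreal (sqrt (det (\<chi> i j. local_metric A g (gchart p) x (axis i 1) (axis j 1)))) \<partial>lborel)"
    using \<nu> gchart_in_atlas[of p] unfolding riemannian_volume_def by auto
  also have "\<dots> = emeasure lborel W"
    unfolding img det_local_metric using W by (simp add: nn_integral_indicator)
  finally show ?thesis .
qed

section \<open>Curves and balls in exponential coordinates\<close>

definition curve :: "real set \<Rightarrow> (real \<Rightarrow> real ^ 'n) \<Rightarrow> bool"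
  where "curve I x \<longleftrightarrow> open I \<and> {0..1} \<subseteq> I \<and> smooth_on I x"

text \<open>\<open>N (x t)\<close> moves the velocity back to the identity by left translation,
  where the metric is the standard inner product.\<close>

definition curve_length :: "(real \<Rightarrow> real ^ 'n) \<Rightarrow> real"
  where "curve_length x = integral {0..1} (\<lambda>t. norm (N (x t) (vector_derivative x (at t))))"

lemma curve_derivative:
  assumes "curve I x" "t \<in> I"
  shows "(x has_vector_derivative vector_derivative x (at t)) (at t)"
proof -
  have "x differentiable (at t)"
    using smooth_on_has_derivative[of I x t] assms by (auto simp: curve_def differentiable_def)
  then show ?thesis by (simp add: vector_derivative_works)
qed

lemma continuous_on_velocity:
  assumes "curve I x"
  shows "continuous_on {0..1} (\<lambda>t. vector_derivative x (at t))" "continuous_on {0..1} x"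
proof -
  have x: "open I" "{0..1} \<subseteq> I" "smooth_on I x" using assms by (auto simp: curve_def)
  have "continuous_on I (\<lambda>t. frechet_derivative x (at t) 1)"
    by (rule smooth_on_imp_continuous_on[OF smooth_on_frechet_derivative[OF x(3)]])
  moreover have "frechet_derivative x (at t) 1 = vector_derivative x (at t)" if "t \<in> I" for t
    using frechet_derivative_eqI[OF curve_derivative[OF assms that, unfolded has_vector_derivative_def]] by simp
  ultimately have "continuous_on I (\<lambda>t. vector_derivative x (at t))"
    by (rule continuous_on_eq)
  then show "continuous_on {0..1} (\<lambda>t. vector_derivative x (at t))"
    using x(2) by (rule continuous_on_subset)
  show "continuous_on {0..1} x"
    using smooth_on_imp_continuous_on[OF x(3)] x(2) by (rule continuous_on_subset)
qed

lemma continuous_on_speed: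
  assumes "curve I x"
  shows "continuous_on {0..1} (\<lambda>t. norm (N (x t) (vector_derivative x (at t))))"
  unfolding N_def by (intro continuous_intros continuous_on continuous_on_velocity[OF assms])

lemma curve_length_nonneg: "curve I x \<Longrightarrow> curve_length x \<ge> 0"
  unfolding curve_length_def by (intro integral_nonneg integrable_continuous_real continuous_on_speed) auto

lemma smooth_path_curve:
  assumes "curve I x"
  shows "smooth_path A (\<lambda>t. gmul p (E (x t)))"
  unfolding smooth_path_def
proof (intro exI conjI ballI)
  have x: "open I" "{0..1} \<subseteq> I" "smooth_on I x" using assms by (auto simp: curve_def)
  show "open I" "{0..1} \<subseteq> I" by fact+
  have contE: "continuous_on UNIV (\<lambda>x. gmul p (E x))" by (intro continuous_intros continuous_E)
  show cont: "continuous_on I (\<lambda>t. gmul p (E (x t)))"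
    using continuous_on_compose2[OF contE smooth_on_imp_continuous_on[OF x(3)]] by simp
  fix c assume c: "c \<in> A"
  let ?I = "{t \<in> I. gmul p (E (x t)) \<in> chart_dom c}"
  have I: "open ?I"
    using continuous_open_preimage[OF cont x(1) open_chart_dom[OF c]] by (simp add: Int_def vimage_def)
  have W: "open {x. gmul p (E x) \<in> chart_dom c}"
    using open_vimage[OF open_chart_dom[OF c] contE] by (simp add: vimage_def)
  have "smooth_on ?I (\<lambda>t. chart_map c (gmul p (E (x t))))"
    by (rule smooth_on_compose[OF I W _ smooth_chart_E[OF c]]) (auto intro: smooth_on_subset[OF x(3)])
  then show "smooth_on ?I (chart_map c \<circ> (\<lambda>t. gmul p (E (x t))))" by (simp add: o_def)
qed

lemma curve_smooth_path:
  assumes "smooth_path A \<gamma>"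
  obtains I where "curve I (\<lambda>t. chart_map (gchart p) (\<gamma> t))"
proof -
  obtain I where I: "open I" "{0..1} \<subseteq> I"
    and sm: "\<And>c. c \<in> A \<Longrightarrow> smooth_on {t \<in> I. \<gamma> t \<in> chart_dom c} (chart_map c \<circ> \<gamma>)"
    using assms unfolding smooth_path_def by blast
  have "smooth_on I (\<lambda>t. chart_map (gchart p) (\<gamma> t))"
    using sm[OF gchart_in_atlas, of p] by (simp add: o_def)
  then show ?thesis using that I by (simp add: curve_def)
qed

lemma riemannian_length_curve:
  assumes x: "curve I x"
  shows "riemannian_length A g (\<lambda>t. gmul p (E (x t))) = curve_length x"
  unfolding riemannian_length_def curve_length_def
proof (rule integral_cong)
  fix t :: real assume t: "t \<in> {0..1}"
  let ?q = "gmul p (E (x t))"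
  let ?c = "chart_at A ?q"
  let ?x' = "vector_derivative x (at t)"
  have tI: "t \<in> I" using t x by (auto simp: curve_def)
  have "((\<lambda>z. chart_map ?c (gmul p (E z))) has_derivative dmap (\<lambda>p. p) (gchart p) ?c ?q) (at (x t))"
    using has_derivative_dmap[OF smooth_map_ident gchart_in_atlas chart_at(1), of ?q p ?q] chart_at(2)[of ?q] by simp
  from has_derivative_compose[OF curve_derivative[OF x tI, unfolded has_vector_derivative_def] this]
  have "((\<lambda>t. chart_map ?c (gmul p (E (x t)))) has_vector_derivative dmap (\<lambda>p. p) (gchart p) ?c ?q ?x') (at t)"
    using linear_dmap[OF smooth_map_ident gchart_in_atlas chart_at(1), of ?q p ?q] chart_at(2)[of ?q]
    by (simp add: has_vector_derivative_def linear_cmul)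
  then have "velocity A (\<lambda>t. gmul p (E (x t))) t = tangent_of_chart A (gchart p) ?q ?x'"
    by (simp add: velocity_def o_def vector_derivative_at tangent_of_chart_def chart_change_dmap)
  then have "g ?q (velocity A (\<lambda>t. gmul p (E (x t))) t) (velocity A (\<lambda>t. gmul p (E (x t))) t)
      = local_metric A g (gchart p) (x t) ?x' ?x'"
    by (simp add: local_metric_def Let_def)
  then show "sqrt (g ?q (velocity A (\<lambda>t. gmul p (E (x t))) t) (velocity A (\<lambda>t. gmul p (E (x t))) t))
      = norm (N (x t) ?x')"
    by (simp add: local_metric_gchart norm_eq_sqrt_inner)
qed

text \<open>The ball of radius \<open>r\<close> about any point, in the coordinates centred at that point.\<close>

definition reach :: "real \<Rightarrow> (real ^ 'n) set"
  where "reach r = {y. \<exists>I x. curve I x \<and> x 0 = 0 \<and> x 1 = y \<and> curve_length x < r}"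

lemma riemannian_ball_reach: "riemannian_ball A g p r = (\<lambda>x. gmul p (E x)) ` reach r"
proof (intro equalityI subsetI)
  let ?L = "\<lambda>q. {riemannian_length A g \<gamma> |\<gamma>. smooth_path A \<gamma> \<and> \<gamma> 0 = p \<and> \<gamma> 1 = q}"
  have path: "\<exists>I x. curve I x \<and> x 0 = 0 \<and> gmul p (E (x 1)) = q \<and> curve_length x = l" if "l \<in> ?L q" for l q
  proof -
    obtain \<gamma> where \<gamma>: "l = riemannian_length A g \<gamma>" "smooth_path A \<gamma>" "\<gamma> 0 = p" "\<gamma> 1 = q"
      using \<open>l \<in> ?L q\<close> by blast
    obtain I where I: "curve I (\<lambda>t. chart_map (gchart p) (\<gamma> t))" by (rule curve_smooth_path[OF \<gamma>(2)])
    have "inv E gunit = 0" by (metis E_0 inv_E(1))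
    then have "chart_map (gchart p) (\<gamma> 0) = 0" by (simp add: \<gamma>)
    moreover have "curve_length (\<lambda>t. chart_map (gchart p) (\<gamma> t)) = l"
      using riemannian_length_curve[OF I, of p] \<gamma>(1) by simp
    ultimately show ?thesis using I \<gamma>(4)
      by (intro exI[of _ I] exI[of _ "\<lambda>t. chart_map (gchart p) (\<gamma> t)"]) simp
  qed
  have bdd: "bdd_below (?L q)" for q
  proof (rule bdd_belowI[of _ 0])
    fix l assume "l \<in> ?L q"
    from path[OF this] show "0 \<le> l" using curve_length_nonneg by blast
  qed
  have length_in: "curve_length x \<in> ?L (gmul p (E (x 1)))" if "curve I x" "x 0 = 0" for I x
    using smooth_path_curve[OF that(1), of p] riemannian_length_curve[OF that(1), of p] that(2)
    by (intro CollectI exI[of _ "\<lambda>t. gmul p (E (x t))"]) simp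
  \<comment> \<open>The coordinate segment from the origin joins \<open>p\<close> to any
    \<open>q\<close>. This and the lower bound \<open>0\<close> are what make the infimum in
    \<open>riemannian_dist\<close> less than \<open>r\<close> exactly when some path is shorter than
    \<open>r\<close>.\<close>
  have ne: "?L q \<noteq> {}" for q
  proof -
    have "curve UNIV (\<lambda>t. t *\<^sub>R inv E (gmul (ginv p) q))"
      by (simp add: curve_def smooth_on_bounded_linear bounded_linear_scaleR_left)
    from length_in[OF this] show ?thesis by force
  qed
  have iff: "q \<in> riemannian_ball A g p r \<longleftrightarrow> (\<exists>l\<in>?L q. l < r)" for q
    unfolding riemannian_ball_def riemannian_dist_def mem_Collect_eq by (rule cInf_less_iff[OF ne bdd])
  {
    fix q assume "q \<in> riemannian_ball A g p r"
    then obtain l where l: "l \<in> ?L q" "l < r" using iff by blast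
    obtain I x where x: "curve I x" "x 0 = 0" "gmul p (E (x 1)) = q" "curve_length x = l" using path[OF l(1)] by blast
    then have "x 1 \<in> reach r" using l(2) unfolding reach_def by blast
    then show "q \<in> (\<lambda>x. gmul p (E x)) ` reach r" using x(3) by blast
  next
    fix q assume "q \<in> (\<lambda>x. gmul p (E x)) ` reach r"
    then obtain I x where x: "curve I x" "x 0 = 0" "q = gmul p (E (x 1))" "curve_length x < r"
      unfolding reach_def by blast
    then show "q \<in> riemannian_ball A g p r" using length_in[OF x(1,2)] iff by blast
  }
qed

text \<open>The endpoint of a curve \<open>x\<close> is moved by passing to \<open>hmul (x t) (t *\<^sub>R w)\<close>, which changes the
  length by an amount proportional to \<open>norm w\<close>.\<close>

lemma open_reach: "open (reach r)"
proof (subst open_subopen, rule ballI)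
  fix y1 assume "y1 \<in> reach r"
  then obtain I x where x: "curve I x" "x 0 = 0" "x 1 = y1" "curve_length x < r" by (auto simp: reach_def)
  let ?x' = "\<lambda>t. vector_derivative x (at t)"
  obtain K where K: "K \<ge> 0" "\<And>u v. norm (b u v) \<le> norm u * norm v * K" using nonneg_bounded by blast
  \<comment> \<open>The speed grows by at most \<open>norm w\<close> times
    \<open>1 + K * norm (?x' t)\<close>; \<open>C\<close> is the integral of that factor.\<close>
  define C where "C = 1 + K * integral {0..1} (\<lambda>t. norm (?x' t))"
  let ?w = "hmul (- y1)"
  let ?O = "{y. curve_length x + norm (?w y) * C < r}"
  have "open ?O" by (intro open_Collect_less continuous_intros)
  moreover have "y1 \<in> ?O" using x(4) by simp
  moreover have "?O \<subseteq> reach r"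
  proof
    fix y assume y: "y \<in> ?O"
    \<comment> \<open>This \<open>w\<close> solves \<open>hmul y1 w = y\<close>, so the modified
      curve ends at \<open>y\<close>.\<close>
    define w where "w = ?w y"
    define z where "z t = hmul (x t) (t *\<^sub>R w)" for t :: real
    define z' where "z' t = ?x' t + w + (1/2) *\<^sub>R (b (x t) w + b (?x' t) (t *\<^sub>R w))" for t :: real
    have I: "open I" "{0..1} \<subseteq> I" "smooth_on I x" using x(1) by (auto simp: curve_def)
    have "smooth_on I (\<lambda>t. t *\<^sub>R w)" by (simp add: smooth_on_bounded_linear bounded_linear_scaleR_left)
    then have "smooth_on I z"
      unfolding z_def[abs_def] hmul_def smooth_on_def using I
      by (intro allI Ck_on_add Ck_on_bounded_linear_compose[OF bounded_linear_scaleR_right] Ck_on_bilinear[OF bilinear])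
        (auto simp: smooth_on_def)
    then have z: "curve I z" using I by (simp add: curve_def)
    have dz: "vector_derivative z (at t) = z' t" if "t \<in> {0..1}" for t
    proof (rule vector_derivative_at)
      have xt: "(x has_vector_derivative ?x' t) (at t)" using curve_derivative[OF x(1)] that I by blast
      have wt: "((\<lambda>t. t *\<^sub>R w) has_vector_derivative w) (at t)"
        by (auto intro!: derivative_eq_intros)
      show "(z has_vector_derivative z' t) (at t)"
        unfolding z_def[abs_def] z'_def hmul_def
        by (intro has_vector_derivative_add xt wt
            bounded_linear.has_vector_derivative[OF bounded_linear_scaleR_right]
            bounded_bilinear.has_vector_derivative[OF bilinear])
    qed
    \<comment> \<open>Moved back to the identity, the velocity of \<open>z\<close> is that of
      \<open>x\<close> plus terms linear in \<open>w\<close>. The contributions of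
      \<open>b (x t) w\<close> cancel, so the position of the curve does not enter the
      bound.\<close>
    have Nz: "N (z t) (z' t) = N (x t) (?x' t) + w + t *\<^sub>R b (?x' t) w" for t
    proof -
      have "b w (?x' t) = - b (?x' t) w" by (rule antisym)
      then have bz: "b (z t) (z' t) = b (x t) (?x' t) + b (x t) w - t *\<^sub>R b (?x' t) w"
        by (simp add: z_def z'_def hmul_def add_left add_right scaleR_left scaleR_right)
      have "b (?x' t) (t *\<^sub>R w) = t *\<^sub>R b (?x' t) w" by (rule scaleR_right)
      then show ?thesis
        unfolding N_def bz unfolding z'_def by (simp only: velocity_identity)
    qed
    have le: "norm (N (z t) (vector_derivative z (at t))) \<le>
        norm (N (x t) (?x' t)) + norm w * (1 + K * norm (?x' t))" if t: "t \<in> {0..1}" for t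
    proof -
      have "norm (t *\<^sub>R b (?x' t) w) \<le> 1 * norm (b (?x' t) w)"
        using t by (simp add: mult_left_le_one_le)
      also have "\<dots> \<le> norm (?x' t) * norm w * K" using K(2) by simp
      finally show ?thesis
        unfolding dz[OF t] Nz
        using norm_triangle_ineq[of "N (x t) (?x' t) + w" "t *\<^sub>R b (?x' t) w"] norm_triangle_ineq[of "N (x t) (?x' t)" w]
        by (simp add: algebra_simps)
    qed
    have int: "(\<lambda>t. norm (N (x t) (?x' t))) integrable_on {0..1}" "(\<lambda>t. norm (?x' t)) integrable_on {0..1}"
      by (intro integrable_continuous_real continuous_on_speed[OF x(1)] continuous_on_norm continuous_on_velocity[OF x(1)])+
    have "curve_length z \<le> integral {0..1} (\<lambda>t. norm (N (x t) (?x' t)) + norm w * (1 + K * norm (?x' t)))"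
      unfolding curve_length_def
      by (intro integral_le integrable_continuous_real continuous_on_speed[OF z] le continuous_intros continuous_on_speed[OF x(1)]
          continuous_on_velocity[OF x(1)])
    also have "\<dots> = curve_length x + norm w * C"
    proof -
      have "((\<lambda>t. norm (N (x t) (?x' t)) + norm w * (1 + K * norm (?x' t))) has_integral
          (curve_length x + norm w * (1 + K * integral {0..1} (\<lambda>t. norm (?x' t))))) {0..1}"
        unfolding curve_length_def
        by (intro has_integral_add has_integral_mult_right integrable_integral int)
          (use has_integral_const_real[of "1::real" 0 1] in simp)
      then show ?thesis by (simp add: integral_unique C_def)
    qed
    also have "\<dots> < r" using y by (simp add: w_def)
    finally have "curve_length z < r" .
    moreover have "z 0 = 0" "z 1 = y" by (simp_all add: z_def x w_def)
    ultimately show "y \<in> reach r" using z unfolding reach_def by blast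
  qed
  ultimately show "\<exists>T. open T \<and> y1 \<in> T \<and> T \<subseteq> reach r" by blast
qed

section \<open>Dilations and the ratio of volumes\<close>

lemma dilation_proj: "coord_dilation J l v = l *\<^sub>R coord_proj J v + l\<^sup>2 *\<^sub>R (v - coord_proj J v)"
  by (simp add: coord_dilation_def coord_proj_def vec_eq_iff)

text \<open>Brackets depend only on the first-layer components, and each of these is scaled by
  \<open>l\<close>. Together with \<open>dilation_bracket\<close> this makes the dilation an
  automorphism of the bracket.\<close>

lemma bracket_dilation: "b (coord_dilation J l v) (coord_dilation J l w) = l\<^sup>2 *\<^sub>R b v w"
proof -
  have "b (v - coord_proj J v) w = 0" "b v (w - coord_proj J w) = 0" for v w
    using P(3)[of v w] bracket_proj[of v w] by (simp_all add: diff_left diff_right)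
  then show ?thesis
    by (simp add: dilation_proj add_left add_right scaleR_left scaleR_right P(3) bracket_proj power2_eq_square)
qed

lemma dilation_bracket: "coord_dilation J l (b v w) = l\<^sup>2 *\<^sub>R b v w"
  by (simp add: dilation_proj P(2))

text \<open>An automorphism commutes with moving velocities back to the identity, so its effect on
  the length of a curve is its effect on the norm there.\<close>

lemma N_dilation: "N (coord_dilation J l x) (coord_dilation J l v) = coord_dilation J l (N x v)"
  by (simp add: N_def bracket_dilation dilation_bracket linear_diff[OF linear_coord_dilation] linear_cmul[OF linear_coord_dilation])

lemma dilation_reach:
  assumes l: "0 < l" "l \<le> 1"
  shows "coord_dilation J l ` reach R \<subseteq> reach (l * R)"
proof clarify
  fix y assume "y \<in> reach R"
  then obtain I x where x: "curve I x" "x 0 = 0" "x 1 = y" "curve_length x < R" by (auto simp: reach_def)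
  let ?d = "coord_dilation J l"
  let ?z = "\<lambda>t. ?d (x t)"
  have bl: "bounded_linear ?d" using linear_coord_dilation by (simp add: linear_conv_bounded_linear)
  have z: "curve I ?z"
    using x(1) Ck_on_bounded_linear_compose[OF bl] unfolding curve_def smooth_on_def by blast
  have "curve_length ?z \<le> integral {0..1} (\<lambda>t. l * norm (N (x t) (vector_derivative x (at t))))"
    unfolding curve_length_def
  proof (intro integral_le integrable_continuous_real continuous_on_speed[OF z] continuous_on_mult_left continuous_on_speed[OF x(1)])
    fix t :: real assume t: "t \<in> {0..1}"
    then have "t \<in> I" using x(1) by (auto simp: curve_def)
    then have "vector_derivative ?z (at t) = ?d (vector_derivative x (at t))"
      by (intro vector_derivative_at bounded_linear.has_vector_derivative[OF bl] curve_derivative[OF x(1)])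
    then show "norm (N (?z t) (vector_derivative ?z (at t))) \<le> l * norm (N (x t) (vector_derivative x (at t)))"
      by (simp add: N_dilation norm_coord_dilation_le l)
  qed
  also have "\<dots> = l * curve_length x" by (simp add: curve_length_def)
  also have "\<dots> < l * R" using x(4) l by simp
  finally have "curve_length ?z < l * R" .
  moreover have "?z 0 = 0" "?z 1 = ?d y" by (simp_all add: x linear_0[OF linear_coord_dilation])
  ultimately show "?d y \<in> reach (l * R)" using z unfolding reach_def by blast
qed

lemma volume_ratio:
  assumes \<nu>: "riemannian_volume A g \<nu>" and rR: "0 < r" "r \<le> R"
  shows "emeasure \<nu> (riemannian_ball A g p R) / emeasure \<nu> (riemannian_ball A g p r)
    \<le> ennreal ((R / r) ^ (card (- J) + 2 * card J))"
proof -
  let ?Q = "card (- J) + 2 * card J"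
  define l where "l = r / R"
  have l: "0 < l" "l \<le> 1" "l * R = r" "R / r = 1 / l" using rR by (simp_all add: l_def)
  let ?X = "emeasure lborel (reach R)" and ?Y = "emeasure lborel (reach r)"
  have "ennreal (l ^ ?Q) * ?X = emeasure lborel (coord_dilation J l ` reach R)"
    using emeasure_coord_dilation[OF l(1) open_reach] by simp
  also have "\<dots> \<le> ?Y"
    using dilation_reach[OF l(1,2), of R] open_reach by (intro emeasure_mono) (simp_all add: l(3))
  finally have le: "ennreal (l ^ ?Q) * ?X \<le> ?Y" .
  have "?X = ennreal ((1 / l) ^ ?Q) * (ennreal (l ^ ?Q) * ?X)"
    using l by (simp add: power_divide flip: mult.assoc ennreal_mult')
  also have "\<dots> \<le> ennreal ((1 / l) ^ ?Q) * ?Y" using le by (rule mult_left_mono) simp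
  finally have "?X / ?Y \<le> ennreal ((1 / l) ^ ?Q) * ?Y / ?Y" by (rule divide_right_mono_ennreal)
  also have "\<dots> = ennreal ((1 / l) ^ ?Q) * (?Y / ?Y)" by (simp add: ennreal_times_divide)
  also have "\<dots> \<le> ennreal ((1 / l) ^ ?Q) * 1"
  proof (rule mult_left_mono)
    \<comment> \<open>In \<open>ennreal\<close> both \<open>0 / 0\<close> and
      \<open>top / top\<close> are \<open>0\<close>, so the degenerate cases obey the bound as
      well.\<close>
    show "?Y / ?Y \<le> 1"
    proof (cases "?Y = 0 \<or> ?Y = top")
      case True
      then show ?thesis by (auto simp: divide_ennreal_def)
    next
      case False
      then show ?thesis by (simp add: ennreal_divide_self less_top)
    qed
  qed simp
  finally show ?thesis
    unfolding riemannian_ball_reach volume_gchart[OF \<nu> open_reach] l(4) by simp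
qed

end

theorem proposition1:
  fixes A :: "('g::{t2_space,second_countable_topology}, 'n::finite) chart set"
    and gmul :: "'g \<Rightarrow> 'g \<Rightarrow> 'g" and gunit :: 'g and ginv :: "'g \<Rightarrow> 'g"
    and g1 g2 :: "('g \<Rightarrow> real ^ 'n) set"
    and g :: "'g \<Rightarrow> real ^ 'n \<Rightarrow> real ^ 'n \<Rightarrow> real"
    and \<nu> :: "'g measure"
    and p :: 'g and r R :: real
  assumes "step_two_carnot_group A gmul gunit ginv g1 g2"
    and "riemannian_metric A g" and "left_invariant_metric A gmul g"
    and "riemannian_volume A g \<nu>"
    and "0 < r" and "r \<le> R"
  shows "emeasure \<nu> (riemannian_ball A g p R) / emeasure \<nu> (riemannian_ball A g p r)
           \<le> ennreal ((R / r) ^ (dim g1 + 2 * dim g2))"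
proof -
  have carnot: "lie_group A gmul gunit ginv" "connected (UNIV :: 'g set)" "simply_connected (UNIV :: 'g set)"
    "step_two_stratification A gmul g1 g2"
    using assms(1) by (simp_all add: step_two_carnot_group_def)
  interpret lie_group_charts A gmul gunit ginv by unfold_locales (rule carnot(1))
  define W where "W = (\<lambda>X. X gunit) ` g2"
  have W: "subspace W" "dim W = dim g2" "dim g1 + dim g2 = CARD('n)"
    "\<And>v w. bracket v w \<in> W" "\<And>v w. w \<in> W \<Longrightarrow> bracket v w = 0"
    using stratification_bracket[OF carnot(4)] by (simp_all add: W_def)
  have metric: "bilinear (g gunit)" "\<And>v w. g gunit v w = g gunit w v" "\<And>v. v \<noteq> 0 \<Longrightarrow> g gunit v v > 0"
    using assms(2) unfolding riemannian_metric_def by blast+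
  obtain T :: "real ^ 'n \<Rightarrow> real ^ 'n" and J where T: "linear T" "bij T" "\<And>v w. g gunit (T v) (T w) = v \<bullet> w"
    "T ` {x. \<forall>i. i \<notin> J \<longrightarrow> x $ i = 0} = W" "card J = dim W"
    by (rule adapted_orthonormal_frame[OF metric(1,2) _ W(1)]) (erule metric(3), rule that)
  have invT: "inv T (T v) = v" "T (inv T v) = v" for v
    using T(2) by (simp_all add: bij_is_inj bij_is_surj surj_f_inv_f)
  have lin_inv: "linear (inv T)" using T(1,2) by (simp add: bij_is_inj inj_linear_imp_inv_linear)
  define b where "b v w = inv T (bracket (T v) (T w))" for v w
  interpret br: bounded_bilinear bracket by (rule bilinear_bracket)
  have proj: "coord_proj J v = 0" if Tv: "T v \<in> W" for v
  proof -
    obtain x where x: "T v = T x" "\<forall>i. i \<notin> J \<longrightarrow> x $ i = 0" using Tv T(4) by blast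
    have "v = x" using arg_cong[OF x(1), of "inv T"] by (simp only: invT)
    then show ?thesis using x(2) by (simp add: coord_proj_def vec_eq_iff)
  qed
  \<comment> \<open>Subtracting the projection leaves only coordinates in \<open>J\<close>, which
    \<open>T\<close> maps into \<open>W\<close>. As \<open>W\<close> is central, \<open>b\<close>
    ignores this part of its arguments.\<close>
  have T_proj: "T (v - coord_proj J v) \<in> W" for v
    using T(4) by (auto simp: coord_proj_def)
  have left0: "bracket w v = 0" if "w \<in> W" for v w
    using W(5)[OF that] bracket_antisym[of w v] by simp
  have br: "step_two_bracket b"
  proof (rule step_two_bracket.intro)
    have "bilinear b"
      unfolding bilinear_def b_def
      by (intro conjI allI linearI) (simp_all add: linear_add[OF T(1)] linear_cmul[OF T(1)] linear_add[OF lin_inv]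
          linear_cmul[OF lin_inv] br.add_left br.add_right br.scaleR_left br.scaleR_right)
    then show "bounded_bilinear b" by (simp add: bilinear_conv_bounded_bilinear)
    show "b y x = - b x y" for x y
      unfolding b_def bracket_antisym[of "T y"] by (simp add: linear_neg[OF lin_inv])
    show "b (b x y) z = 0" for x y z
      by (simp add: b_def invT left0[OF W(4)] linear_0[OF lin_inv])
  qed
  have "adapted_frame A gmul gunit ginv b T (coord_proj J)"
  proof (rule adapted_frame.intro[OF lie_group_charts_axioms br], rule adapted_frame_axioms.intro)
    show "T (b v w) = bracket (T v) (T w)" for v w by (simp add: b_def invT)
    have "linear (coord_proj J)" by (rule linearI) (simp_all add: coord_proj_def vec_eq_iff)
    then show "bounded_linear (coord_proj J)" by (simp add: linear_conv_bounded_linear)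
    show "coord_proj J (b v w) = 0" for v w by (rule proj) (simp add: b_def invT W(4))
    show "b (coord_proj J v) w = b v w" for v w
    proof -
      have "bracket (T v - T (coord_proj J v)) (T w) = 0"
        using left0[OF T_proj] by (simp add: linear_diff[OF T(1)])
      then show ?thesis by (simp add: b_def br.diff_left)
    qed
  qed (use carnot T in auto)
  then interpret fr: adapted_frame A gmul gunit ginv b T "coord_proj J" .
  obtain E s F V \<epsilon> where "exponential_chart A gmul gunit ginv b T J E s F V \<epsilon> g"
  proof (rule fr.exponential_exists)
    fix E s F V \<epsilon>
    assume *: "bij E" "\<And>u v. E (fr.hmul u v) = gmul (E u) (E v)" "E 0 = gunit"
    "continuous_on UNIV E" "\<And>W. open W \<Longrightarrow> open (E ` W)"
    "\<epsilon> > 0" "smooth_on (ball 0 \<epsilon>) s" "(s has_derivative T) (at 0)"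
    "\<And>u. norm u < \<epsilon> \<Longrightarrow> s u \<in> V \<and> F (s u) = u \<and> E u = chart_inv c0 (s u)"
    "open V" "V \<subseteq> U0" "smooth_on V F"
    have "exponential_chart A gmul gunit ginv b T J E s F V \<epsilon> g"
      by (rule exponential_chart.intro[OF fr.adapted_frame_axioms], rule exponential_chart_axioms.intro)
        (use * assms(3) T(3) in auto)
    then show thesis by (rule that)
  qed
  then interpret ex: exponential_chart A gmul gunit ginv b T J E s F V \<epsilon> g .
  \<comment> \<open>\<open>J\<close> has \<open>dim g2\<close> elements and the layers together have
    dimension \<open>CARD('n)\<close>, so the weights of the frame add up to \<open>Q\<close> even
    though its first layer may differ from \<open>g1\<close>.\<close>
  have "card J + card (- J) = CARD('n)" 
    using card_Un_disjoint[of J "- J"] by (simp add: Compl_partition)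
  then have "card (- J) + 2 * card J = dim g1 + 2 * dim g2"
    using W(2,3) T(5) by simp
  then show ?thesis using ex.volume_ratio[OF assms(4-6)] by simp
qed

end
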